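(* An ordered distinguished collection can have a nonzero obstruction. More precisely, let $$A=\begin{bmatrix}20&-5&3&0&0\\-3&2&-1&1&0\\-16&4&-1&0&1\end{bmatrix},\qquad B=\begin{bmatrix}0&-1\\3&-4\\5&0\\-1&5\\-7&0\end{bmatrix}.$$ Put $\vartheta=15+\frac{\sqrt2}{100}$ and $w=(\vartheta-4,1,0,0,0)$, so that $wB=(3,-\vartheta)$, and take $v={}^t(0,1,0,-2,-3)$. Then $A$ is homogeneous, the direction $w$ is generic, and $v$ is a fake exponent in the direction $w$ for $\beta=Av={}^t(-5,0,1)$. The distinguished collection is $\mathcal N_v=\{\{3,4\},\{4,5\}\}$, this collection is ordered, and (computed with the Gale dual $B$) $$J_{\mathcal N_v}^{\mathrm{amb}}=\langle s_2,s_1^2\rangle\subsetneq\langle s_1,s_2\rangle=J_{\mathcal N_v}^{\mathrm{intr}} .$$ Hence $\dim_{\mathbb C}\mathfrak D_{\mathcal N_v}(e)=1$.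
   Context: System. $\mathbb N=\{0,1,2,\dots\}$. For a matrix $A=(a_{ij})\in\mathbb Z^{d\times n}$ of rank $d$, "homogeneous" means that its columns lie in an affine hyperplane not containing the origin. $L=\ker_{\mathbb Z}(A)$, $r=\operatorname{rank}L=n-d$; a Gale dual $B$ is an $n\times r$ integer matrix whose columns form a $\mathbb Z$-basis of $L$. For $u\in L$ write $u=u_+-u_-$ with $u_\pm\in\mathbb N^n$ of disjoint support. $I_A=\langle\partial^{u_+}-\partial^{u_-}\mid u\in L\rangle\subseteq\mathbb C[\partial_1,\dots,\partial_n]$. For $\beta\in\mathbb C^d$, $H_A(\beta)$ is the left ideal of the Weyl algebra in $x_1,\dots,x_n$ generated by $I_A$ and $\sum_j a_{ij}x_j\partial_j-\beta_i$ $(1\le i\le d)$. $\operatorname{in}_w$ takes terms of largest $w$-weight; $\operatorname{in}_{(-w,w)}$ is the initial ideal in the Weyl algebra for weights $-w$ on $x$, $w$ on $\partial$. A direction $w\in\mathbb R^n$ is generic if $\operatorname{in}_w(I_A)$ is a monomial ideal and $w$ lies in the interior of a full-dimensional cone of the small Gröbner fan of $H_A(\beta)$ (so $\operatorname{in}_{(-w',w')}(H_A(\beta))$ is constant for $w'$ in that interior). For $z\in\mathbb C^n$, $p\in\mathbb N^n$: $[z]_p=\prod_j z_j(z_j-1)\cdots(z_j-p_j+1)$. A fake exponent of $H_A(\beta)$ in the direction $w$ is $v\in\mathbb C^n$ with $Av=\beta$ and $[v]_p=0$ for every monomial $\partial^p\in\operatorname{in}_w(I_A)$. Negative supports. $\operatorname{nsupp}(z)=\{j\mid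 z_j\in\mathbb Z_{<0}\}$. For $u\in L$, $I_u=\operatorname{nsupp}(v+u)$; $I_0=\operatorname{nsupp}(v)$; $\mathcal S(v)=\{I_u\mid u\in L\}$. The distinguished collection is $\mathcal N_v=\{I\in\mathcal S(v)\mid w\cdot u\ge0\text{ for every }u\in L\text{ with }I_u=I\}$. A family $\mathcal N$ with $I_0\in\mathcal N\subseteq\mathcal N_v$ is ordered if $I\in\mathcal N$, $J\in\mathcal S(v)$, $J\subseteq I$ imply $J\in\mathcal N$. $K_{\mathcal N}=\bigcap_{I\in\mathcal N}I$. Obstruction module. $\widehat R=\mathbb C[[t_1,\dots,t_n]]$, $t^J=\prod_{j\in J}t_j$, $e=t^{I_0\setminus K_{\mathcal N}}$, $U=\langle At\rangle$ (entries of $At$), $M_{\mathcal N}=\langle t^{I\setminus K_{\mathcal N}}\mid I\in\mathcal N\rangle$, $P_{\mathcal N}(t)=\langle t^{(I\cup J)\setminus K_{\mathcal N}}\mid I\in\mathcal N,J\in\mathcal S(v)\setminus\mathcal N\rangle$, $\mathfrak D_{\mathcal N}(e)=\dfrac{(U+P_{\mathcal N}(t)):e}{(UM_{\mathcal N}+P_{\mathcal N}(t)):e}$. The two ideals. $S_0=\mathbb C[s_1,\dots,s_r]$; $\ell_j=(Bs)_j$, $\ell^Y=\prod_{j\in Y}\ell_j$ ($\ell^\varnothing=1$), $E=I_0\setminus K_{\mathcal N}$. Let $\{G_1,\dots,G_g\}$ be the inclusion-minimal members of $\{I\setminus K_{\mathcal N}\mid I\in\mathcal N\}$ and $\{H_1,\dots,H_h\}$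 the inclusion-minimal members of $\{(I\cup J)\setminus K_{\mathcal N}\mid I\in\mathcal N,\ J\in\mathcal S(v)\setminus\mathcal N\}$. Each $H_a$ contains some $G_i$; choose such an index $\iota(a)$. $F_{\mathcal N}=\bigoplus_{i}S_0(-|G_i|)\eta_i$, and $Z_{\mathcal N}\subseteq F_{\mathcal N}$ is generated by $\ell^{G_j\setminus G_i}\eta_i-\ell^{G_i\setminus G_j}\eta_j$ $(i<j)$ and $\ell^{H_a\setminus G_{\iota(a)}}\eta_{\iota(a)}$ $(1\le a\le h)$. Choose $i$ with $G_i\subseteq E$ and put $\epsilon_{\mathcal N}=\ell^{E\setminus G_i}\overline{\eta_i}\in F_{\mathcal N}/Z_{\mathcal N}$ (independent of the choices). $J_{\mathcal N}^{\mathrm{amb}}=\operatorname{Ann}_{S_0}(\epsilon_{\mathcal N})$, $J_{\mathcal N}^{\mathrm{intr}}=\langle\ell^{H_1},\dots,\ell^{H_h}\rangle:\ell^E$. *)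

theory Defs
  imports "HOL-Analysis.Analysis" "HOL-Library.Poly_Mapping"
begin

section \<open>Polynomials and ideals\<close>

text \<open>
  The variables of a polynomial ring are indexed by a finite type, and exponents are vectors of
  natural numbers, added componentwise; multiplication of finitely supported functions on a
  monoid is convolution, so the type below is the usual polynomial ring.
\<close>

type_synonym 'n mpoly = "(nat^'n) \<Rightarrow>\<^sub>0 complex"

definition mpoly_monom :: "nat^'n \<Rightarrow> 'n::finite mpoly" where
  "mpoly_monom p = Poly_Mapping.single p 1"

definition mpoly_var :: "'n \<Rightarrow> 'n::finite mpoly" where
  "mpoly_var j = mpoly_monom (axis j 1)"

definition ideal_gen :: "'a::comm_ring_1 set \<Rightarrow> 'a set" where
  "ideal_gen S = module.span (*) S"

definition ideal_sum :: "'a::comm_ring_1 set \<Rightarrow> 'a set \<Rightarrow> 'a set" where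
  "ideal_sum I J = {a + b | a b. a \<in> I \<and> b \<in> J}"

definition ideal_prod :: "'a::comm_ring_1 set \<Rightarrow> 'a set \<Rightarrow> 'a set" where
  "ideal_prod I J = ideal_gen {a * b | a b. a \<in> I \<and> b \<in> J}"

definition ideal_colon :: "'a::comm_ring_1 set \<Rightarrow> 'a \<Rightarrow> 'a set" where
  "ideal_colon I e = {f. f * e \<in> I}"

text \<open>The sum of the terms of largest weight.\<close>

definition initial_form :: "('k \<Rightarrow> real) \<Rightarrow> ('k \<Rightarrow>\<^sub>0 complex) \<Rightarrow> ('k \<Rightarrow>\<^sub>0 complex)" where
  "initial_form \<omega> f =
     (\<Sum>k | k \<in> Poly_Mapping.keys f \<and> (\<forall>k'\<in>Poly_Mapping.keys f. \<omega> k' \<le> \<omega> k).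
        Poly_Mapping.single k (Poly_Mapping.lookup f k))"

section \<open>The lattice, Gale duals and the toric ideal\<close>

definition homogeneous_matrix :: "int^'n^'d \<Rightarrow> bool" where
  "homogeneous_matrix A \<longleftrightarrow>
     (\<exists>(h::real^'d) b. h \<noteq> 0 \<and> b \<noteq> 0 \<and> (\<forall>j. column j (map_matrix real_of_int A) \<in> {x. h \<bullet> x = b}))"

definition full_row_rank :: "int^'n^'d \<Rightarrow> bool" where
  "full_row_rank A \<longleftrightarrow> rank (map_matrix real_of_int A) = CARD('d)"

definition kernel_lattice :: "int^'n^'d \<Rightarrow> (int^'n) set" where
  "kernel_lattice A = {u. A *v u = 0}"

text \<open>
  The columns of \<open>B\<close> form a basis of the lattice exactly when every lattice vector is a unique
  integer combination of them and all such combinations lie in the lattice.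
\<close>

definition gale_dual :: "int^'n^'d \<Rightarrow> int^'r^'n \<Rightarrow> bool" where
  "gale_dual A B \<longleftrightarrow> bij_betw (\<lambda>c. B *v c) UNIV (kernel_lattice A)"

definition pos_part :: "int^'n \<Rightarrow> nat^'n" where
  "pos_part u = (\<chi> j. nat (u $ j))"

definition neg_part :: "int^'n \<Rightarrow> nat^'n" where
  "neg_part u = (\<chi> j. nat (- (u $ j)))"

text \<open>Here the variables of the polynomial ring are the derivations.\<close>

definition toric_ideal :: "int^'n^'d \<Rightarrow> 'n::finite mpoly set" where
  "toric_ideal A =
     ideal_gen {mpoly_monom (pos_part u) - mpoly_monom (neg_part u) | u. u \<in> kernel_lattice A}"

definition poly_initial_ideal :: "real^'n \<Rightarrow> 'n::finite mpoly set \<Rightarrow> 'n mpoly set" where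
  "poly_initial_ideal w I = ideal_gen (initial_form (\<lambda>p. w \<bullet> (\<chi> j. real (p $ j))) ` I)"

definition monomial_ideal :: "'n::finite mpoly set \<Rightarrow> bool" where
  "monomial_ideal I \<longleftrightarrow> (\<exists>M. I = ideal_gen (mpoly_monom ` M))"

section \<open>The Weyl algebra and the hypergeometric ideal\<close>

definition falling :: "complex^'n \<Rightarrow> nat^'n \<Rightarrow> complex" where
  "falling z p = (\<Prod>j\<in>UNIV. \<Prod>k<p $ j. z $ j - of_nat k)"

text \<open>
  The Weyl algebra is realised as the ring of differential operators with polynomial coefficients
  acting on the polynomial ring in the variables \<open>x\<close>, with composition as multiplication.
  A finitely supported function \<open>P\<close> on pairs of exponents encodes the normally ordered
  expression \<open>\<Sum> P(a,b) x^a \<partial>^b\<close>; over the complex numbers distinct \<open>P\<close> give distinct operators.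
  In \<open>poly_deriv b\<close> the truncated subtraction of exponents is harmless, because
  \<open>falling m b\<close> vanishes unless \<open>b \<le> m\<close>.
\<close>

definition poly_deriv :: "nat^'n \<Rightarrow> 'n::finite mpoly \<Rightarrow> 'n mpoly" where
  "poly_deriv b f =
     (\<Sum>m\<in>Poly_Mapping.keys f.
        Poly_Mapping.single (m - b) (falling (\<chi> j. of_nat (m $ j)) b * Poly_Mapping.lookup f m))"

definition weyl_op :: "(((nat^'n) \<times> (nat^'n)) \<Rightarrow>\<^sub>0 complex) \<Rightarrow> 'n::finite mpoly \<Rightarrow> 'n mpoly" where
  "weyl_op P f =
     (\<Sum>(a, b)\<in>Poly_Mapping.keys P.
        Poly_Mapping.single a (Poly_Mapping.lookup P (a, b)) * poly_deriv b f)"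

definition weyl_algebra :: "('n::finite mpoly \<Rightarrow> 'n mpoly) set" where
  "weyl_algebra = range weyl_op"

definition weyl_left_ideal ::
    "('n::finite mpoly \<Rightarrow> 'n mpoly) set \<Rightarrow> ('n mpoly \<Rightarrow> 'n mpoly) set" where
  "weyl_left_ideal S =
     {(\<lambda>f. \<Sum>i<k. (P i \<circ> Q i) f) | (k::nat) P Q. \<forall>i<k. P i \<in> weyl_algebra \<and> Q i \<in> S}"

text \<open>A polynomial in the derivations, viewed as an operator with constant coefficients.\<close>

definition const_coeff_op :: "'n::finite mpoly \<Rightarrow> 'n mpoly \<Rightarrow> 'n mpoly" where
  "const_coeff_op q f =
     (\<Sum>p\<in>Poly_Mapping.keys q. Poly_Mapping.single 0 (Poly_Mapping.lookup q p) * poly_deriv p f)"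

definition euler_op :: "int^'n^'d \<Rightarrow> complex^'d \<Rightarrow> 'd \<Rightarrow> 'n::finite mpoly \<Rightarrow> 'n mpoly" where
  "euler_op A \<beta> i f =
     (\<Sum>j\<in>UNIV. of_int (A $ i $ j) * (mpoly_var j * poly_deriv (axis j 1) f))
       - Poly_Mapping.single 0 (\<beta> $ i) * f"

definition hypergeometric_ideal ::
    "int^'n^'d \<Rightarrow> complex^'d \<Rightarrow> ('n::finite mpoly \<Rightarrow> 'n mpoly) set" where
  "hypergeometric_ideal A \<beta> =
     weyl_left_ideal (const_coeff_op ` toric_ideal A \<union> range (euler_op A \<beta>))"

text \<open>
  The initial ideal for the weights \<open>-w\<close> on \<open>x\<close> and \<open>w\<close> on \<open>\<partial>\<close>; for these weights the associated
  graded ring is the Weyl algebra itself.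
\<close>

definition weyl_weight :: "real^'n \<Rightarrow> (nat^'n) \<times> (nat^'n) \<Rightarrow> real" where
  "weyl_weight w = (\<lambda>(a, b). (- w) \<bullet> (\<chi> j. real (a $ j)) + w \<bullet> (\<chi> j. real (b $ j)))"

definition weyl_initial_ideal ::
    "real^'n \<Rightarrow> ('n::finite mpoly \<Rightarrow> 'n mpoly) set \<Rightarrow> ('n mpoly \<Rightarrow> 'n mpoly) set" where
  "weyl_initial_ideal w I =
     weyl_left_ideal {weyl_op (initial_form (weyl_weight w) P) | P. weyl_op P \<in> I}"

text \<open>
  The small Groebner fan is given by its cells, the classes of directions with the same
  initial ideal; its closed cones are the closures of the cells, so that the interior of a
  full-dimensional cone is the (nonempty) interior of its cell.
\<close>

definition small_groebner_cells ::
    "('n::finite mpoly \<Rightarrow> 'n mpoly) set \<Rightarrow> (real^'n) set set" where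
  "small_groebner_cells I =
     UNIV // {(w, w'). weyl_initial_ideal w I = weyl_initial_ideal w' I}"

definition generic_direction :: "int^'n^'d \<Rightarrow> complex^'d \<Rightarrow> real^'n::finite \<Rightarrow> bool" where
  "generic_direction A \<beta> w \<longleftrightarrow>
     monomial_ideal (poly_initial_ideal w (toric_ideal A)) \<and>
     (\<exists>C\<in>small_groebner_cells (hypergeometric_ideal A \<beta>). w \<in> interior C)"

definition fake_exponent ::
    "int^'n^'d \<Rightarrow> complex^'d \<Rightarrow> real^'n::finite \<Rightarrow> complex^'n \<Rightarrow> bool" where
  "fake_exponent A \<beta> w v \<longleftrightarrow>
     map_matrix of_int A *v v = \<beta> \<and>
     (\<forall>p. mpoly_monom p \<in> poly_initial_ideal w (toric_ideal A) \<longrightarrow> falling v p = 0)"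

section \<open>Negative supports\<close>

definition nsupp :: "complex^'n \<Rightarrow> 'n set" where
  "nsupp z = {j. \<exists>k::int. k < 0 \<and> z $ j = of_int k}"

definition shifted_nsupp :: "complex^'n \<Rightarrow> int^'n \<Rightarrow> 'n set" where
  "shifted_nsupp v u = nsupp (v + (\<chi> j. of_int (u $ j)))"

definition nsupps :: "int^'n^'d \<Rightarrow> complex^'n \<Rightarrow> 'n set set" where
  "nsupps A v = shifted_nsupp v ` kernel_lattice A"

definition distinguished :: "int^'n^'d \<Rightarrow> real^'n \<Rightarrow> complex^'n \<Rightarrow> 'n set set" where
  "distinguished A w v =
     {I \<in> nsupps A v. \<forall>u\<in>kernel_lattice A. shifted_nsupp v u = I \<longrightarrow>
        w \<bullet> (\<chi> j. real_of_int (u $ j)) \<ge> 0}"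

definition ordered_family ::
    "int^'n^'d \<Rightarrow> real^'n \<Rightarrow> complex^'n \<Rightarrow> 'n set set \<Rightarrow> bool" where
  "ordered_family A w v N \<longleftrightarrow>
     nsupp v \<in> N \<and> N \<subseteq> distinguished A w v \<and>
     (\<forall>I\<in>N. \<forall>J\<in>nsupps A v. J \<subseteq> I \<longrightarrow> J \<in> N)"

text \<open>The index sets of the generators of \<open>M\<close> and \<open>P\<close>, with \<open>K = \<Inter>N\<close> removed.\<close>

definition member_sets :: "'n set set \<Rightarrow> 'n set set" where
  "member_sets N = {I - \<Inter>N | I. I \<in> N}"

definition nonmember_sets :: "int^'n^'d \<Rightarrow> complex^'n \<Rightarrow> 'n set set \<Rightarrow> 'n set set" where
  "nonmember_sets A v N = {(I \<union> J) - \<Inter>N | I J. I \<in> N \<and> J \<in> nsupps A v - N}"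

section \<open>Formal power series in several variables\<close>

typedef 'n mfps = "UNIV :: ((nat^'n::finite) \<Rightarrow> complex) set"
  morphisms mfps_nth Abs_mfps by simp

lemma mfps_eq_iff: "f = g \<longleftrightarrow> (\<forall>m. mfps_nth f m = mfps_nth g m)"
  by (simp add: mfps_nth_inject[symmetric] fun_eq_iff)

lemma mfps_nth_Abs [simp]: "mfps_nth (Abs_mfps f) = f"
  by (simp add: Abs_mfps_inverse)

lemma finite_exponents_le: "finite {k::nat^'n::finite. k \<le> m}"
proof -
  have "{k::nat^'n. k \<le> m} \<subseteq> vec_lambda ` (PiE UNIV (\<lambda>j. {..m $ j}))"
  proof
    fix k :: "nat^'n" assume "k \<in> {k. k \<le> m}"
    then have "vec_nth k \<in> PiE UNIV (\<lambda>j. {..m $ j})"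
      by (auto simp: less_eq_vec_def)
    then show "k \<in> vec_lambda ` (PiE UNIV (\<lambda>j. {..m $ j}))"
      by (metis image_eqI vec_nth_inverse)
  qed
  then show ?thesis
    by (rule finite_subset) (intro finite_imageI finite_PiE, auto)
qed

instantiation mfps :: (finite) comm_ring_1
begin

definition "0 = Abs_mfps (\<lambda>m. 0)"
definition "1 = Abs_mfps (\<lambda>m. if m = 0 then 1 else 0)"
definition "f + g = Abs_mfps (\<lambda>m. mfps_nth f m + mfps_nth g m)"
definition "f - g = Abs_mfps (\<lambda>m. mfps_nth f m - mfps_nth g m)"
definition "- f = Abs_mfps (\<lambda>m. - mfps_nth f m)"
definition "f * g = Abs_mfps (\<lambda>m. \<Sum>k | k \<le> m. mfps_nth f k * mfps_nth g (m - k))"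

instance
proof
  fix a b c :: "'a mfps"
  show "a * b * c = a * (b * c)"
  proof -
    have "(\<Sum>k | k \<le> m. (\<Sum>i | i \<le> k. mfps_nth a i * mfps_nth b (k - i)) * mfps_nth c (m - k)) =
          (\<Sum>i | i \<le> m. mfps_nth a i * (\<Sum>j | j \<le> m - i. mfps_nth b j * mfps_nth c (m - i - j)))"
      for m :: "nat^'a"
    proof -
      have "(\<Sum>k | k \<le> m. (\<Sum>i | i \<le> k. mfps_nth a i * mfps_nth b (k - i)) * mfps_nth c (m - k)) =
            (\<Sum>(k, i)\<in>Sigma {k. k \<le> m} (\<lambda>k. {i. i \<le> k}).
               mfps_nth a i * mfps_nth b (k - i) * mfps_nth c (m - k))"
        by (simp add: sum_distrib_right sum.Sigma finite_exponents_le)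
      also have "\<dots> = (\<Sum>(i, j)\<in>Sigma {i. i \<le> m} (\<lambda>i. {j. j \<le> m - i}).
               mfps_nth a i * (mfps_nth b j * mfps_nth c (m - i - j)))"
      proof (rule sum.reindex_bij_witness[where i = "\<lambda>(i, j). (i + j, i)" and j = "\<lambda>(k, i). (i, k - i)"])
        fix x assume "x \<in> Sigma {k. k \<le> m} (\<lambda>k. {i. i \<le> k})"
        then obtain k i where x: "x = (k, i)" "k \<le> m" "i \<le> k" by auto
        have k: "i + (k - i) = k" using x by (auto simp: vec_eq_iff less_eq_vec_def)
        have mk: "m - i - (k - i) = m - k" using x by (auto simp: vec_eq_iff less_eq_vec_def)
        show "(case case x of (k, i) \<Rightarrow> (i, k - i) of (i, j) \<Rightarrow> (i + j, i)) = x"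
          using x k by simp
        show "(case x of (k, i) \<Rightarrow> (i, k - i)) \<in> Sigma {i. i \<le> m} (\<lambda>i. {j. j \<le> m - i})"
          using x by (auto simp: less_eq_vec_def intro: order_trans diff_le_mono)
        show "(case case x of (k, i) \<Rightarrow> (i, k - i) of (i, j) \<Rightarrow>
                 mfps_nth a i * (mfps_nth b j * mfps_nth c (m - i - j))) =
              (case x of (k, i) \<Rightarrow> mfps_nth a i * mfps_nth b (k - i) * mfps_nth c (m - k))"
          using x mk by (simp add: mult.assoc)
      next
        fix y assume "y \<in> Sigma {i. i \<le> m} (\<lambda>i. {j. j \<le> m - i})"
        then obtain i j where y: "y = (i, j)" "i \<le> m" "j \<le> m - i" by auto
        have "i + j - i = j" by (simp add: vec_eq_iff)
        then show "(case case y of (i, j) \<Rightarrow> (i + j, i) of (k, i) \<Rightarrow> (i, k - i)) = y"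
          using y by simp
        have "i $ l + j $ l \<le> m $ l" for l
          using y(2)[unfolded less_eq_vec_def, rule_format, of l]
            y(3)[unfolded less_eq_vec_def, rule_format, of l] by simp
        then show "(case y of (i, j) \<Rightarrow> (i + j, i)) \<in> Sigma {k. k \<le> m} (\<lambda>k. {i. i \<le> k})"
          using y by (auto simp: less_eq_vec_def)
      qed
      also have "\<dots> = (\<Sum>i | i \<le> m. mfps_nth a i * (\<Sum>j | j \<le> m - i. mfps_nth b j * mfps_nth c (m - i - j)))"
        by (simp add: sum_distrib_left sum.Sigma finite_exponents_le)
      finally show ?thesis .
    qed
    then show ?thesis by (simp add: times_mfps_def mfps_eq_iff)
  qed
  show "a * b = b * a"
  proof -
    have "(\<Sum>k | k \<le> m. mfps_nth a k * mfps_nth b (m - k)) =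
          (\<Sum>k | k \<le> m. mfps_nth b k * mfps_nth a (m - k))" for m :: "nat^'a"
    proof (rule sum.reindex_bij_witness[where i = "\<lambda>k. m - k" and j = "\<lambda>k. m - k"])
      fix k :: "nat^'a" assume "k \<in> {k. k \<le> m}"
      then show k: "m - (m - k) = k" by (auto simp: less_eq_vec_def vec_eq_iff)
      show "m - k \<in> {k. k \<le> m}" by (simp add: less_eq_vec_def)
      show "mfps_nth b (m - k) * mfps_nth a (m - (m - k)) = mfps_nth a k * mfps_nth b (m - k)"
        by (simp add: k mult.commute)
    qed (auto simp: less_eq_vec_def vec_eq_iff)
    then show ?thesis by (simp add: times_mfps_def mfps_eq_iff)
  qed
  show "1 * a = a"
  proof -
    have "(\<Sum>k | k \<le> m. (if k = 0 then 1 else 0) * mfps_nth a (m - k)) = mfps_nth a m"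
      for m :: "nat^'a"
    proof -
      have "(\<Sum>k | k \<le> m. (if k = 0 then 1 else 0) * mfps_nth a (m - k)) =
            (\<Sum>k\<in>{0}. mfps_nth a (m - k))"
        by (rule sum.mono_neutral_cong_right[OF finite_exponents_le]) (auto simp: less_eq_vec_def)
      moreover have "m - 0 = m" by (simp add: vec_eq_iff)
      ultimately show ?thesis by simp
    qed
    then show ?thesis by (simp add: times_mfps_def one_mfps_def mfps_eq_iff)
  qed
  show "(0::'a mfps) \<noteq> 1"
    by (auto simp: zero_mfps_def one_mfps_def mfps_eq_iff)
  show "(a + b) * c = a * c + b * c"
    by (simp add: times_mfps_def plus_mfps_def mfps_eq_iff distrib_right sum.distrib)
qed (simp_all add: zero_mfps_def plus_mfps_def minus_mfps_def uminus_mfps_def mfps_eq_iff)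

end

definition mfps_const :: "complex \<Rightarrow> 'n::finite mfps" where
  "mfps_const c = Abs_mfps (\<lambda>m. if m = 0 then c else 0)"

definition mfps_var :: "'n \<Rightarrow> 'n::finite mfps" where
  "mfps_var j = Abs_mfps (\<lambda>m. if m = axis j 1 then 1 else 0)"

definition mfps_sqfree :: "'n set \<Rightarrow> 'n::finite mfps" where
  "mfps_sqfree J = (\<Prod>j\<in>J. mfps_var j)"

section \<open>The obstruction module\<close>

definition U_ideal :: "int^'n^'d \<Rightarrow> 'n::finite mfps set" where
  "U_ideal A = ideal_gen (range (\<lambda>i. \<Sum>j\<in>UNIV. of_int (A $ i $ j) * mfps_var j))"

definition M_ideal :: "'n set set \<Rightarrow> 'n::finite mfps set" where
  "M_ideal N = ideal_gen (mfps_sqfree ` member_sets N)"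

definition P_ideal :: "int^'n^'d \<Rightarrow> complex^'n \<Rightarrow> 'n set set \<Rightarrow> 'n::finite mfps set" where
  "P_ideal A v N = ideal_gen (mfps_sqfree ` nonmember_sets A v N)"

definition obstruction_num ::
    "int^'n^'d \<Rightarrow> complex^'n \<Rightarrow> 'n set set \<Rightarrow> 'n mfps \<Rightarrow> 'n::finite mfps set" where
  "obstruction_num A v N e = ideal_colon (ideal_sum (U_ideal A) (P_ideal A v N)) e"

definition obstruction_den ::
    "int^'n^'d \<Rightarrow> complex^'n \<Rightarrow> 'n set set \<Rightarrow> 'n mfps \<Rightarrow> 'n::finite mfps set" where
  "obstruction_den A v N e =
     ideal_colon (ideal_sum (ideal_prod (U_ideal A) (M_ideal N)) (P_ideal A v N)) e"

text \<open>
  The quotient of the complex vector space \<open>V\<close> by its subspace \<open>W\<close> has dimension \<open>n\<close>: there are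
  \<open>n\<close> elements of \<open>V\<close> whose classes form a basis of the quotient.
\<close>

definition quotient_has_dim :: "'n::finite mfps set \<Rightarrow> 'n mfps set \<Rightarrow> nat \<Rightarrow> bool" where
  "quotient_has_dim V W n \<longleftrightarrow> W \<subseteq> V \<and>
     (\<exists>S. S \<subseteq> V \<and> finite S \<and> card S = n \<and>
        (\<forall>f\<in>V. \<exists>c. f - (\<Sum>b\<in>S. mfps_const (c b) * b) \<in> W) \<and>
        (\<forall>c. (\<Sum>b\<in>S. mfps_const (c b) * b) \<in> W \<longrightarrow> (\<forall>b\<in>S. c b = 0)))"

section \<open>The ambient and intrinsic ideals\<close>

definition minimal_members :: "'a set set \<Rightarrow> 'a set set" where
  "minimal_members F = {X \<in> F. \<forall>Y\<in>F. Y \<subseteq> X \<longrightarrow> Y = X}"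

definition linear_form :: "int^'r^'n \<Rightarrow> 'n \<Rightarrow> 'r::finite mpoly" where
  "linear_form B j = (\<Sum>k\<in>UNIV. of_int (B $ j $ k) * mpoly_var k)"

definition form_prod :: "int^'r^'n \<Rightarrow> 'n set \<Rightarrow> 'r::finite mpoly" where
  "form_prod B Y = (\<Prod>j\<in>Y. linear_form B j)"

definition G_sets :: "'n set set \<Rightarrow> 'n set set" where
  "G_sets N = minimal_members (member_sets N)"

definition H_sets :: "int^'n^'d \<Rightarrow> complex^'n \<Rightarrow> 'n set set \<Rightarrow> 'n set set" where
  "H_sets A v N = minimal_members (nonmember_sets A v N)"

text \<open>
  The free module has one basis element for each minimal set \<open>G\<close>; its elements are finitely
  supported functions on sets of indices (with support in \<open>G_sets N\<close>), and the basis element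
  of \<open>G\<close> is labelled by \<open>G\<close> itself. The degree shifts play no role for annihilators.
  Relations are listed for ordered pairs of minimal sets; exchanging the two sets only
  changes the sign, so this is the same submodule.
\<close>

type_synonym ('n, 'r) free_module = "'n set \<Rightarrow>\<^sub>0 'r mpoly"

definition fm_scale :: "'r::finite mpoly \<Rightarrow> ('n, 'r) free_module \<Rightarrow> ('n, 'r) free_module" where
  "fm_scale c = Poly_Mapping.map ((*) c)"

definition fm_basis :: "'n set \<Rightarrow> ('n, 'r::finite) free_module" where
  "fm_basis G = Poly_Mapping.single G 1"

definition choice_H ::
    "int^'n^'d \<Rightarrow> complex^'n \<Rightarrow> 'n set set \<Rightarrow> ('n set \<Rightarrow> 'n set) \<Rightarrow> bool" where
  "choice_H A v N \<iota> \<longleftrightarrow> (\<forall>H\<in>H_sets A v N. \<iota> H \<in> G_sets N \<and> \<iota> H \<subseteq> H)"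

definition choice_E :: "complex^'n \<Rightarrow> 'n set set \<Rightarrow> 'n set \<Rightarrow> bool" where
  "choice_E v N G \<longleftrightarrow> G \<in> G_sets N \<and> G \<subseteq> nsupp v - \<Inter>N"

definition Z_module ::
    "int^'n^'d \<Rightarrow> int^'r^'n \<Rightarrow> complex^'n \<Rightarrow> 'n set set \<Rightarrow> ('n set \<Rightarrow> 'n set) \<Rightarrow>
       ('n, 'r::finite) free_module set" where
  "Z_module A B v N \<iota> = module.span fm_scale
     ({fm_scale (form_prod B (G' - G)) (fm_basis G) - fm_scale (form_prod B (G - G')) (fm_basis G')
         | G G'. G \<in> G_sets N \<and> G' \<in> G_sets N \<and> G \<noteq> G'} \<union>
      {fm_scale (form_prod B (H - \<iota> H)) (fm_basis (\<iota> H)) | H. H \<in> H_sets A v N})"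

text \<open>
  The annihilator of the class of \<open>\<ell>^(E - G) \<eta>_G\<close> in the quotient of the free module by
  \<open>Z_module\<close>, where \<open>E = nsupp v - \<Inter>N\<close>.
\<close>

definition J_amb ::
    "int^'n^'d \<Rightarrow> int^'r^'n \<Rightarrow> complex^'n \<Rightarrow> 'n set set \<Rightarrow> ('n set \<Rightarrow> 'n set) \<Rightarrow> 'n set \<Rightarrow>
       'r::finite mpoly set" where
  "J_amb A B v N \<iota> G =
     {f. fm_scale f (fm_scale (form_prod B ((nsupp v - \<Inter>N) - G)) (fm_basis G))
           \<in> Z_module A B v N \<iota>}"

definition J_intr ::
    "int^'n^'d \<Rightarrow> int^'r^'n \<Rightarrow> complex^'n \<Rightarrow> 'n set set \<Rightarrow> 'r::finite mpoly set" where
  "J_intr A B v N =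
     ideal_colon (ideal_gen (form_prod B ` H_sets A v N)) (form_prod B (nsupp v - \<Inter>N))"

end

(*
Genericity of w comes from a Groebner argument in the Weyl algebra.  The hypergeometric ideal H
is graded by A, and w . u is nonzero for every nonzero u in the lattice because sqrt 2 is
irrational; so all weights occurring in an A-homogeneous operator are compared strictly by w
unless the terms have the same Z^n-degree.  Dickson's lemma, applied to pairs (leading exponent,
bound on the total degree), gives a finite A-homogeneous Groebner basis that respects the total
degree.  Finitely many strict inequalities persist near w, so its leading exponents and initial
forms do too; reducing within the finite-dimensional spaces of operators of bounded degree shows
that it remains a Groebner basis, and hence that the initial ideal is constant near w.

For the obstruction, with t_1,...,t_5 cut down by A t to the two parameters s, the collection
gives M = (t3, t5), P = (t2 t3, t1 t5) and e = t5.  The numerator is the maximal ideal, and the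
denominator consists of the series in it whose linear part vanishes on the first column of B, so
t3 spans the quotient.
*)

theory Submission
  imports Defs
begin

text \<open>The weights of the variables x are the negatives of those of the derivations, so
  ordering by weight has infinite descents and ordinary division need not stop. This is why total
  degrees are carried along: each basis element comes with a bound on its degree, no reduction may
  exceed the bound of the dividend, and below a fixed bound there are only finitely many exponents.
  The effect is that of homogenizing the ideal, without an extra variable. The obstruction has its
  origin in rows 3 and 5 of B, which are proportional: (5,0) and (-7,0). On the side of power series
  this puts 7 t3 + 5 t5 into U. On the side of polynomials the forms of indices 3 and 5 share the
  factor s1. Under the map sending each basis vector of the free module to the product of forms that
  it stands for, 7 \<eta>_3 + 5 \<eta>_5 goes to zero, but the relation imposed in the module is
  only s1 (7 \<eta>_3 + 5 \<eta>_5) = 0.\<close>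

abbreviation lookup where "lookup \<equiv> Poly_Mapping.lookup"
abbreviation keys where "keys \<equiv> Poly_Mapping.keys"
abbreviation single where "single \<equiv> Poly_Mapping.single"

section \<open>The Weyl algebra\<close>

(* Otherwise the simplifier turns axis j 1 into axis j (Suc 0). *)
declare One_nat_def [simp del]

text \<open>Scalars act throughout as multiplication by the constant \<open>single 0 c\<close>, for
  polynomials and symbols alike.\<close>

lemma lookup_cscale [simp]:
  "lookup (single 0 c * f) k = c * lookup f k"
  for f :: "'k::monoid_add \<Rightarrow>\<^sub>0 'a::semiring_0"
proof -
  have "lookup (Poly_Mapping.map ((*) c) f) k = c * lookup f k"
    by transfer (simp add: when_def)
  then show ?thesis by (simp add: mult_map_scale_conv_mult)
qed

lemma poly_mapping_decompose:
  "f = (\<Sum>k\<in>keys f. single k (lookup f k))"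
  by (rule poly_mapping_eqI)
     (simp add: lookup_sum lookup_single when_def not_in_keys_iff_lookup_eq_zero)

lemma lookup_single_mult_add:
  "lookup (single a c * f) (a + m) = c * lookup f m"
  for f :: "'k::cancel_comm_monoid_add \<Rightarrow>\<^sub>0 'a::semiring_0"
proof -
  have "single a c * f =
      (\<Sum>k\<in>keys f. single (a + k) (c * lookup f k))"
    by (subst (1) poly_mapping_decompose[of f]) (simp add: sum_distrib_left mult_single)
  then show ?thesis
    by (simp add: lookup_sum lookup_single when_def not_in_keys_iff_lookup_eq_zero)
qed

lemma vec_diff_add: "b \<le> k \<Longrightarrow> k - b + b = k" for b k :: "nat^'n::finite"
  by (auto simp: vec_eq_iff less_eq_vec_def)

lemma lookup_single_mult_vec:
  "lookup (single a c * f) m =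
     (if a \<le> m then c * lookup f (m - a) else 0)"
  for f :: "(nat^'n::finite) \<Rightarrow>\<^sub>0 'a::semiring_0"
proof (cases "a \<le> m")
  case True
  then have "m = a + (m - a)" by (auto simp: vec_eq_iff less_eq_vec_def)
  then show ?thesis using True lookup_single_mult_add[of a c f "m - a"] by simp
next
  case False
  have "m \<notin> keys (single a c * f)"
  proof
    assume "m \<in> keys (single a c * f)"
    then obtain b where "m = a + b"
      using keys_mult[of "single a c" f] by (auto split: if_splits)
    then show False using False by (auto simp: less_eq_vec_def)
  qed
  then show ?thesis using False by (simp add: in_keys_iff)
qed

section \<open>Derivatives of monomials and the Leibniz rule\<close>

definition nat_falling :: "nat^'n \<Rightarrow> nat^'n \<Rightarrow> complex" where
  "nat_falling m b = falling (\<chi> j. of_nat (m $ j)) b"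

lemma nat_falling_eq_0: "\<not> b \<le> m \<Longrightarrow> nat_falling m b = 0" for b :: "nat^'n::finite"
proof -
  assume "\<not> b \<le> m"
  then obtain j where j: "m $ j < b $ j" by (auto simp: less_eq_vec_def not_le)
  then have "(\<Prod>k<b $ j. (of_nat (m $ j) :: complex) - of_nat k) = 0"
    by (intro prod_zero) auto
  then show ?thesis unfolding nat_falling_def falling_def
    by (intro prod_zero) auto
qed

lemma falling_add: "falling z (p + q) = falling z p * falling (z - (\<chi> j. of_nat (p $ j))) q"
proof -
  have "(\<Prod>k<a + b. y - of_nat k) = (\<Prod>k<a. y - of_nat k) * (\<Prod>k<b. y - of_nat a - of_nat k)"
    for y :: complex and a b :: nat
    by (induction b) (simp_all add: algebra_simps)
  then show ?thesis by (simp add: falling_def prod.distrib)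
qed

lemma falling_axis: "falling z (axis j 1) = z $ j"
proof -
  have "(\<Prod>i\<in>UNIV. \<Prod>k<axis j (1::nat) $ i. z $ i - of_nat k) = (\<Prod>i\<in>UNIV. if i = j then z $ j else 1)"
    by (rule prod.cong) (auto simp: axis_def)
  then show ?thesis by (simp add: falling_def)
qed

lemma nat_falling_axis: "nat_falling m (axis j 1) = of_nat (m $ j)"
  by (simp add: nat_falling_def falling_axis)

lemma nat_falling_add:
  fixes m b c :: "nat^'a::finite"
  shows "nat_falling (m + b) (b + c) = nat_falling (m + b) b * nat_falling m c"
proof -
  have "(\<chi> j. of_nat ((m + b) $ j)) - (\<chi> j. of_nat (b $ j)) = ((\<chi> j. of_nat (m $ j)) :: complex^'a)"
    by (simp add: vec_eq_iff)
  then show ?thesis by (simp add: nat_falling_def falling_add)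
qed

lemma nat_falling_self: "nat_falling b b \<noteq> 0"
  by (auto simp: nat_falling_def falling_def)

text \<open>Indexing by the exponent of the result replaces the truncated subtraction by an
  addition. The terms of \<open>f\<close> for which truncation would matter carry the factor
  \<open>nat_falling k b = 0\<close>.\<close>

lemma lookup_poly_deriv:
  "lookup (poly_deriv b f) m = nat_falling (m + b) b * lookup f (m + b)"
proof -
  have "lookup (poly_deriv b f) m =
      (\<Sum>k\<in>keys f. if k = m + b then nat_falling k b * lookup f k else 0)"
    unfolding poly_deriv_def lookup_sum
  proof (rule sum.cong[OF refl])
    fix k assume "k \<in> keys f"
    show "lookup (single (k - b)
            (falling (\<chi> j. of_nat (k $ j)) b * lookup f k)) m =
          (if k = m + b then nat_falling k b * lookup f k else 0)"
    proof (cases "b \<le> k")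
      case True
      then have "k - b = m \<longleftrightarrow> k = m + b"
        by (metis vec_diff_add add_diff_cancel_right')
      then show ?thesis by (simp add: lookup_single when_def nat_falling_def)
    next
      case False
      then have "k \<noteq> m + b" by (auto simp: less_eq_vec_def)
      then show ?thesis using nat_falling_eq_0[OF False]
        by (simp add: lookup_single nat_falling_def)
    qed
  qed
  then show ?thesis by (simp add: not_in_keys_iff_lookup_eq_zero)
qed

lemma poly_deriv_add: "poly_deriv b (f + g) = poly_deriv b f + poly_deriv b g"
  by (rule poly_mapping_eqI) (simp add: lookup_poly_deriv lookup_add algebra_simps)

lemma poly_deriv_0 [simp]: "poly_deriv b 0 = 0"
  by (rule poly_mapping_eqI) (simp add: lookup_poly_deriv)

lemma poly_deriv_sum: "poly_deriv b (sum f S) = (\<Sum>i\<in>S. poly_deriv b (f i))"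
  by (induction S rule: infinite_finite_induct) (simp_all add: poly_deriv_add)

lemma poly_deriv_scale:
  "poly_deriv b (single 0 c * f) = single 0 c * poly_deriv b f"
  by (rule poly_mapping_eqI) (simp add: lookup_poly_deriv)

lemma poly_deriv_zero_exponent [simp]: "poly_deriv 0 f = f"
  by (rule poly_mapping_eqI) (simp add: lookup_poly_deriv nat_falling_def falling_def)

lemma poly_deriv_poly_deriv: "poly_deriv c (poly_deriv b f) = poly_deriv (b + c) f"
proof (rule poly_mapping_eqI)
  fix m
  have "nat_falling (m + c + b) (b + c) = nat_falling (m + c + b) b * nat_falling (m + c) c"
    by (rule nat_falling_add)
  then show "lookup (poly_deriv c (poly_deriv b f)) m =
      lookup (poly_deriv (b + c) f) m"
    by (simp add: lookup_poly_deriv add_ac)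
qed

text \<open>This is the Leibniz rule for x^a f. If \<open>a $ j = 0\<close>, the truncated exponent
  \<open>a - axis j 1\<close> is harmless because its coefficient vanishes.\<close>

lemma poly_deriv_axis_single_mult:
  "poly_deriv (axis j 1) (single a c * f) =
     single (a - axis j 1) (of_nat (a $ j) * c) * f
     + single a c * poly_deriv (axis j 1) f"
proof (rule poly_mapping_eqI)
  fix m
  let ?e = "axis j (1::nat)"
  have e: "a \<le> m \<Longrightarrow> m + ?e - a = m - a + ?e" by (auto simp: vec_eq_iff less_eq_vec_def)
  have e': "a $ j > 0 \<Longrightarrow> m + ?e - a = m - (a - ?e)" for m
    by (auto simp: vec_eq_iff axis_def)
  have le: "a - ?e \<le> m \<longleftrightarrow> a \<le> m + ?e"
    by (simp add: less_eq_vec_def le_diff_conv)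
  have le0: "a \<le> m + ?e \<longleftrightarrow> a \<le> m" if "a $ j = 0"
  proof -
    have "a $ i \<le> (m + ?e) $ i \<longleftrightarrow> a $ i \<le> m $ i" for i
      using that by (cases "i = j") (simp_all add: axis_def)
    then show ?thesis by (simp add: less_eq_vec_def)
  qed
  have nle: "a \<le> m \<Longrightarrow> a \<le> m + ?e" by (auto simp: less_eq_vec_def trans_le_add1)
  show "lookup (poly_deriv ?e (single a c * f)) m =
    lookup (single (a - ?e) (of_nat (a $ j) * c) * f
      + single a c * poly_deriv ?e f) m"
  proof (cases "a $ j = 0")
    case True
    show ?thesis
    proof (cases "a \<le> m")
      case le: True
      have "m - a + ?e = m + ?e - a" by (rule e[OF le, symmetric])
      then have *: "lookup f (m - a + ?e) = lookup f (m + ?e - a)"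
        by (rule arg_cong)
      show ?thesis
        unfolding lookup_poly_deriv lookup_add lookup_single_mult_vec nat_falling_axis le0[OF True] *
        using True le by simp
    next
      case nle: False
      then show ?thesis using True
        by (simp add: lookup_poly_deriv lookup_add lookup_single_mult_vec nat_falling_axis le0[OF True])
    qed
  next
    case False
    then have pos: "a $ j > 0" by simp
    \<comment> \<open>The boundary case: \<open>a\<close> exceeds \<open>m\<close> in coordinate
      \<open>j\<close> only, and there by one. The term with the derivative of \<open>f\<close> is
      then absent, and the whole coefficient comes from differentiating x^a.\<close>
    have bd: "m $ j + 1 = a $ j" if "a \<le> m + ?e" "\<not> a \<le> m"
    proof -
      obtain i where i: "\<not> a $ i \<le> m $ i" using \<open>\<not> a \<le> m\<close> by (auto simp: less_eq_vec_def)
      moreover have "a $ i \<le> m $ i + ?e $ i" using \<open>a \<le> m + ?e\<close> by (simp add: less_eq_vec_def)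
      ultimately show ?thesis by (cases "i = j") (auto simp: axis_def)
    qed
    have sh: "m - (a - ?e) = m + ?e - a" using e'[OF pos] by simp
    consider (both) "a \<le> m" "a \<le> m + ?e" | (edge) "\<not> a \<le> m" "a \<le> m + ?e" | (none) "\<not> a \<le> m" "\<not> a \<le> m + ?e"
      using nle by blast
    then show ?thesis
    proof cases
      case both
      have "a $ j \<le> m $ j" using both by (simp add: less_eq_vec_def)
      then have co: "of_nat ((m + ?e) $ j) = (of_nat (a $ j) + of_nat ((m - a + ?e) $ j) :: complex)"
        by (simp add: of_nat_diff)
      have idx: "lookup f (m - a + ?e) = lookup f (m + ?e - a)"
        by (rule arg_cong[OF e[OF both(1), symmetric]])
      show ?thesis
        unfolding lookup_poly_deriv lookup_add lookup_single_mult_vec nat_falling_axis le sh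
        unfolding idx co using both by (simp add: algebra_simps)
    next
      case edge
      have co: "of_nat ((m + ?e) $ j) = (of_nat (a $ j) :: complex)"
        using bd[OF edge(2,1)] by (simp flip: of_nat_Suc of_nat_add)
      show ?thesis
        unfolding lookup_poly_deriv lookup_add lookup_single_mult_vec nat_falling_axis le sh
        unfolding co using edge by simp
    next
      case none
      then show ?thesis
        unfolding lookup_poly_deriv lookup_add lookup_single_mult_vec nat_falling_axis le sh
        by simp
    qed
  qed
qed


text \<open>Summation over an arbitrary finite superset of the support lets two symbols be expanded
  over one index set.\<close>

lemma weyl_op_alt:
  assumes "finite S" "keys P \<subseteq> S"
  shows "weyl_op P f =
    (\<Sum>k\<in>S. single (fst k) (lookup P k) * poly_deriv (snd k) f)"
proof -
  have "weyl_op P f =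
    (\<Sum>k\<in>keys P. single (fst k) (lookup P k) * poly_deriv (snd k) f)"
    unfolding weyl_op_def by (rule sum.cong) (auto simp: split_beta)
  also have "\<dots> = (\<Sum>k\<in>S. single (fst k) (lookup P k) * poly_deriv (snd k) f)"
    by (rule sum.mono_neutral_left) (use assms in \<open>auto simp: in_keys_iff\<close>)
  finally show ?thesis .
qed

lemma weyl_op_single: "weyl_op (single k c) f = single (fst k) c * poly_deriv (snd k) f"
  by (subst weyl_op_alt[of "{k}"]) simp_all

lemma weyl_op_plus: "weyl_op (P + Q) f = weyl_op P f + weyl_op Q f"
proof -
  let ?S = "keys P \<union> keys Q"
  have "keys (P + Q) \<subseteq> ?S" by (rule keys_add)
  then show ?thesis
    by (simp add: weyl_op_alt[of ?S] lookup_add single_add distrib_right sum.distrib)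
qed

lemma weyl_op_0 [simp]: "weyl_op 0 f = 0"
  by (simp add: weyl_op_def)

lemma weyl_op_scale: "weyl_op (single 0 c * P) f = single 0 c * weyl_op P f"
proof -
  have "keys (single 0 c * P) \<subseteq> keys P"
    by (auto simp: in_keys_iff)
  moreover have "single a (c * d) = single 0 c * single a d"
    for a :: "nat^'a" and d by (simp add: mult_single)
  ultimately show ?thesis
    by (simp add: weyl_op_alt[of "keys P"] sum_distrib_left mult.assoc)
qed

lemma weyl_op_sum: "weyl_op (\<Sum>i\<in>S. P i) f = (\<Sum>i\<in>S. weyl_op (P i) f)"
  by (induction S rule: infinite_finite_induct) (simp_all add: weyl_op_plus)

lemma weyl_op_uminus: "weyl_op (- P) f = - weyl_op P f"
  using weyl_op_plus[of P "- P" f] by (simp add: eq_neg_iff_add_eq_0 add.commute)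

lemma weyl_op_minus: "weyl_op (P - Q) f = weyl_op P f - weyl_op Q f"
  using weyl_op_plus[of P "- Q" f] by (simp add: weyl_op_uminus)

section \<open>Left multiplication on normally ordered symbols\<close>

type_synonym 'n wexp = "(nat^'n) \<times> (nat^'n)"
type_synonym 'n wsym = "((nat^'n) \<times> (nat^'n)) \<Rightarrow>\<^sub>0 complex"

text \<open>The Z^n-degree of x^a \<partial>^b. The commutation relation of the Weyl algebra is
  homogeneous for it, though not for the total degree \<open>exp_deg\<close>.\<close>

definition exp_shift :: "'n::finite wexp \<Rightarrow> int^'n" where
  "exp_shift k = (\<chi> j. int (snd k $ j) - int (fst k $ j))"

definition exp_deg :: "'n::finite wexp \<Rightarrow> nat" where
  "exp_deg k = (\<Sum>j\<in>UNIV. fst k $ j + snd k $ j)"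

lemma exp_shift_add: "exp_shift (k + l) = exp_shift k + exp_shift l"
  by (simp add: exp_shift_def vec_eq_iff)

lemma exp_deg_add: "exp_deg (k + l) = exp_deg k + exp_deg l"
  by (simp add: exp_deg_def sum.distrib)

text \<open>
  Composing with a monomial operator on the left multiplies symbols by the monomial up to terms
  of lower total degree, because \<open>\<partial>\<^sub>j x\<^sub>j = x\<^sub>j \<partial>\<^sub>j + 1\<close>; the grading by \<open>exp_shift\<close> is respected.
\<close>

definition left_mult :: "'n wexp \<Rightarrow> ('n wsym \<Rightarrow> 'n::finite wsym) \<Rightarrow> bool"
  where "left_mult c T \<longleftrightarrow>
    (\<forall>P Q. T (P + Q) = T P + T Q) \<and>
    (\<forall>a P. T (single 0 a * P) = single 0 a * T P) \<and>
    (\<forall>k. \<exists>R. T (single k 1) = single (c + k) 1 + R \<and>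
       (\<forall>k'\<in>keys R. exp_shift k' = exp_shift (c + k) \<and> exp_deg k' < exp_deg (c + k))) \<and>
    (\<forall>P. weyl_op (T P) = weyl_op (single c 1) \<circ> weyl_op P)"

lemma left_mult_sum:
  assumes "left_mult c T"
  shows "T (\<Sum>i\<in>S. P i) = (\<Sum>i\<in>S. T (P i))"
proof -
  have "T 0 = T (single 0 0 * 0)" by simp
  also have "\<dots> = 0" using assms unfolding left_mult_def by (metis mult_zero_left single_zero)
  finally have "T 0 = 0" .
  then show ?thesis using assms
    by (induction S rule: infinite_finite_induct) (auto simp: left_mult_def)
qed

lemma left_mult_expand:
  assumes "left_mult c T"
  shows "T P = (\<Sum>k\<in>keys P. single 0 (lookup P k) * T (single k 1))"
proof -
  let ?g = "\<lambda>k. single 0 (lookup P k) * single k 1"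
  have "P = (\<Sum>k\<in>keys P. ?g k)"
    unfolding mult_single by (simp add: poly_mapping_decompose[symmetric])
  then have "T P = T (\<Sum>k\<in>keys P. ?g k)" by (rule arg_cong)
  also have "\<dots> = (\<Sum>k\<in>keys P. T (?g k))" by (rule left_mult_sum[OF assms])
  finally show ?thesis using assms by (simp add: left_mult_def)
qed

text \<open>Shift and degree are additive, so what \<open>T\<close> puts below \<open>d + k\<close>
  is moved by \<open>S\<close> below \<open>c + d + k\<close>. The assumption \<open>mon\<close>
  holds when no commutator arises between the two monomials: powers of x to the left of derivations,
  or derivations among themselves.\<close>

lemma left_mult_comp:
  assumes S: "left_mult c S" and T: "left_mult d T"
    and mon: "weyl_op (single (c + d) 1) = weyl_op (single c 1) \<circ> weyl_op (single d 1)"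
  shows "left_mult (c + d) (S \<circ> T)"
  unfolding left_mult_def
proof (intro conjI allI)
  fix k
  obtain R where R: "T (single k 1) = single (d + k) 1 + R"
    "\<forall>k'\<in>keys R. exp_shift k' = exp_shift (d + k) \<and> exp_deg k' < exp_deg (d + k)"
    using T unfolding left_mult_def by blast
  have addS: "S (P + Q) = S P + S Q" for P Q using S unfolding left_mult_def by blast
  define lower where "lower R k \<longleftrightarrow>
    (\<forall>k'\<in>keys R. exp_shift k' = exp_shift k \<and> exp_deg k' < exp_deg k)"
    for R :: "'a wsym" and k :: "'a wexp"
  have "\<forall>k. \<exists>R. S (single k 1) = single (c + k) 1 + R \<and> lower R (c + k)"
    using S unfolding left_mult_def lower_def by blast
  from choice[OF this] obtain Q where
    "\<forall>k. S (single k 1) = single (c + k) 1 + Q k \<and> lower (Q k) (c + k)" ..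
  then have Q: "S (single k 1) = single (c + k) 1 + Q k"
    "k' \<in> keys (Q k) \<Longrightarrow> exp_shift k' = exp_shift (c + k) \<and> exp_deg k' < exp_deg (c + k)"
    for k k' unfolding lower_def by blast+
  define Z where "Z = Q (d + k) + S R"
  have "(S \<circ> T) (single k 1) = single (c + d + k) 1 + Z"
    by (simp only: R(1) addS Q(1) Z_def comp_apply add.assoc)
  moreover have "exp_shift k' = exp_shift (c + d + k) \<and> exp_deg k' < exp_deg (c + d + k)"
    if Z: "k' \<in> keys Z" for k'
  proof -
    consider "k' \<in> keys (Q (d + k))" | "k' \<in> keys (S R)"
      using Z keys_add[of "Q (d + k)" "S R"] unfolding Z_def by blast
    then show ?thesis
    proof cases
      case 1 then show ?thesis using Q(2)[of k' "d + k"] by (simp only: add.assoc)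
    next
      case 2
      then obtain l where l: "l \<in> keys R"
        "k' \<in> keys (single 0 (lookup R l) * S (single l 1))"
        using subsetD[OF keys_sum 2[unfolded left_mult_expand[OF S, of R]]] by blast
      then have "k' \<in> keys (single (c + l) 1 + Q l)"
        by (auto simp: in_keys_iff Q(1))
      then have "k' = c + l \<or> k' \<in> keys (Q l)"
        using keys_add[of "single (c + l) (1::complex)" "Q l"] by auto
      then have "exp_shift k' = exp_shift (c + l) \<and> exp_deg k' \<le> exp_deg (c + l)"
        using Q(2)[of k' l] by auto
      moreover have "exp_shift l = exp_shift (d + k)" "exp_deg l < exp_deg (d + k)"
        using R(2) l(1) by blast+
      ultimately show ?thesis by (simp add: exp_shift_add exp_deg_add)
    qed
  qed
  ultimately show "\<exists>R. (S \<circ> T) (single k 1) = single (c + d + k) 1 + R \<and>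
    (\<forall>k'\<in>keys R. exp_shift k' = exp_shift (c + d + k) \<and> exp_deg k' < exp_deg (c + d + k))"
    by blast
next
  have opS: "weyl_op (S P) = weyl_op (single c 1) \<circ> weyl_op P" for P
    using S unfolding left_mult_def by blast
  have opT: "weyl_op (T P) = weyl_op (single d 1) \<circ> weyl_op P" for P
    using T unfolding left_mult_def by blast
  show "weyl_op ((S \<circ> T) P) = weyl_op (single (c + d) 1) \<circ> weyl_op P" for P
    by (simp only: comp_apply opS opT mon comp_assoc)
next
  fix P Q :: "'a wsym" and a :: complex
  show "(S \<circ> T) (P + Q) = (S \<circ> T) P + (S \<circ> T) Q"
    using S T unfolding left_mult_def comp_apply by metis
  show "(S \<circ> T) (single 0 a * P) = single 0 a * (S \<circ> T) P"
    using S T unfolding left_mult_def comp_apply by metis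
qed

lemma left_mult_x: "left_mult (a, 0) (\<lambda>P. single (a, 0) 1 * P)"
  unfolding left_mult_def
proof (intro conjI allI)
  fix P :: "'a wsym"
  have "single (a, 0) 1 * P =
      (\<Sum>k\<in>keys P. single ((a, 0) + k) (lookup P k))"
    by (subst (1) poly_mapping_decompose[of P]) (simp add: sum_distrib_left mult_single)
  moreover have "single (fst ((a, 0) + k)) c = single a 1 * single (fst k) c"
    for k :: "(nat^'a) \<times> (nat^'a)" and c :: complex by (simp add: mult_single)
  ultimately show "weyl_op (single (a, 0) 1 * P) = weyl_op (single (a, 0) 1) \<circ> weyl_op P"
    by (intro ext) (simp add: weyl_op_sum weyl_op_single weyl_op_alt[of "keys P" P]
        sum_distrib_left mult.assoc)
qed (auto simp: algebra_simps mult_single intro!: exI[of _ 0])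

text \<open>The second summand is the commutator of the derivation with x^a. When
  \<open>fst k $ j = 0\<close> its truncated exponent is multiplied by zero.\<close>

definition d_mult :: "'n \<Rightarrow> 'n wsym \<Rightarrow> 'n::finite wsym" where
  "d_mult j P = (\<Sum>k\<in>keys P.
     single ((0, axis j 1) + k) (lookup P k)
     + single (fst k - axis j 1, snd k) (of_nat (fst k $ j) * lookup P k))"

lemma d_mult_alt:
  assumes "finite S" "keys P \<subseteq> S"
  shows "d_mult j P = (\<Sum>k\<in>S.
     single ((0, axis j 1) + k) (lookup P k)
     + single (fst k - axis j 1, snd k) (of_nat (fst k $ j) * lookup P k))"
  unfolding d_mult_def
  by (rule sum.mono_neutral_left) (use assms in \<open>auto simp: in_keys_iff\<close>)

lemma left_mult_d: "left_mult (0, axis j 1) (d_mult j)"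
  unfolding left_mult_def
proof (intro conjI allI)
  let ?e = "axis j 1 :: nat^'a"
  fix P Q :: "'a wsym" and a :: complex and k :: "'a wexp"
  have "keys (P + Q) \<subseteq> keys P \<union> keys Q" by (rule keys_add)
  then show "d_mult j (P + Q) = d_mult j P + d_mult j Q"
    by (simp add: d_mult_alt[of "keys P \<union> keys Q"] lookup_add single_add
        distrib_left sum.distrib add_ac)
  have "keys (single 0 a * P) \<subseteq> keys P"
    by (auto simp: in_keys_iff)
  then show "d_mult j (single 0 a * P) = single 0 a * d_mult j P"
    by (simp add: d_mult_alt[of "keys P"] sum_distrib_left distrib_left mult_single
        mult.left_commute)
  define R where "R = single (fst k - ?e, snd k) (of_nat (fst k $ j) :: complex)"
  have "d_mult j (single k 1) = single ((0, ?e) + k) 1 + R"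
    by (simp add: d_mult_alt[of "{k}"] R_def)
  moreover have "exp_shift k' = exp_shift ((0, ?e) + k) \<and> exp_deg k' < exp_deg ((0, ?e) + k)"
    if "k' \<in> keys R" for k'
  proof -
    have k': "k' = (fst k - ?e, snd k)" and pos: "fst k $ j > 0"
      using that by (auto simp: R_def split: if_splits)
    \<comment> \<open>The commutator term lacks both the new derivation and one power of the
      variable: the shift is the same and the degree drops by two.\<close>
    have eq: "fst k = fst k' + ?e" using pos by (auto simp: k' vec_eq_iff axis_def)
    then have "exp_shift ((0, ?e) + k) = exp_shift k'"
      unfolding exp_shift_def vec_eq_iff by (simp add: eq) (simp add: k')
    moreover have "exp_deg ((0, ?e) + k) = exp_deg k' + (\<Sum>i\<in>UNIV. ?e $ i + ?e $ i)"
      unfolding exp_deg_def by (simp add: eq sum.distrib) (simp add: k')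
    moreover have "(\<Sum>i\<in>UNIV. ?e $ i + ?e $ i) > 0"
      by (rule sum_pos2[of _ j]) (simp_all add: axis_def)
    ultimately show ?thesis by simp
  qed
  ultimately show "\<exists>R. d_mult j (single k 1) = single ((0, ?e) + k) 1 + R \<and>
    (\<forall>k'\<in>keys R. exp_shift k' = exp_shift ((0, ?e) + k) \<and> exp_deg k' < exp_deg ((0, ?e) + k))"
    by blast
  show "weyl_op (d_mult j P) = weyl_op (single (0, ?e) 1) \<circ> weyl_op P"
  proof
    fix f
    have "weyl_op (d_mult j P) f = (\<Sum>k\<in>keys P.
        single (fst k) (lookup P k) * poly_deriv (?e + snd k) f
        + single (fst k - ?e) (of_nat (fst k $ j) * lookup P k) * poly_deriv (snd k) f)"
      by (simp add: d_mult_def weyl_op_sum weyl_op_plus weyl_op_single)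
    also have "\<dots> = poly_deriv ?e (weyl_op P f)"
      by (simp add: weyl_op_alt[of "keys P" P] poly_deriv_sum poly_deriv_axis_single_mult
          poly_deriv_poly_deriv add_ac)
    finally show "weyl_op (d_mult j P) f = (weyl_op (single (0, ?e) 1) \<circ> weyl_op P) f"
      by (simp add: weyl_op_single)
  qed
qed

lemma left_mult_d_exists: "\<exists>T. left_mult (0, b :: nat^'n::finite) T"
proof (induction "\<Sum>j\<in>UNIV. b $ j" arbitrary: b)
  case 0
  then have "b = 0" by (simp add: vec_eq_iff)
  then show ?case using left_mult_x[of 0] by auto
next
  case (Suc n)
  then obtain j where j: "b $ j > 0"
    by (metis (full_types) Zero_not_Suc finite_class.finite_UNIV not_gr_zero sum.neutral)
  define b' where "b' = b - axis j 1"
  have b: "b = axis j 1 + b'" using j by (auto simp: b'_def vec_eq_iff axis_def)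
  have "(\<Sum>i\<in>UNIV. axis j (1::nat) $ i) = 1" by (simp add: axis_def)
  then have "n = (\<Sum>j\<in>UNIV. b' $ j)" using Suc(2) by (simp add: b sum.distrib One_nat_def)
  then obtain T where T: "left_mult (0, b') T" using Suc(1) by blast
  have "left_mult ((0, axis j 1) + (0, b')) (d_mult j \<circ> T)"
    by (rule left_mult_comp[OF left_mult_d T])
       (auto simp: weyl_op_single poly_deriv_poly_deriv add_ac)
  then show ?case using b by auto
qed

lemma left_mult_exists: "\<exists>T. left_mult c T"
proof -
  obtain T where T: "left_mult (0, snd c) T" using left_mult_d_exists by blast
  have "left_mult ((fst c, 0) + (0, snd c)) ((\<lambda>P. single (fst c, 0) 1 * P) \<circ> T)"
    by (rule left_mult_comp[OF left_mult_x T]) (auto simp: weyl_op_single)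
  then show ?thesis by auto
qed

text \<open>The choice is in fact unique: the last clause of \<open>left_mult\<close> fixes the
  operator of \<open>T P\<close>, and \<open>weyl_op\<close> is injective.\<close>

definition weyl_lmult where "weyl_lmult c = (SOME T. left_mult c T)"

lemma left_mult_weyl_lmult: "left_mult c (weyl_lmult c)"
  unfolding weyl_lmult_def by (rule someI_ex[OF left_mult_exists])

lemmas weyl_lmult_single = left_mult_weyl_lmult[unfolded left_mult_def, THEN conjunct2, THEN conjunct2, THEN conjunct1, rule_format]
lemmas weyl_op_lmult = left_mult_weyl_lmult[unfolded left_mult_def, THEN conjunct2, THEN conjunct2, THEN conjunct2, rule_format]

text \<open>Choose (a, b) in the support with b of least total degree, apply the operator to x^b and
  read off the coefficient of x^a. A term (a', b') contributes only if b = (a - a') + b', and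
  minimality then forces a' = a and b' = b, so the coefficient is a nonzero multiple of that of (a,
  b).\<close>

lemma weyl_op_eq_0:
  assumes "\<And>f. weyl_op P f = 0"
  shows "P = 0"
proof (rule ccontr)
  assume "P \<noteq> 0"
  then have ne: "keys P \<noteq> {}" by simp
  define s where "s k = (\<Sum>j\<in>UNIV. snd k $ j)" for k :: "'a wexp"
  obtain k where k: "k \<in> keys P" "\<And>k'. k' \<in> keys P \<Longrightarrow> s k \<le> s k'"
    using ex_min_if_finite[OF _ ne] by (metis finite_keys not_le arg_min_if_finite(1,2) ne)
  obtain a b where ab: "k = (a, b)" by fastforce
  have "lookup (weyl_op P (single b 1)) a =
    (\<Sum>k'\<in>keys P. if k' = k then lookup P k * nat_falling b b else 0)"
    unfolding weyl_op_alt[of "keys P" P, OF finite_keys subset_refl] lookup_sum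
  proof (rule sum.cong[OF refl])
    fix k' assume k': "k' \<in> keys P"
    obtain a' b' where ab': "k' = (a', b')" by fastforce
    have lk: "lookup (single (fst k') (lookup P k') *
        poly_deriv (snd k') (single b 1)) a =
      (if a' \<le> a then lookup P k' * (nat_falling (a - a' + b') b' * (1 when b = a - a' + b')) else 0)"
      by (simp add: lookup_single_mult_vec lookup_poly_deriv ab' lookup_single)
    show "lookup (single (fst k') (lookup P k') *
        poly_deriv (snd k') (single b 1)) a =
      (if k' = k then lookup P k * nat_falling b b else 0)"
    proof (cases "a' \<le> a \<and> b = a - a' + b'")
      case True
      have "s k = s k' + (\<Sum>j\<in>UNIV. (a - a') $ j)"
        using True by (simp add: s_def ab ab' sum.distrib)
      then have "(\<Sum>j\<in>UNIV. (a - a') $ j) = 0" using k(2)[OF k'] by simp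
      then have "a - a' = 0" by (simp add: vec_eq_iff)
      then have "a = a'" "b = b'" using True vec_diff_add[of a' a] by auto
      then show ?thesis unfolding lk using ab ab' by simp
    next
      case False
      then have "k' \<noteq> k" using ab ab' by auto
      then show ?thesis unfolding lk using False by auto
    qed
  qed
  also have "\<dots> = lookup P k * nat_falling b b" using k(1) by simp
  finally show False using assms k(1) nat_falling_self[of b] by (simp add: in_keys_iff)
qed

lemma weyl_op_inject: "weyl_op P = weyl_op Q \<longleftrightarrow> P = Q"
  using weyl_op_eq_0[of "P - Q"] by (auto simp: weyl_op_minus)

section \<open>Left ideals and Groebner bases\<close>

lemma weyl_op_arg_add: "weyl_op P (f + g) = weyl_op P f + weyl_op P g"
  by (simp add: weyl_op_alt[of "keys P"] poly_deriv_add distrib_left sum.distrib)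

lemma weyl_op_arg_0: "weyl_op P 0 = 0"
  by (simp add: weyl_op_alt[of "keys P"])

lemma weyl_op_comp:
  "weyl_op P \<circ> weyl_op Q =
     weyl_op (\<Sum>k\<in>keys P. single 0 (lookup P k) * weyl_lmult k Q)"
proof
  fix f
  have "single (fst k) (lookup P k) * g =
      single 0 (lookup P k) * (single (fst k) 1 * g)"
    for k :: "'a wexp" and g :: "'a mpoly" by (simp add: mult_single flip: mult.assoc)
  then have "weyl_op P (weyl_op Q f) = (\<Sum>k\<in>keys P.
      single 0 (lookup P k) * weyl_op (single k 1) (weyl_op Q f))"
    unfolding weyl_op_alt[OF finite_keys subset_refl, of P] weyl_op_single by (rule sum.cong[OF refl])
  then show "(weyl_op P \<circ> weyl_op Q) f = weyl_op (\<Sum>k\<in>keys P.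
      single 0 (lookup P k) * weyl_lmult k Q) f"
    by (simp add: weyl_op_sum weyl_op_scale weyl_op_lmult)
qed

lemma weyl_algebra_comp: "P \<in> weyl_algebra \<Longrightarrow> Q \<in> weyl_algebra \<Longrightarrow> P \<circ> Q \<in> weyl_algebra"
  unfolding weyl_algebra_def using weyl_op_comp by auto

section \<open>Left ideals of operators and of symbols\<close>

lemma weyl_left_ideal_0: "(\<lambda>f. 0) \<in> weyl_left_ideal S"
  unfolding weyl_left_ideal_def by (rule CollectI, rule exI[of _ 0]) auto

lemma weyl_left_ideal_add_gen:
  assumes "T \<in> weyl_left_ideal S" "P \<in> weyl_algebra" "Q \<in> S"
  shows "(\<lambda>f. T f + P (Q f)) \<in> weyl_left_ideal S"
proof -
  obtain k Ps Qs where k: "T = (\<lambda>f. \<Sum>i<k. (Ps i \<circ> Qs i) f)" "\<forall>i<k::nat. Ps i \<in> weyl_algebra \<and> Qs i \<in> S"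
    using assms(1) unfolding weyl_left_ideal_def by blast
  have "(\<lambda>f. T f + P (Q f)) = (\<lambda>f. \<Sum>i<Suc k. ((Ps(k := P)) i \<circ> (Qs(k := Q)) i) f)"
    by (simp add: k(1))
  moreover have "\<forall>i<Suc k. (Ps(k := P)) i \<in> weyl_algebra \<and> (Qs(k := Q)) i \<in> S"
    using k(2) assms(2,3) by (auto simp: less_Suc_eq)
  ultimately show ?thesis unfolding weyl_left_ideal_def by blast
qed

lemma weyl_left_ideal_induct [consumes 1, case_names zero add]:
  assumes "T \<in> weyl_left_ideal S"
    and zero: "R (\<lambda>f. 0)"
    and add: "\<And>T P Q. T \<in> weyl_left_ideal S \<Longrightarrow> R T \<Longrightarrow> P \<in> weyl_algebra \<Longrightarrow> Q \<in> S \<Longrightarrow> R (\<lambda>f. T f + P (Q f))"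
  shows "R T"
proof -
  obtain k Ps Qs where k: "T = (\<lambda>f. \<Sum>i<k. (Ps i \<circ> Qs i) f)" "\<forall>i<k::nat. Ps i \<in> weyl_algebra \<and> Qs i \<in> S"
    using assms(1) unfolding weyl_left_ideal_def by blast
  have "l \<le> k \<Longrightarrow> (\<lambda>f. \<Sum>i<l. (Ps i \<circ> Qs i) f) \<in> weyl_left_ideal S \<and> R (\<lambda>f. \<Sum>i<l. (Ps i \<circ> Qs i) f)" for l
  proof (induction l)
    case 0 then show ?case using zero weyl_left_ideal_0 by simp
  next
    case (Suc l)
    then show ?case
      using add[of "\<lambda>f. \<Sum>i<l. (Ps i \<circ> Qs i) f" "Ps l" "Qs l"]
        weyl_left_ideal_add_gen[of "\<lambda>f. \<Sum>i<l. (Ps i \<circ> Qs i) f" S "Ps l" "Qs l"] k(2)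
      by simp
  qed
  then show ?thesis using k(1) by auto
qed

lemma weyl_left_ideal_add:
  assumes "T \<in> weyl_left_ideal S" "T' \<in> weyl_left_ideal S"
  shows "(\<lambda>f. T f + T' f) \<in> weyl_left_ideal S"
  using assms(2)
proof (induction rule: weyl_left_ideal_induct)
  case zero then show ?case using assms(1) by simp
next
  case (add T' P Q)
  then show ?case using weyl_left_ideal_add_gen[OF add.IH add.hyps(2,3)] by (simp add: add.assoc)
qed

lemma weyl_left_ideal_comp:
  assumes "T \<in> weyl_left_ideal S" "W \<in> weyl_algebra"
  shows "W \<circ> T \<in> weyl_left_ideal S"
  using assms(1)
proof (induction rule: weyl_left_ideal_induct)
  case zero
  have *: "W \<circ> (\<lambda>f::'a mpoly. 0) = (\<lambda>f. 0)"
    using assms(2) by (auto simp: weyl_algebra_def weyl_op_arg_0)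
  show ?case unfolding * by (rule weyl_left_ideal_0)
next
  case (add T P Q)
  have "W \<circ> (\<lambda>f. T f + P (Q f)) = (\<lambda>f. (W \<circ> T) f + (W \<circ> P) (Q f))"
    using assms(2) by (auto simp: weyl_algebra_def weyl_op_arg_add)
  then show ?case
    using weyl_left_ideal_add_gen[OF add.IH weyl_algebra_comp[OF assms(2) add.hyps(2)] add.hyps(3)] by simp
qed

lemma weyl_left_ideal_gen:
  assumes "Q \<in> S" shows "Q \<in> weyl_left_ideal S"
proof -
  have "weyl_op (single 0 1) f = f" for f :: "'a mpoly"
    unfolding weyl_op_single by simp
  then show ?thesis
    using weyl_left_ideal_add_gen[OF weyl_left_ideal_0, of "weyl_op (single 0 1)" Q S] assms
    by (auto simp: weyl_algebra_def)
qed

lemma weyl_left_ideal_mono: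
  assumes "S \<subseteq> weyl_left_ideal S'" shows "weyl_left_ideal S \<subseteq> weyl_left_ideal S'"
proof
  fix T assume "T \<in> weyl_left_ideal S"
  then show "T \<in> weyl_left_ideal S'"
  proof (induction rule: weyl_left_ideal_induct)
    case zero then show ?case by (rule weyl_left_ideal_0)
  next
    case (add T P Q)
    have "P \<circ> Q \<in> weyl_left_ideal S'" using weyl_left_ideal_comp[OF subsetD[OF assms add.hyps(3)] add.hyps(2)] .
    from weyl_left_ideal_add[OF add.IH this] show ?case by simp
  qed
qed

text \<open>A left ideal read off on symbols. Every operator is a linear combination of monomial
  ones, so closure under sums, scalars and \<open>weyl_lmult\<close> amounts to closure under the
  whole Weyl algebra.\<close>

definition sym_ideal :: "'n::finite wsym set \<Rightarrow> bool" where
  "sym_ideal I \<longleftrightarrow> 0 \<in> I \<and> (\<forall>P\<in>I. \<forall>Q\<in>I. P + Q \<in> I) \<and>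
     (\<forall>a. \<forall>P\<in>I. single 0 a * P \<in> I) \<and> (\<forall>c. \<forall>P\<in>I. weyl_lmult c P \<in> I)"

lemma sym_idealD:
  assumes "sym_ideal I"
  shows "0 \<in> I" "P \<in> I \<Longrightarrow> Q \<in> I \<Longrightarrow> P + Q \<in> I" "P \<in> I \<Longrightarrow> single 0 a * P \<in> I"
    "P \<in> I \<Longrightarrow> weyl_lmult c P \<in> I"
  using assms unfolding sym_ideal_def by blast+

lemma sym_ideal_weyl_left_ideal: "sym_ideal {P. weyl_op P \<in> weyl_left_ideal S}"
  unfolding sym_ideal_def
proof (intro conjI ballI allI; unfold mem_Collect_eq)
  have "weyl_op 0 = (\<lambda>f::'a mpoly. 0)" by auto
  then show "weyl_op 0 \<in> weyl_left_ideal S" using weyl_left_ideal_0[of S] by simp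
next
  fix P Q :: "'a wsym" assume "weyl_op P \<in> weyl_left_ideal S" "weyl_op Q \<in> weyl_left_ideal S"
  from weyl_left_ideal_add[OF this]
  show "weyl_op (P + Q) \<in> weyl_left_ideal S" by (simp add: weyl_op_plus[abs_def])
next
  fix P :: "'a wsym" and a :: complex assume "weyl_op P \<in> weyl_left_ideal S"
  from weyl_left_ideal_comp[OF this, of "weyl_op (single 0 a)"]
  have "weyl_op (single 0 a) \<circ> weyl_op P \<in> weyl_left_ideal S"
    by (simp add: weyl_algebra_def)
  moreover have "weyl_op (single 0 a) \<circ> weyl_op P = weyl_op (single 0 a * P)"
    by (auto simp: weyl_op_scale weyl_op_single)
  ultimately show "weyl_op (single 0 a * P) \<in> weyl_left_ideal S" by simp
next
  fix P :: "'a wsym" and c assume "weyl_op P \<in> weyl_left_ideal S"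
  from weyl_left_ideal_comp[OF this, of "weyl_op (single c 1)"]
  show "weyl_op (weyl_lmult c P) \<in> weyl_left_ideal S"
    by (simp add: weyl_algebra_def weyl_op_lmult)
qed

section \<open>Weights and the term order\<close>

lemma weyl_weight_add: "weyl_weight w (k + l) = weyl_weight w k + weyl_weight w l"
  by (simp add: weyl_weight_def split_beta inner_vec_def sum.distrib algebra_simps sum_negf)

text \<open>The weight sees only the Z^n-degree, so the corrections made by normal ordering have the
  same weight as the main term and are told apart from it by total degree.\<close>

lemma weyl_weight_exp_shift: "weyl_weight w k = w \<bullet> (\<chi> j. real_of_int (exp_shift k $ j))"
  by (simp add: weyl_weight_def split_beta inner_vec_def exp_shift_def sum_subtractf algebra_simps sum_negf)

text \<open>One index type for all entries of both exponents, shared by the lexicographic tie-break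
  and by the application of Dickson's lemma.\<close>

definition exp_coord :: "'n::finite wexp \<Rightarrow> 'n + 'n \<Rightarrow> nat" where
  "exp_coord k i = (case i of Inl j \<Rightarrow> fst k $ j | Inr j \<Rightarrow> snd k $ j)"

definition tail_key :: "'n::finite wexp \<Rightarrow> real poly" where
  "tail_key k = (\<Sum>i\<in>UNIV. monom (real (exp_coord k i)) (to_nat i))"

text \<open>A position above all the codes \<open>to_nat i\<close>: total degree is stored there and
  weight one place higher, so both override the single coordinates.\<close>

definition key_top :: "'n::finite itself \<Rightarrow> nat" where
  "key_top _ = Suc (Max (range (to_nat :: 'n + 'n \<Rightarrow> nat)))"

text \<open>
  Polynomials are compared by their leading coefficients, so this key orders the exponents by
  weight, then by total degree, then lexicographically; being additive and injective it makes
  leading exponents multiplicative.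
\<close>

definition term_key :: "real^'n \<Rightarrow> 'n::finite wexp \<Rightarrow> real poly" where
  "term_key w k = monom (weyl_weight w k) (Suc (key_top TYPE('n)))
     + (monom (real (exp_deg k)) (key_top TYPE('n)) + tail_key k)"

lemma to_nat_less_key_top: "to_nat i < key_top TYPE('n)" for i :: "'n::finite + 'n"
  unfolding key_top_def less_Suc_eq_le by (rule Max_ge) simp_all

lemma exp_coord_add: "exp_coord (k + l) i = exp_coord k i + exp_coord l i"
  by (simp add: exp_coord_def split: sum.splits)

lemma term_key_add: "term_key w (k + l) = term_key w k + term_key w l"
  by (simp add: term_key_def tail_key_def weyl_weight_add exp_deg_add exp_coord_add
      add_monom[symmetric] sum.distrib)

lemma coeff_tail_key: "coeff (tail_key k) (to_nat i) = real (exp_coord k i)"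
  by (simp add: tail_key_def coeff_sum if_distrib cong: if_cong)

lemma coeff_tail_key_ge: "m \<ge> key_top TYPE('n) \<Longrightarrow> coeff (tail_key (k :: 'n::finite wexp)) m = 0"
proof -
  assume m: "m \<ge> key_top TYPE('n)"
  have "to_nat i \<noteq> m" for i :: "'n + 'n"
    using to_nat_less_key_top[of i] m by auto
  then show ?thesis by (simp add: tail_key_def coeff_sum)
qed

lemma term_key_inject:
  fixes k l :: "'n::finite wexp"
  assumes "term_key w k = term_key w l" shows "k = l"
proof -
  have "exp_coord k i = exp_coord l i" for i
  proof -
    have "to_nat i < key_top TYPE('n)" by (rule to_nat_less_key_top)
    then show ?thesis
      using arg_cong[OF assms, of "\<lambda>p. coeff p (to_nat i)"] by (simp add: term_key_def coeff_tail_key)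
  qed
  from this[of "Inl _"] this[of "Inr _"] show ?thesis
    by (simp add: exp_coord_def prod_eq_iff vec_eq_iff)
qed

lemma term_key_le_neq: "term_key w k \<le> term_key w l \<Longrightarrow> k \<noteq> l \<Longrightarrow> term_key w k < term_key w l"
  using term_key_inject by (metis less_le)

lemma poly_less_by_coeff:
  fixes p q :: "real poly"
  assumes "coeff p m < coeff q m" "\<And>i. i > m \<Longrightarrow> coeff p i = coeff q i"
  shows "p < q"
proof -
  have "degree (q - p) = m"
    by (rule antisym[OF degree_le le_degree]) (use assms in auto)
  then show ?thesis using assms(1) by (simp add: less_poly_def pos_poly_def)
qed

lemma term_key_less_weight: "weyl_weight w k < weyl_weight w l \<Longrightarrow> term_key w k < term_key w l"
  for k :: "'n::finite wexp"
  by (rule poly_less_by_coeff[of _ "Suc (key_top TYPE('n))"])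
     (simp_all add: term_key_def coeff_tail_key_ge)

lemma term_key_less_deg:
  "weyl_weight w k = weyl_weight w l \<Longrightarrow> exp_deg k < exp_deg l \<Longrightarrow> term_key w k < term_key w l"
  for k :: "'n::finite wexp"
  by (rule poly_less_by_coeff[of _ "key_top TYPE('n)"])
     (simp_all add: term_key_def coeff_tail_key_ge)

lemma term_key_le_weight: "term_key w k \<le> term_key w l \<Longrightarrow> weyl_weight w k \<le> weyl_weight w l"
  using term_key_less_weight[of w l k] by (metis not_le)

text \<open>Below its top coefficient the key does not depend on the direction.\<close>

lemma term_key_le_cong:
  assumes "weyl_weight w k = weyl_weight w l" "weyl_weight w' k = weyl_weight w' l"
  shows "term_key w k \<le> term_key w l \<longleftrightarrow> term_key w' k \<le> term_key w' l"
  using assms by (simp add: term_key_def)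

definition is_lead :: "real^'n \<Rightarrow> 'n::finite wsym \<Rightarrow> 'n wexp \<Rightarrow> bool" where
  "is_lead w P k \<longleftrightarrow> k \<in> keys P \<and> (\<forall>l\<in>keys P. term_key w l \<le> term_key w k)"

lemma finite_argmax:
  fixes f :: "'a \<Rightarrow> 'b::linorder"
  assumes "finite X" "X \<noteq> {}"
  obtains x where "x \<in> X" "\<And>y. y \<in> X \<Longrightarrow> f y \<le> f x"
proof -
  have "Max (f ` X) \<in> f ` X" using assms by (intro Max_in) simp_all
  then obtain x where x: "Max (f ` X) = f x" "x \<in> X" by (rule imageE)
  have "f y \<le> f x" if "y \<in> X" for y
    unfolding x(1)[symmetric] using that assms(1) by (intro Max_ge) simp_all
  then show ?thesis using that x(2) by blast
qed

lemma is_lead_exists: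
  assumes "P \<noteq> 0" obtains k where "is_lead w P k"
proof -
  obtain k where "k \<in> keys P" "\<And>l. l \<in> keys P \<Longrightarrow> term_key w l \<le> term_key w k"
    by (rule finite_argmax[of "keys P" "term_key w"]) (use assms in auto)
  then show ?thesis using that unfolding is_lead_def by blast
qed

definition deg_bound :: "nat \<Rightarrow> 'n::finite wsym \<Rightarrow> bool" where
  "deg_bound m P \<longleftrightarrow> (\<forall>k\<in>keys P. exp_deg k \<le> m)"

lemma keys_weyl_lmult_single:
  assumes "l \<in> keys (weyl_lmult c (single k 1))"
  shows "exp_shift l = exp_shift (c + k)" "l = c + k \<or> exp_deg l < exp_deg (c + k)"
proof -
  obtain R where R: "weyl_lmult c (single k 1) = single (c + k) 1 + R"
    "\<forall>k'\<in>keys R. exp_shift k' = exp_shift (c + k) \<and> exp_deg k' < exp_deg (c + k)"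
    using weyl_lmult_single[of c k] by (elim exE conjE) (rule that)
  have "l \<in> keys (single (c + k) (1::complex)) \<union> keys R"
    by (rule subsetD[OF keys_add assms[unfolded R(1)]])
  then have "l = c + k \<or> l \<in> keys R" by simp
  then show "exp_shift l = exp_shift (c + k)" "l = c + k \<or> exp_deg l < exp_deg (c + k)"
    using R(2) by blast+
qed

lemma lookup_weyl_lmult_single: "lookup (weyl_lmult c (single k 1)) (c + k) = 1"
proof -
  obtain R where R: "weyl_lmult c (single k 1) = single (c + k) 1 + R"
    "\<forall>k'\<in>keys R. exp_shift k' = exp_shift (c + k) \<and> exp_deg k' < exp_deg (c + k)"
    using weyl_lmult_single[of c k] by (elim exE conjE) (rule that)
  have "c + k \<notin> keys R" using R(2) by blast
  then show ?thesis unfolding R(1) lookup_add by (simp add: in_keys_iff)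
qed

lemmas weyl_lmult_expand = left_mult_expand[OF left_mult_weyl_lmult]

lemma keys_weyl_lmult:
  assumes "l \<in> keys (weyl_lmult c P)"
  obtains k where "k \<in> keys P" "l \<in> keys (weyl_lmult c (single k 1))"
proof -
  obtain k where k: "k \<in> keys P"
    "l \<in> keys (single 0 (lookup P k) * weyl_lmult c (single k 1))"
    using subsetD[OF keys_sum assms[unfolded weyl_lmult_expand[of c P]]] by blast
  then have "l \<in> keys (weyl_lmult c (single k 1))"
    by (auto simp: in_keys_iff)
  with k(1) show ?thesis using that by blast
qed

lemma term_key_lmult_le:
  assumes "l \<in> keys (weyl_lmult c (single k 1))"
  shows "term_key w l \<le> term_key w (c + k)"
  using keys_weyl_lmult_single[OF assms] term_key_less_deg[of w l "c + k"]
  by (auto simp: weyl_weight_exp_shift intro: less_imp_le)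

lemma deg_bound_lmult:
  assumes "deg_bound m P" shows "deg_bound (exp_deg c + m) (weyl_lmult c P)"
  unfolding deg_bound_def
proof
  fix l assume "l \<in> keys (weyl_lmult c P)"
  then obtain k where k: "k \<in> keys P" "l \<in> keys (weyl_lmult c (single k 1))"
    by (rule keys_weyl_lmult)
  have "exp_deg l \<le> exp_deg (c + k)" using keys_weyl_lmult_single(2)[OF k(2)] by auto
  then show "exp_deg l \<le> exp_deg c + m" using assms k(1) by (force simp: deg_bound_def exp_deg_add)
qed

text \<open>A term \<open>l\<close> of \<open>P\<close> produces only keys up to that of
  \<open>c + l\<close>. As the key is additive and injective, \<open>c + k\<close> can be reached
  from \<open>k\<close> alone, and its coefficient is not disturbed.\<close>

lemma is_lead_lmult:
  assumes "is_lead w P k"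
  shows "is_lead w (weyl_lmult c P) (c + k)"
    "lookup (weyl_lmult c P) (c + k) = lookup P k"
proof -
  have k: "k \<in> keys P" and le: "\<And>l. l \<in> keys P \<Longrightarrow> term_key w l \<le> term_key w k"
    using assms by (auto simp: is_lead_def)
  have "lookup (weyl_lmult c P) (c + k) = (\<Sum>l\<in>keys P.
      lookup P l * lookup (weyl_lmult c (single l 1)) (c + k))"
    by (subst weyl_lmult_expand) (simp add: lookup_sum)
  also have "\<dots> = (\<Sum>l\<in>keys P. if l = k then lookup P k else 0)"
  proof (rule sum.cong[OF refl])
    fix l assume l: "l \<in> keys P"
    show "lookup P l * lookup (weyl_lmult c (single l 1)) (c + k)
        = (if l = k then lookup P k else 0)"
    proof (cases "l = k")
      case True then show ?thesis by (simp add: lookup_weyl_lmult_single)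
    next
      case False
      then have "\<not> term_key w (c + k) \<le> term_key w (c + l)"
        using le[OF l] term_key_inject[of w l k] by (auto simp: term_key_add)
      then have "c + k \<notin> keys (weyl_lmult c (single l 1))"
        using term_key_lmult_le by blast
      then show ?thesis using False by (simp add: in_keys_iff)
    qed
  qed
  also have "\<dots> = lookup P k" using k by simp
  finally show eq: "lookup (weyl_lmult c P) (c + k) = lookup P k" .
  show "is_lead w (weyl_lmult c P) (c + k)"
    unfolding is_lead_def
  proof
    show "c + k \<in> keys (weyl_lmult c P)" using k eq by (simp add: in_keys_iff)
    show "\<forall>l\<in>keys (weyl_lmult c P). term_key w l \<le> term_key w (c + k)"
    proof
      fix l assume "l \<in> keys (weyl_lmult c P)"
      then obtain k' where k': "k' \<in> keys P" "l \<in> keys (weyl_lmult c (single k' 1))"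
        by (rule keys_weyl_lmult)
      show "term_key w l \<le> term_key w (c + k)"
        using term_key_lmult_le[OF k'(2), of w] le[OF k'(1)] by (simp add: term_key_add)
    qed
  qed
qed

text \<open>Projection onto the terms satisfying a predicate; it serves for weight slices as well as
  for the components of the grading by A.\<close>

definition restrict_sym :: "('k \<Rightarrow> bool) \<Rightarrow> ('k \<Rightarrow>\<^sub>0 complex) \<Rightarrow> ('k \<Rightarrow>\<^sub>0 complex)" where
  "restrict_sym S P = (\<Sum>k | k \<in> keys P \<and> S k. single k (lookup P k))"

lemma lookup_restrict_sym:
  "lookup (restrict_sym S P) k = (if S k then lookup P k else 0)"
proof -
  have "lookup (restrict_sym S P) k =
      (\<Sum>l | l \<in> keys P \<and> S l. if l = k then lookup P k else 0)"
    unfolding restrict_sym_def lookup_sum by (rule sum.cong) (auto simp: lookup_single)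
  then show ?thesis by (simp add: sum.delta not_in_keys_iff_lookup_eq_zero)
qed

lemma keys_restrict_sym: "keys (restrict_sym S P) = {k \<in> keys P. S k}"
  by (auto simp: in_keys_iff lookup_restrict_sym split: if_splits)

lemma restrict_sym_add: "restrict_sym S (P + Q) = restrict_sym S P + restrict_sym S Q"
  by (rule poly_mapping_eqI) (simp add: lookup_restrict_sym lookup_add)

lemma restrict_sym_sum: "restrict_sym S (\<Sum>i\<in>X. P i) = (\<Sum>i\<in>X. restrict_sym S (P i))"
  by (rule poly_mapping_eqI) (simp add: lookup_restrict_sym lookup_sum)

lemma restrict_sym_scale:
  "restrict_sym S (single 0 a * P) = single 0 a * restrict_sym S P"
  for P :: "'k::monoid_add \<Rightarrow>\<^sub>0 complex"
  by (rule poly_mapping_eqI) (simp add: lookup_restrict_sym)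

lemma initial_form_eq_restrict:
  assumes "\<And>k. k \<in> keys f \<Longrightarrow> S k \<longleftrightarrow> (\<forall>k'\<in>keys f. \<omega> k' \<le> \<omega> k)"
  shows "initial_form \<omega> f = restrict_sym S f"
  unfolding initial_form_def restrict_sym_def using assms by (intro sum.cong) auto

text \<open>Left multiplication by a monomial shifts every grading that depends on
  \<open>exp_shift\<close> only, so it commutes with projections once the predicate is shifted:
  \<open>S'\<close> is \<open>S\<close> moved back by \<open>c\<close>.\<close>

lemma restrict_sym_lmult:
  assumes "\<And>k l. l \<in> keys (weyl_lmult c (single k 1)) \<Longrightarrow> S l \<longleftrightarrow> S' k"
  shows "restrict_sym S (weyl_lmult c P) = weyl_lmult c (restrict_sym S' P)"
proof -
  let ?t = "\<lambda>k. single 0 (lookup P k) * weyl_lmult c (single k 1)"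
  have "restrict_sym S (weyl_lmult c (single k 1)) =
      (if S' k then weyl_lmult c (single k 1) else 0)" for k
  proof (rule poly_mapping_eqI)
    fix l
    show "lookup (restrict_sym S (weyl_lmult c (single k 1))) l =
      lookup (if S' k then weyl_lmult c (single k 1) else 0) l"
    proof (cases "l \<in> keys (weyl_lmult c (single k 1))")
      case True then show ?thesis using assms[OF True] by (simp add: lookup_restrict_sym)
    next
      case False then show ?thesis by (simp add: lookup_restrict_sym in_keys_iff)
    qed
  qed
  then have "restrict_sym S (weyl_lmult c P) = (\<Sum>k\<in>keys P. if S' k then ?t k else 0)"
    by (subst weyl_lmult_expand) (auto simp: restrict_sym_sum restrict_sym_scale intro!: sum.cong)
  also have "\<dots> = (\<Sum>k | k \<in> keys P \<and> S' k. ?t k)"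
    by (rule sum.inter_filter[symmetric]) simp
  also have "\<dots> = weyl_lmult c (restrict_sym S' P)"
    by (subst (2) weyl_lmult_expand) (auto simp: keys_restrict_sym lookup_restrict_sym intro!: sum.cong)
  finally show ?thesis .
qed

text \<open>The number paired with \<open>Q\<close> bounds the degree of all its terms, not just of
  the leading one. The inequality \<open>exp_deg c + m' \<le> m\<close> then keeps the multiple used
  in a reduction within the degree bound of \<open>P\<close>, as it would be for a basis of the
  homogenized ideal.\<close>

definition groebner :: "real^'n \<Rightarrow> 'n::finite wsym set \<Rightarrow> ('n wsym \<times> nat) set \<Rightarrow> bool" where
  "groebner w I G \<longleftrightarrow> (\<forall>(Q, m)\<in>G. Q \<in> I \<and> deg_bound m Q) \<and>
     (\<forall>P\<in>I. \<forall>m k. deg_bound m P \<longrightarrow> is_lead w P k \<longrightarrow>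
        (\<exists>(Q, m')\<in>G. \<exists>c l. is_lead w Q l \<and> k = c + l \<and> exp_deg c + m' \<le> m))"

lemma groebner_mem:
  assumes "groebner w I G" "(Q, m) \<in> G" shows "Q \<in> I" "deg_bound m Q"
  using assms unfolding groebner_def by auto

lemma groebner_lead:
  assumes "groebner w I G" "P \<in> I" "deg_bound m P" "is_lead w P k"
  obtains Q m' c l where "(Q, m') \<in> G" "is_lead w Q l" "k = c + l" "exp_deg c + m' \<le> m"
proof -
  have "\<exists>(Q, m')\<in>G. \<exists>c l. is_lead w Q l \<and> k = c + l \<and> exp_deg c + m' \<le> m"
    using assms unfolding groebner_def by blast
  then show ?thesis using that by auto
qed

text \<open>This finiteness stands in for the well-foundedness that \<open>term_key\<close> lacks in
  general.\<close>

lemma finite_exp_deg_le: "finite {k :: 'n::finite wexp. exp_deg k \<le> m}"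
proof -
  let ?b = "(\<chi> j. m) :: nat^'n"
  have "k \<in> {x. x \<le> ?b} \<times> {x. x \<le> ?b}" if "exp_deg k \<le> m" for k :: "'n wexp"
  proof -
    have "fst k $ j + snd k $ j \<le> exp_deg k" for j
      unfolding exp_deg_def by (rule member_le_sum) auto
    then have "fst k $ j \<le> m" "snd k $ j \<le> m" for j
      using that by (meson add_leE order_trans)+
    then show ?thesis by (cases k) (auto simp: less_eq_vec_def)
  qed
  then have "{k :: 'n wexp. exp_deg k \<le> m} \<subseteq> {x. x \<le> ?b} \<times> {x. x \<le> ?b}" by blast
  then show ?thesis by (rule finite_subset) (intro finite_cartesian_product finite_exponents_le)
qed

text \<open>One division step at an arbitrary exponent \<open>k\<close>. It need not be the leading
  one of \<open>P\<close>: the change of direction below removes lower terms while the leading one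
  stays.\<close>

lemma lead_reduction:
  assumes I: "sym_ideal I" and P: "P \<in> I" "deg_bound m P"
    and Q: "Q \<in> I" "deg_bound m' Q" "is_lead w Q l" and k: "k = c + l" "exp_deg c + m' \<le> m"
  obtains a P' where "P = P' + single 0 a * weyl_lmult c Q" "P' \<in> I" "deg_bound m P'"
    "k \<notin> keys P'"
    "\<forall>k'\<in>keys P'. k' \<in> keys P \<or> term_key w k' < term_key w k"
    "\<forall>k'. term_key w k < term_key w k' \<longrightarrow> lookup P' k' = lookup P k'"
proof -
  define T where "T = weyl_lmult c Q"
  define a where "a = lookup P k / lookup T k"
  define P' where "P' = P - single 0 a * T"
  have T: "is_lead w T k" using is_lead_lmult(1)[OF Q(3)] by (simp add: T_def k(1))
  have lk: "lookup P' k' = lookup P k' - a * lookup T k'" for k'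
    by (simp add: P'_def lookup_minus)
  have "P' = P + single 0 (- a) * T"
    by (rule poly_mapping_eqI) (simp add: P'_def lookup_minus lookup_add)
  then have 1: "P' \<in> I" using sym_idealD[OF I] P(1) Q(1) by (simp add: T_def)
  have keys: "k' \<in> keys P \<or> k' \<in> keys T" if "k' \<in> keys P'" for k'
    using that by (auto simp: in_keys_iff lk)
  have 2: "deg_bound m P'"
    using keys P(2) deg_bound_lmult[OF Q(2), of c] k(2) unfolding deg_bound_def T_def[symmetric]
    by (meson order_trans)
  have 3: "k \<notin> keys P'"
    using T by (simp add: in_keys_iff lk a_def is_lead_def)
  have 4: "k' \<in> keys P \<or> term_key w k' < term_key w k" if k': "k' \<in> keys P'" for k'
  proof (cases "k' \<in> keys P")
    case False
    then have "k' \<in> keys T" using keys k' by blast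
    then have "term_key w k' \<le> term_key w k" using T by (simp add: is_lead_def)
    moreover have "k' \<noteq> k" using 3 k' by blast
    ultimately show ?thesis by (simp add: term_key_le_neq)
  qed simp
  have 5: "lookup P' k' = lookup P k'" if "term_key w k < term_key w k'" for k'
  proof -
    have "k' \<notin> keys T" using T that by (auto simp: is_lead_def)
    then show ?thesis by (simp add: lk in_keys_iff)
  qed
  have "P = P' + single 0 a * weyl_lmult c Q" by (simp add: P'_def T_def)
  then show ?thesis using that 1 2 3 4 5 by blast
qed

text \<open>Division of \<open>P\<close> by \<open>G\<close> with the level \<open>r\<close> held
  fixed. The remainder may have smaller top weight than \<open>P\<close>, so an induction on initial
  forms would break off; the slice at level \<open>r\<close> is additive, and it is simply zero once
  all weights lie below \<open>r\<close>.\<close>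

lemma groebner_restrict_mem:
  assumes I: "sym_ideal I" and J: "sym_ideal J" and G: "groebner w I G"
    and init: "\<And>Q m. (Q, m) \<in> G \<Longrightarrow> initial_form (weyl_weight w) Q \<in> J"
    and P: "P \<in> I" "deg_bound m P" "\<And>k. k \<in> keys P \<Longrightarrow> weyl_weight w k \<le> r"
  shows "restrict_sym (\<lambda>k. weyl_weight w k = r) P \<in> J"
proof -
  \<comment> \<open>The measure counts exponents of bounded degree that lie at or below some term of
    \<open>P\<close>. A reduction at the leading exponent removes that exponent from the set and
    adds none.\<close>
  define below where "below P = {k. exp_deg k \<le> m \<and> (\<exists>k'\<in>keys P. term_key w k \<le> term_key w k')}"
    for P :: "'a wsym"
  have fin: "finite (below P)" for P
    unfolding below_def by (rule finite_subset[OF _ finite_exp_deg_le[of m]]) auto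
  show ?thesis using P
  proof (induction "card (below P)" arbitrary: P rule: less_induct)
    case less
    show ?case
    proof (cases "P = 0")
      case True
      then show ?thesis using sym_idealD(1)[OF J] by (simp add: restrict_sym_def)
    next
      case False
      then obtain k where k: "is_lead w P k" by (rule is_lead_exists)
      obtain Q m' c l where Q: "(Q, m') \<in> G" "is_lead w Q l" "k = c + l" "exp_deg c + m' \<le> m"
        using groebner_lead[OF G less.prems(1,2) k] .
      have QI: "Q \<in> I" "deg_bound m' Q" by (rule groebner_mem[OF G Q(1)])+
      obtain a P' where PP': "P = P' + single 0 a * weyl_lmult c Q"
        and a: "P' \<in> I" "deg_bound m P'" "k \<notin> keys P'"
          "\<forall>k'\<in>keys P'. k' \<in> keys P \<or> term_key w k' < term_key w k"
          "\<forall>k'. term_key w k < term_key w k' \<longrightarrow> lookup P' k' = lookup P k'"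
        using lead_reduction[OF I less.prems(1,2) QI Q(2,3,4)] .
      have P'less: "term_key w k' < term_key w k" if "k' \<in> keys P'" for k'
        using bspec[OF a(4) that]
      proof
        assume "k' \<in> keys P"
        then have "term_key w k' \<le> term_key w k" using k by (simp add: is_lead_def)
        moreover have "k' \<noteq> k" using a(3) that by blast
        ultimately show ?thesis by (rule term_key_le_neq)
      qed
      have kr: "weyl_weight w k \<le> r" using less.prems(3) k by (simp add: is_lead_def)
      have "x \<in> below P" if x: "x \<in> below P'" for x
      proof -
        obtain k' where k': "exp_deg x \<le> m" "k' \<in> keys P'" "term_key w x \<le> term_key w k'"
          using x unfolding below_def by blast
        have "term_key w x \<le> term_key w k" using k'(3) P'less[OF k'(2)] by simp
        then show ?thesis using k k'(1) unfolding below_def is_lead_def by blast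
      qed
      then have "below P' \<subseteq> below P" by blast
      moreover have "k \<in> below P" using k less.prems(2) unfolding below_def is_lead_def deg_bound_def by blast
      moreover have "k \<notin> below P'"
      proof
        assume "k \<in> below P'"
        then obtain k' where "k' \<in> keys P'" "term_key w k \<le> term_key w k'"
          unfolding below_def by blast
        then show False using P'less[of k'] by simp
      qed
      ultimately have "card (below P') < card (below P)"
        by (intro psubset_card_mono fin) auto
      moreover have "weyl_weight w k' \<le> r" if "k' \<in> keys P'" for k'
        using term_key_le_weight[OF less_imp_le[OF P'less[OF that]]] kr by simp
      ultimately have P'J: "restrict_sym (\<lambda>k. weyl_weight w k = r) P' \<in> J"
        using less.hyps[of P'] a(1,2) by blast
      have "restrict_sym (\<lambda>k. weyl_weight w k = r) (weyl_lmult c Q) =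
          weyl_lmult c (restrict_sym (\<lambda>k. weyl_weight w (c + k) = r) Q)"
      proof (rule restrict_sym_lmult)
        fix k' l' assume "l' \<in> keys (weyl_lmult c (single k' 1))"
        then have "exp_shift l' = exp_shift (c + k')" by (rule keys_weyl_lmult_single(1))
        then show "weyl_weight w l' = r \<longleftrightarrow> weyl_weight w (c + k') = r"
          by (simp add: weyl_weight_exp_shift)
      qed
      \<comment> \<open>No term of \<open>Q\<close> outweighs \<open>l\<close>. If
        \<open>c + l\<close> has weight \<open>r\<close>, this slice is the initial form of
        \<open>Q\<close>; if it weighs less, the slice is empty.\<close>
      moreover have "restrict_sym (\<lambda>k. weyl_weight w (c + k) = r) Q \<in> J"
      proof (cases "weyl_weight w k = r")
        case True
        have le: "weyl_weight w k' \<le> weyl_weight w l" if "k' \<in> keys Q" for k'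
          using Q(2) that by (auto simp: is_lead_def intro: term_key_le_weight)
        have "initial_form (weyl_weight w) Q = restrict_sym (\<lambda>k. weyl_weight w (c + k) = r) Q"
        proof (rule initial_form_eq_restrict)
          fix k' assume k': "k' \<in> keys Q"
          have "weyl_weight w (c + k') = r \<longleftrightarrow> weyl_weight w k' = weyl_weight w l"
            using True by (auto simp: Q(3) weyl_weight_add)
          also have "\<dots> \<longleftrightarrow> (\<forall>k''\<in>keys Q. weyl_weight w k'' \<le> weyl_weight w k')"
          proof
            assume "weyl_weight w k' = weyl_weight w l"
            then show "\<forall>k''\<in>keys Q. weyl_weight w k'' \<le> weyl_weight w k'" using le by simp
          next
            assume "\<forall>k''\<in>keys Q. weyl_weight w k'' \<le> weyl_weight w k'"
            then have "weyl_weight w l \<le> weyl_weight w k'" using Q(2) unfolding is_lead_def by blast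
            then show "weyl_weight w k' = weyl_weight w l" using le[OF k'] by simp
          qed
          finally show "weyl_weight w (c + k') = r \<longleftrightarrow> \<dots>" .
        qed
        then show ?thesis using init[OF Q(1)] by simp
      next
        case False
        have "weyl_weight w (c + k') \<noteq> r" if "k' \<in> keys Q" for k'
          using Q(2) that kr False term_key_le_weight[of w k' l]
          by (auto simp: is_lead_def Q(3) weyl_weight_add)
        then have "restrict_sym (\<lambda>k. weyl_weight w (c + k) = r) Q = 0"
          by (intro poly_mapping_eqI) (auto simp: lookup_restrict_sym in_keys_iff)
        then show ?thesis using sym_idealD(1)[OF J] by simp
      qed
      ultimately have QJ: "restrict_sym (\<lambda>k. weyl_weight w k = r) (weyl_lmult c Q) \<in> J"
        using sym_idealD(4)[OF J] by simp
      have "restrict_sym (\<lambda>k. weyl_weight w k = r) P = restrict_sym (\<lambda>k. weyl_weight w k = r) P'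
          + single 0 a * restrict_sym (\<lambda>k. weyl_weight w k = r) (weyl_lmult c Q)"
        by (simp only: PP' restrict_sym_add restrict_sym_scale)
      then show ?thesis using P'J QJ sym_idealD(2,3)[OF J] by simp
    qed
  qed
qed

lemma deg_bound_exists: "\<exists>m. deg_bound m P"
  unfolding deg_bound_def
  by (rule exI[of _ "\<Sum>k\<in>keys P. exp_deg k"]) (auto intro: member_le_sum)

lemma groebner_initial_form_mem:
  assumes I: "sym_ideal I" and J: "sym_ideal J" and G: "groebner w I G"
    and init: "\<And>Q m. (Q, m) \<in> G \<Longrightarrow> initial_form (weyl_weight w) Q \<in> J" and P: "P \<in> I"
  shows "initial_form (weyl_weight w) P \<in> J"
proof (cases "P = 0")
  case True
  then show ?thesis using sym_idealD(1)[OF J] by (simp add: initial_form_def)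
next
  case False
  then obtain k where k: "is_lead w P k" by (rule is_lead_exists)
  have le: "weyl_weight w k' \<le> weyl_weight w k" if "k' \<in> keys P" for k'
    using k that by (auto simp: is_lead_def intro: term_key_le_weight)
  obtain m where m: "deg_bound m P" using deg_bound_exists by blast
  have "initial_form (weyl_weight w) P = restrict_sym (\<lambda>k'. weyl_weight w k' = weyl_weight w k) P"
  proof (rule initial_form_eq_restrict)
    fix k' assume k': "k' \<in> keys P"
    have "k \<in> keys P" using k by (simp add: is_lead_def)
    then show "weyl_weight w k' = weyl_weight w k \<longleftrightarrow> (\<forall>k''\<in>keys P. weyl_weight w k'' \<le> weyl_weight w k')"
      using le k' by (metis order_antisym)
  qed
  then show ?thesis using groebner_restrict_mem[OF I J G init P m le] by simp
qed

text \<open>The set \<open>L m\<close> of exponents reached by \<open>G\<close> in degree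
  \<open>m\<close> is the same for both directions. Suppose that the leading exponent
  \<open>t\<close> of \<open>P\<close> for \<open>w'\<close> is outside it. Clearing the terms of
  \<open>P\<close> in \<open>L m\<close> by \<open>w'\<close>-reductions, from the
  \<open>w'\<close>-largest downwards, leaves \<open>t\<close> untouched; but the result, being
  nonzero in \<open>I\<close>, has a \<open>w\<close>-leading exponent, and that one lies in
  \<open>L m\<close>. No S-pairs are involved.\<close>

lemma groebner_transfer:
  assumes I: "sym_ideal I" and G: "groebner w I G"
    and lead: "\<And>Q m l. (Q, m) \<in> G \<Longrightarrow> is_lead w Q l \<Longrightarrow> is_lead w' Q l"
  shows "groebner w' I G"
proof -
  define L where "L m = {k. \<exists>(Q, m')\<in>G. \<exists>c l. is_lead w Q l \<and> k = c + l \<and> exp_deg c + m' \<le> m}" for m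
  have L: "k \<in> L m" if "P \<in> I" "deg_bound m P" "is_lead w P k" for P m k
    using G that unfolding groebner_def L_def by blast
  have finL: "finite (L m)" for m
  proof (rule finite_subset[OF _ finite_exp_deg_le[of m]])
    have "exp_deg k \<le> m" if k: "k \<in> L m" for k
    proof -
      obtain Q m' c l where Q: "(Q, m') \<in> G" "is_lead w Q l" "k = c + l" "exp_deg c + m' \<le> m"
        using k unfolding L_def by blast
      have "exp_deg l \<le> m'" using G Q(1,2) unfolding groebner_def deg_bound_def is_lead_def by auto
      then show ?thesis using Q(3,4) by (simp add: exp_deg_add)
    qed
    then show "L m \<subseteq> {k. exp_deg k \<le> m}" by blast
  qed
  have bad: False if "P \<in> I" "deg_bound m P" "is_lead w' P t" "t \<notin> L m" for P m t
  proof -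
    define below where "below P = {s \<in> L m. \<exists>k\<in>keys P \<inter> L m. term_key w' s \<le> term_key w' k}"
      for P :: "'a wsym"
    have fin: "finite (below P)" for P unfolding below_def using finL by simp
    show False using that(1-3)
    proof (induction "card (below P)" arbitrary: P rule: less_induct)
      case less
      have "P \<noteq> 0" using less.prems(3) by (auto simp: is_lead_def)
      then obtain k where k: "is_lead w P k" by (rule is_lead_exists)
      \<comment> \<open>The \<open>w\<close>-leading exponent of \<open>P\<close> is such a term, so
        the descent never runs out of terms to remove; as the measure is finite, this is the
        contradiction.\<close>
      have ne: "keys P \<inter> L m \<noteq> {}"
        using L[OF less.prems(1,2) k] k unfolding is_lead_def by blast
      obtain s where s: "s \<in> keys P \<inter> L m"
        and smax: "\<And>k. k \<in> keys P \<inter> L m \<Longrightarrow> term_key w' k \<le> term_key w' s"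
        by (rule finite_argmax[of "keys P \<inter> L m" "term_key w'"]) (use ne in auto)
      have "s \<noteq> t" using s that(4) by blast
      then have st: "term_key w' s < term_key w' t"
        using s less.prems(3) by (simp add: is_lead_def term_key_le_neq)
      obtain Q m' c l where Q: "(Q, m') \<in> G" "is_lead w Q l" "s = c + l" "exp_deg c + m' \<le> m"
        using s unfolding L_def by blast
      have QI: "Q \<in> I" "deg_bound m' Q" by (rule groebner_mem[OF G Q(1)])+
      obtain a P' where "P = P' + single 0 a * weyl_lmult c Q"
        and a: "P' \<in> I" "deg_bound m P'" "s \<notin> keys P'"
          "\<forall>k'\<in>keys P'. k' \<in> keys P \<or> term_key w' k' < term_key w' s"
          "\<forall>k'. term_key w' s < term_key w' k' \<longrightarrow> lookup P' k' = lookup P k'"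
        using lead_reduction[OF I less.prems(1,2) QI lead[OF Q(1,2)] Q(3,4)] .
      \<comment> \<open>The reduction takes place at \<open>s\<close>, strictly below
        \<open>t\<close> for \<open>w'\<close>, so it leaves the coefficient at \<open>t\<close>
        alone and creates nothing above it.\<close>
      have lead': "is_lead w' P' t"
        unfolding is_lead_def
      proof
        show "t \<in> keys P'" using a(5)[rule_format, OF st] less.prems(3) by (simp add: is_lead_def in_keys_iff)
        show "\<forall>k'\<in>keys P'. term_key w' k' \<le> term_key w' t"
          using a(4) st less.prems(3) by (meson is_lead_def less_imp_le order_trans)
      qed
      have P'less: "term_key w' k' < term_key w' s" if "k' \<in> keys P' \<inter> L m" for k'
      proof -
        have "k' \<in> keys P \<or> term_key w' k' < term_key w' s" using a(4) that by blast
        then show ?thesis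
        proof
          assume "k' \<in> keys P"
          then have "term_key w' k' \<le> term_key w' s" using smax that by blast
          moreover have "k' \<noteq> s" using a(3) that by blast
          ultimately show ?thesis by (rule term_key_le_neq)
        qed
      qed
      have "x \<in> below P" if x: "x \<in> below P'" for x
      proof -
        obtain k' where k': "x \<in> L m" "k' \<in> keys P' \<inter> L m" "term_key w' x \<le> term_key w' k'"
          using x unfolding below_def by blast
        have "term_key w' x \<le> term_key w' s" using k'(3) P'less[OF k'(2)] by simp
        then show ?thesis using s k'(1) unfolding below_def by blast
      qed
      then have "below P' \<subseteq> below P" by blast
      moreover have "s \<in> below P" using s unfolding below_def by blast
      moreover have "s \<notin> below P'"
      proof
        assume "s \<in> below P'"
        then obtain k' where "k' \<in> keys P' \<inter> L m" "term_key w' s \<le> term_key w' k'"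
          unfolding below_def by blast
        then show False using P'less[of k'] by simp
      qed
      ultimately have "card (below P') < card (below P)"
        by (intro psubset_card_mono fin) auto
      then show False using less.hyps[of P'] a(1,2) lead' by blast
    qed
  qed
  have "\<exists>(Q, m')\<in>G. \<exists>c l. is_lead w' Q l \<and> k = c + l \<and> exp_deg c + m' \<le> m"
    if "P \<in> I" "deg_bound m P" "is_lead w' P k" for P m k
  proof -
    have "k \<in> L m" using bad[OF that] by blast
    then show ?thesis using lead unfolding L_def by blast
  qed
  then show ?thesis using G unfolding groebner_def by blast
qed

section \<open>Dickson's lemma and homogeneous bases\<close>

lemma dickson_aux:
  fixes X :: "('i \<Rightarrow> nat) set"
  assumes "finite D"
  shows "\<exists>F. finite F \<and> F \<subseteq> X \<and> (\<forall>x\<in>X. \<exists>y\<in>F. \<forall>i\<in>D. y i \<le> x i)"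
  using assms
proof (induction D arbitrary: X rule: finite_induct)
  case empty
  show ?case
  proof (cases "X = {}")
    case False
    then obtain x where "x \<in> X" by blast
    then show ?thesis by (intro exI[of _ "{x}"]) auto
  qed auto
next
  case (insert d D)
  obtain F where F: "finite F" "F \<subseteq> X" "\<forall>x\<in>X. \<exists>y\<in>F. \<forall>i\<in>D. y i \<le> x i"
    using insert.IH[of X] by blast
  \<comment> \<open>The set \<open>F\<close> takes care of the coordinates in \<open>D\<close>. It
    already dominates, in the coordinate \<open>d\<close> too, every \<open>x\<close> with
    \<open>x d \<ge> b\<close>; the finitely many remaining values of \<open>x d\<close> are treated
    slice by slice.\<close>
  define b where "b = (\<Sum>y\<in>F. y d)"
  have b: "y d \<le> b" if "y \<in> F" for y unfolding b_def by (rule member_le_sum) (use that F(1) in auto)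
  have "\<forall>v. \<exists>F. finite F \<and> F \<subseteq> {x \<in> X. x d = v} \<and> (\<forall>x\<in>{x \<in> X. x d = v}. \<exists>y\<in>F. \<forall>i\<in>D. y i \<le> x i)"
    using insert.IH by blast
  from choice[OF this] obtain E where E': "\<forall>v. finite (E v) \<and> E v \<subseteq> {x \<in> X. x d = v} \<and>
    (\<forall>x\<in>{x \<in> X. x d = v}. \<exists>y\<in>E v. \<forall>i\<in>D. y i \<le> x i)" ..
  then have E: "finite (E v)" "E v \<subseteq> {x \<in> X. x d = v}"
    "x \<in> X \<Longrightarrow> x d = v \<Longrightarrow> \<exists>y\<in>E v. \<forall>i\<in>D. y i \<le> x i" for v x by blast+
  show ?case
  proof (intro exI[of _ "F \<union> (\<Union>v<b. E v)"] conjI ballI)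
    show "finite (F \<union> (\<Union>v<b. E v))" using F(1) E(1) by simp
    show "F \<union> (\<Union>v<b. E v) \<subseteq> X" using F(2) E(2) by blast
    fix x assume x: "x \<in> X"
    show "\<exists>y\<in>F \<union> (\<Union>v<b. E v). \<forall>i\<in>insert d D. y i \<le> x i"
    proof (cases "x d < b")
      case True
      obtain y where y: "y \<in> E (x d)" "\<forall>i\<in>D. y i \<le> x i" using E(3)[OF x refl] by blast
      then have "y d = x d" using E(2) by blast
      then show ?thesis using y True by (intro bexI[of _ y]) auto
    next
      case False
      obtain y where y: "y \<in> F" "\<forall>i\<in>D. y i \<le> x i" using F(3) x by blast
      then show ?thesis using b[of y] False by (intro bexI[of _ y]) auto
    qed
  qed
qed

lemma dickson:
  fixes X :: "('i::finite \<Rightarrow> nat) set"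
  obtains F where "finite F" "F \<subseteq> X" "\<And>x. x \<in> X \<Longrightarrow> \<exists>y\<in>F. y \<le> x"
  using dickson_aux[OF finite_class.finite_UNIV, of X] by (auto simp: le_fun_def)

definition graded_ideal :: "int^'n^'d \<Rightarrow> 'n::finite wsym set \<Rightarrow> bool" where
  "graded_ideal A I \<longleftrightarrow> (\<forall>P\<in>I. \<forall>\<alpha>. restrict_sym (\<lambda>k. A *v exp_shift k = \<alpha>) P \<in> I)"

definition homogeneous_sym :: "int^'n^'d \<Rightarrow> 'n::finite wsym \<Rightarrow> bool" where
  "homogeneous_sym A P \<longleftrightarrow> (\<forall>k\<in>keys P. \<forall>l\<in>keys P. A *v exp_shift k = A *v exp_shift l)"

lemma exists_homogeneous_groebner:
  fixes I :: "'n::finite wsym set"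
  assumes gr: "graded_ideal A I"
  obtains G where "finite G" "groebner w I G" "\<forall>z\<in>G. homogeneous_sym A (fst z)"
proof -
  \<comment> \<open>The entry at \<open>None\<close> is the exponent that a homogenizing variable
    would have. Domination in all coordinates says that one leading exponent divides the other and
    that the multiplier fits under the degree bound,
    \<open>exp_deg (k - l) + m' \<le> m\<close>.\<close>
  define enc where "enc k m i = (case i of None \<Rightarrow> m - exp_deg k | Some j \<Rightarrow> exp_coord k j)"
    for k :: "'n wexp" and m :: nat and i :: "('n + 'n) option"
  define good where "good y Q m \<longleftrightarrow> Q \<in> I \<and> homogeneous_sym A Q \<and> deg_bound m Q \<and> (\<exists>k. is_lead w Q k \<and> y = enc k m)"
    for y Q m
  define X where "X = {y. \<exists>Q m. good y Q m}"
  obtain F where F: "finite F" "F \<subseteq> X" "\<And>x. x \<in> X \<Longrightarrow> \<exists>y\<in>F. y \<le> x"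
    using dickson[of X] by blast
  have "\<forall>y\<in>F. \<exists>z. good y (fst z) (snd z)" using F(2) by (auto simp: X_def)
  from bchoice[OF this] obtain g where g: "\<And>y. y \<in> F \<Longrightarrow> good y (fst (g y)) (snd (g y))" by blast
  have "groebner w I (g ` F)"
    unfolding groebner_def
  proof (intro conjI ballI allI impI)
    fix z assume "z \<in> g ` F"
    then show "case z of (Q, m) \<Rightarrow> Q \<in> I \<and> deg_bound m Q"
      using g by (auto simp: good_def split_beta)
  next
    fix P m k assume P: "P \<in> I" "deg_bound m P" "is_lead w P k"
    \<comment> \<open>The component of \<open>P\<close> through its leading exponent stays in the
      graded ideal and keeps that exponent, so homogeneous elements suffice.\<close>
    define P' where "P' = restrict_sym (\<lambda>l. A *v exp_shift l = A *v exp_shift k) P"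
    have "P' \<in> I" using gr P(1) by (simp add: graded_ideal_def P'_def)
    moreover have "homogeneous_sym A P'" by (auto simp: homogeneous_sym_def P'_def keys_restrict_sym)
    moreover have "deg_bound m P'" using P(2) by (auto simp: deg_bound_def P'_def keys_restrict_sym)
    moreover have "is_lead w P' k" using P(3) by (auto simp: is_lead_def P'_def keys_restrict_sym)
    ultimately have "enc k m \<in> X" unfolding X_def good_def by blast
    then obtain y where y: "y \<in> F" "y \<le> enc k m" using F(3) by blast
    define Q m' where "Q = fst (g y)" and "m' = snd (g y)"
    obtain l where l: "deg_bound m' Q" "is_lead w Q l" "y = enc l m'"
      using g[OF y(1)] unfolding good_def Q_def m'_def by blast
    have le: "enc l m' i \<le> enc k m i" for i using y(2) l(3) by (simp add: le_fun_def)
    have "fst l \<le> fst k" using le[of "Some (Inl _)"] by (simp add: enc_def exp_coord_def less_eq_vec_def)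
    moreover have "snd l \<le> snd k" using le[of "Some (Inr _)"] by (simp add: enc_def exp_coord_def less_eq_vec_def)
    ultimately have k: "k = (k - l) + l" by (simp add: prod_eq_iff vec_diff_add)
    have "exp_deg k = exp_deg (k - l) + exp_deg l" using k exp_deg_add by metis
    moreover have "exp_deg l \<le> m'" using l(1,2) by (auto simp: deg_bound_def is_lead_def)
    moreover have "exp_deg k \<le> m" using P(2,3) by (auto simp: deg_bound_def is_lead_def)
    moreover have "m' - exp_deg l \<le> m - exp_deg k" using le[of None] by (simp add: enc_def)
    ultimately have "exp_deg (k - l) + m' \<le> m" by linarith
    then have "\<exists>c l. is_lead w Q l \<and> k = c + l \<and> exp_deg c + m' \<le> m" using k l(2) by blast
    moreover have "(Q, m') \<in> g ` F" using y(1) by (simp add: Q_def m'_def)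
    ultimately show "\<exists>(Q, m')\<in>g ` F. \<exists>c l. is_lead w Q l \<and> k = c + l \<and> exp_deg c + m' \<le> m"
      by blast
  qed
  moreover have "\<forall>z\<in>g ` F. homogeneous_sym A (fst z)"
    using g unfolding good_def by blast
  ultimately show ?thesis using that[of "g ` F"] F(1) by blast
qed

lemma weyl_initial_ideal_locally_constant:
  fixes A :: "int^'n::finite^'d" and w :: "real^'n"
  assumes H: "H = weyl_left_ideal S" and gr: "graded_ideal A {P. weyl_op P \<in> H}"
    and w: "\<And>u. A *v u = 0 \<Longrightarrow> u \<noteq> 0 \<Longrightarrow> w \<bullet> (\<chi> j. real_of_int (u $ j)) \<noteq> 0"
  shows "w \<in> interior {w'. weyl_initial_ideal w' H = weyl_initial_ideal w H}"
proof -
  define I where "I = {P. weyl_op P \<in> H}"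
  have I: "sym_ideal I" unfolding I_def H by (rule sym_ideal_weyl_left_ideal)
  obtain G where G: "finite G" "groebner w I G" "\<forall>z\<in>G. homogeneous_sym A (fst z)"
    using exists_homogeneous_groebner[OF gr[folded I_def]] .
  define D where "D = (\<Union>z\<in>G. keys (fst z) \<times> keys (fst z))"
  define U where "U = (\<Inter>(k, l)\<in>{(k, l) \<in> D. weyl_weight w k < weyl_weight w l}. {w'. weyl_weight w' k < weyl_weight w' l})"
  have "finite D" unfolding D_def using G(1) by simp
  then have fin: "finite {(k, l) \<in> D. weyl_weight w k < weyl_weight w l}"
    by (rule rev_finite_subset) auto
  have "open {w'. weyl_weight w' k < weyl_weight w' l}" for k l :: "'n wexp"
    unfolding weyl_weight_exp_shift by (intro open_Collect_less continuous_intros)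
  then have "open U" unfolding U_def using fin by (intro open_INT) auto
  moreover have "w \<in> U" unfolding U_def by auto
  moreover have "weyl_initial_ideal w' H = weyl_initial_ideal w H" if w': "w' \<in> U" for w'
  proof -
    have lt: "weyl_weight w' k < weyl_weight w' l"
      if Q: "(Q, m) \<in> G" "k \<in> keys Q" "l \<in> keys Q"
        and less: "weyl_weight w k < weyl_weight w l"
      for Q m k l
    proof -
      have "(k, l) \<in> D" unfolding D_def using Q by (intro UN_I[of "(Q, m)"]) auto
      then show ?thesis using w' less unfolding U_def by blast
    qed
    \<comment> \<open>Two terms of one homogeneous element have shifts differing by a kernel vector,
      on which \<open>w\<close> vanishes only at zero. A tie in direction \<open>w\<close> is
      therefore a tie in every direction.\<close>
    have eq: "exp_shift k = exp_shift l"
      if "(Q, m) \<in> G" "k \<in> keys Q" "l \<in> keys Q" "weyl_weight w k = weyl_weight w l"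
      for Q m k l
    proof (rule ccontr)
      assume "exp_shift k \<noteq> exp_shift l"
      moreover have "A *v exp_shift k = A *v exp_shift l"
        using bspec[OF G(3) that(1)] that(2,3) unfolding homogeneous_sym_def fst_conv by blast
      then have "A *v (exp_shift k - exp_shift l) = 0" by (simp add: matrix_vector_mult_diff_distrib)
      ultimately have "w \<bullet> (\<chi> j. real_of_int ((exp_shift k - exp_shift l) $ j)) \<noteq> 0"
        using w[of "exp_shift k - exp_shift l"] by simp
      then show False using that(4)
        by (simp add: weyl_weight_exp_shift inner_vec_def algebra_simps sum_subtractf)
    qed
    have iff: "weyl_weight w' k \<le> weyl_weight w' l \<longleftrightarrow> weyl_weight w k \<le> weyl_weight w l"
      if "(Q, m) \<in> G" "k \<in> keys Q" "l \<in> keys Q" for Q m k l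
      using lt[OF that] lt[OF that(1,3,2)] eq[OF that]
      by (cases "weyl_weight w k" "weyl_weight w l" rule: linorder_cases)
         (auto simp: weyl_weight_exp_shift)
    have lead: "is_lead w' Q l" if Q: "(Q, m) \<in> G" "is_lead w Q l" for Q m l
      unfolding is_lead_def
    proof
      show l: "l \<in> keys Q" using Q(2) by (simp add: is_lead_def)
      show "\<forall>k\<in>keys Q. term_key w' k \<le> term_key w' l"
      proof
        fix k assume k: "k \<in> keys Q"
        have le: "term_key w k \<le> term_key w l" using Q(2) k by (simp add: is_lead_def)
        show "term_key w' k \<le> term_key w' l"
        proof (cases "weyl_weight w k = weyl_weight w l")
          case True
          then have "weyl_weight w' k = weyl_weight w' l"
            using eq[OF Q(1) k l] by (simp add: weyl_weight_exp_shift)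
          then show ?thesis using term_key_le_cong[OF True] le by blast
        next
          case False
          then have "weyl_weight w' k < weyl_weight w' l"
            using lt[OF Q(1) k l] term_key_le_weight[OF le] by simp
          then show ?thesis by (rule less_imp_le[OF term_key_less_weight])
        qed
      qed
    qed
    have G': "groebner w' I G" by (rule groebner_transfer[OF I G(2) lead])
    have init: "initial_form (weyl_weight w') Q = initial_form (weyl_weight w) Q" if "(Q, m) \<in> G" for Q m
      unfolding initial_form_def using iff[OF that] by (intro sum.cong) auto
    \<comment> \<open>An inclusion needs a Groebner basis for its source direction only; as
      \<open>G\<close> is one for both directions, the argument is used twice with the roles
      exchanged.\<close>
    have sub: "weyl_initial_ideal w1 H \<subseteq> weyl_initial_ideal w2 H"
      if g: "groebner w1 I G" and i: "\<And>Q m. (Q, m) \<in> G \<Longrightarrow> initial_form (weyl_weight w1) Q = initial_form (weyl_weight w2) Q"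
      for w1 w2
      unfolding weyl_initial_ideal_def[of w1]
    proof -
      let ?J = "{P. weyl_op P \<in> weyl_initial_ideal w2 H}"
      have J: "sym_ideal ?J" unfolding weyl_initial_ideal_def by (rule sym_ideal_weyl_left_ideal)
      have "initial_form (weyl_weight w1) Q \<in> ?J" if "(Q, m) \<in> G" for Q m
        using g that i[OF that] unfolding weyl_initial_ideal_def groebner_def I_def
        by (auto intro!: weyl_left_ideal_gen)
      from groebner_initial_form_mem[OF I J g this]
      have "weyl_op (initial_form (weyl_weight w1) P) \<in> weyl_initial_ideal w2 H" if "weyl_op P \<in> H" for P
        using that by (auto simp: I_def)
      then show "weyl_left_ideal {weyl_op (initial_form (weyl_weight w1) P) |P. weyl_op P \<in> H} \<subseteq> weyl_initial_ideal w2 H"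
        unfolding weyl_initial_ideal_def[of w2] by (intro weyl_left_ideal_mono) auto
    qed
    show ?thesis
      by (rule equalityI[OF sub[OF G' init] sub[OF G(2) init[symmetric]]])
  qed
  ultimately show ?thesis unfolding interior_def by blast
qed

section \<open>Hypergeometric and toric ideals\<close>

lemma module_mult: "module ((*) :: 'a::comm_ring_1 \<Rightarrow> 'a \<Rightarrow> 'a)"
  by unfold_locales (simp_all add: algebra_simps)

lemma ideal_gen_base: "x \<in> S \<Longrightarrow> x \<in> ideal_gen S"
  unfolding ideal_gen_def by (rule module.span_base[OF module_mult])

lemma ideal_gen_0: "0 \<in> ideal_gen S"
  unfolding ideal_gen_def by (rule module.span_zero[OF module_mult])

lemma ideal_gen_add: "x \<in> ideal_gen S \<Longrightarrow> y \<in> ideal_gen S \<Longrightarrow> x + y \<in> ideal_gen S"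
  unfolding ideal_gen_def by (rule module.span_add[OF module_mult])

lemma ideal_gen_diff: "x \<in> ideal_gen S \<Longrightarrow> y \<in> ideal_gen S \<Longrightarrow> x - y \<in> ideal_gen S"
  unfolding ideal_gen_def by (rule module.span_diff[OF module_mult])

lemma ideal_gen_mult: "x \<in> ideal_gen S \<Longrightarrow> r * x \<in> ideal_gen S"
  unfolding ideal_gen_def by (rule module.span_scale[OF module_mult])

lemma ideal_gen_sum: "(\<And>i. i \<in> X \<Longrightarrow> f i \<in> ideal_gen S) \<Longrightarrow> (\<Sum>i\<in>X. f i) \<in> ideal_gen S"
  unfolding ideal_gen_def by (rule module.span_sum[OF module_mult])

lemma ideal_gen_minimal:
  assumes "S \<subseteq> T" "0 \<in> T" "\<And>x y. x \<in> T \<Longrightarrow> y \<in> T \<Longrightarrow> x + y \<in> T" "\<And>r x. x \<in> T \<Longrightarrow> r * x \<in> T"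
  shows "ideal_gen S \<subseteq> T"
  unfolding ideal_gen_def
  by (rule module.span_minimal[OF module_mult assms(1)])
     (use assms in \<open>simp add: module.subspace_def[OF module_mult]\<close>)

lemma ideal_gen_subsetI: "S \<subseteq> ideal_gen T \<Longrightarrow> ideal_gen S \<subseteq> ideal_gen T"
  by (rule ideal_gen_minimal) (auto intro: ideal_gen_0 ideal_gen_add ideal_gen_mult)

lemma const_coeff_op_alt:
  assumes "finite S" "keys q \<subseteq> S"
  shows "const_coeff_op q f = (\<Sum>p\<in>S. single 0 (lookup q p) * poly_deriv p f)"
  unfolding const_coeff_op_def
  by (rule sum.mono_neutral_left) (use assms in \<open>auto simp: in_keys_iff\<close>)

lemma const_coeff_op_add: "const_coeff_op (q + r) f = const_coeff_op q f + const_coeff_op r f"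
proof -
  let ?S = "keys q \<union> keys r"
  have "keys (q + r) \<subseteq> ?S" by (rule keys_add)
  then show ?thesis
    by (simp add: const_coeff_op_alt[of ?S] lookup_add single_add distrib_right sum.distrib)
qed

lemma const_coeff_op_0: "const_coeff_op 0 f = 0"
  by (simp add: const_coeff_op_def)

lemma const_coeff_op_sum: "const_coeff_op (\<Sum>i\<in>S. q i) f = (\<Sum>i\<in>S. const_coeff_op (q i) f)"
  by (induction S rule: infinite_finite_induct) (simp_all add: const_coeff_op_add const_coeff_op_0)

lemma const_coeff_op_single:
  "const_coeff_op (single p c) f = single 0 c * poly_deriv p f"
  by (subst const_coeff_op_alt[of "{p}"]) simp_all

lemma const_coeff_op_eq_weyl_op:
  "const_coeff_op q = weyl_op (\<Sum>p\<in>keys q. single (0, p) (lookup q p))"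
  by (rule ext) (simp add: weyl_op_sum weyl_op_single const_coeff_op_def)

lemma const_coeff_op_mult: "const_coeff_op (q * r) f = const_coeff_op q (const_coeff_op r f)"
proof -
  have "q * r = (\<Sum>p\<in>keys q. \<Sum>s\<in>keys r.
      single (p + s) (lookup q p * lookup r s))"
    by (subst (1) poly_mapping_decompose[of q], subst (1) poly_mapping_decompose[of r])
       (simp add: sum_product mult_single)
  then have "const_coeff_op (q * r) f = (\<Sum>p\<in>keys q. \<Sum>s\<in>keys r.
      single 0 (lookup q p * lookup r s) * poly_deriv (p + s) f)"
    by (simp add: const_coeff_op_sum const_coeff_op_single)
  also have "\<dots> = (\<Sum>p\<in>keys q. single 0 (lookup q p) *
      poly_deriv p (\<Sum>s\<in>keys r. single 0 (lookup r s) * poly_deriv s f))"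
  proof (intro sum.cong refl)
    fix p
    have "single 0 (a * b) * g = single 0 a * (single 0 b * g)"
      for a b and g :: "'a mpoly" by (simp add: mult_single flip: mult.assoc)
    then show "(\<Sum>s\<in>keys r.
        single 0 (lookup q p * lookup r s) * poly_deriv (p + s) f) =
      single 0 (lookup q p) *
      poly_deriv p (\<Sum>s\<in>keys r. single 0 (lookup r s) * poly_deriv s f)"
      by (simp add: poly_deriv_sum poly_deriv_scale poly_deriv_poly_deriv sum_distrib_left add.commute[of p])
  qed
  finally show ?thesis unfolding const_coeff_op_def[of q] const_coeff_op_def[of r] .
qed

section \<open>Homogeneous generators of the hypergeometric ideal\<close>

definition binomial_sym :: "int^'n \<Rightarrow> 'n::finite wsym" where
  "binomial_sym u = single (0, pos_part u) 1 - single (0, neg_part u) 1"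

definition euler_sym :: "int^'n^'d \<Rightarrow> complex^'d \<Rightarrow> 'd \<Rightarrow> 'n::finite wsym" where
  "euler_sym A \<beta> i = (\<Sum>j\<in>UNIV. single (axis j 1, axis j 1) (of_int (A $ i $ j)))
     - single 0 (\<beta> $ i)"

definition hypergeometric_syms :: "int^'n^'d \<Rightarrow> complex^'d \<Rightarrow> 'n::finite wsym set" where
  "hypergeometric_syms A \<beta> = binomial_sym ` kernel_lattice A \<union> range (euler_sym A \<beta>)"

lemma weyl_op_binomial_sym:
  "weyl_op (binomial_sym u) = const_coeff_op (mpoly_monom (pos_part u) - mpoly_monom (neg_part u))"
proof
  fix f
  have "const_coeff_op (mpoly_monom (pos_part u) + - mpoly_monom (neg_part u)) f =
      poly_deriv (pos_part u) f - poly_deriv (neg_part u) f"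
    unfolding const_coeff_op_add mpoly_monom_def single_uminus[symmetric] const_coeff_op_single
    by (simp add: single_uminus)
  then show "weyl_op (binomial_sym u) f = const_coeff_op (mpoly_monom (pos_part u) - mpoly_monom (neg_part u)) f"
    by (simp add: binomial_sym_def weyl_op_minus weyl_op_single)
qed

lemma weyl_op_euler_sym: "weyl_op (euler_sym A \<beta> i) = euler_op A \<beta> i"
proof
  fix f :: "'a mpoly"
  have "single (axis j 1) (of_int a) * g = of_int a * (mpoly_var j * g)"
    for j and a :: int and g :: "'a mpoly"
    by (simp add: mpoly_var_def mpoly_monom_def mult_single flip: mult.assoc single_of_int)
  then show "weyl_op (euler_sym A \<beta> i) f = euler_op A \<beta> i f"
    by (simp add: euler_sym_def euler_op_def weyl_op_minus weyl_op_sum weyl_op_single)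
qed

text \<open>General elements of the toric ideal are not homogeneous, so they are traded for
  binomials. The polynomials whose operators lie in the left ideal form an ideal, because
  \<open>const_coeff_op\<close> turns products into compositions.\<close>

lemma hypergeometric_ideal_eq:
  "hypergeometric_ideal A \<beta> = weyl_left_ideal (weyl_op ` hypergeometric_syms A \<beta>)"
proof
  let ?H = "weyl_left_ideal (weyl_op ` hypergeometric_syms A \<beta>)"
  define T where "T = {q. const_coeff_op q \<in> ?H}"
  have "toric_ideal A \<subseteq> T"
    unfolding toric_ideal_def
  proof (rule ideal_gen_minimal)
    show "{mpoly_monom (pos_part u) - mpoly_monom (neg_part u) |u. u \<in> kernel_lattice A} \<subseteq> T"
      unfolding T_def weyl_op_binomial_sym[symmetric]
      by (auto simp flip: weyl_op_binomial_sym intro!: weyl_left_ideal_gen simp: hypergeometric_syms_def)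
    have "const_coeff_op 0 = (\<lambda>f::'a mpoly. 0)" by (auto simp: const_coeff_op_0)
    then show "0 \<in> T" unfolding T_def using weyl_left_ideal_0 by simp
    show "x + y \<in> T" if "x \<in> T" "y \<in> T" for x y
      using weyl_left_ideal_add[of "const_coeff_op x" _ "const_coeff_op y"] that
      by (simp add: T_def const_coeff_op_add[abs_def])
    show "r * x \<in> T" if "x \<in> T" for r x
    proof -
      have "const_coeff_op r \<in> weyl_algebra"
        unfolding weyl_algebra_def by (subst const_coeff_op_eq_weyl_op) (rule rangeI)
      then have "const_coeff_op r \<circ> const_coeff_op x \<in> ?H"
        using that weyl_left_ideal_comp unfolding T_def by blast
      moreover have "const_coeff_op r \<circ> const_coeff_op x = const_coeff_op (r * x)"
        by (auto simp: const_coeff_op_mult)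
      ultimately show ?thesis by (simp add: T_def)
    qed
  qed
  then have "const_coeff_op ` toric_ideal A \<subseteq> ?H" by (auto simp: T_def)
  moreover have "range (euler_op A \<beta>) \<subseteq> ?H"
    by (auto simp flip: weyl_op_euler_sym intro!: weyl_left_ideal_gen simp: hypergeometric_syms_def)
  ultimately show "hypergeometric_ideal A \<beta> \<subseteq> ?H"
    unfolding hypergeometric_ideal_def by (intro weyl_left_ideal_mono) simp
  have "const_coeff_op (mpoly_monom (pos_part u) - mpoly_monom (neg_part u)) \<in> const_coeff_op ` toric_ideal A"
    if "u \<in> kernel_lattice A" for u
    unfolding toric_ideal_def using that by (intro imageI ideal_gen_base) auto
  then show "?H \<subseteq> hypergeometric_ideal A \<beta>"
    unfolding hypergeometric_ideal_def
    by (intro weyl_left_ideal_mono)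
       (auto simp: hypergeometric_syms_def weyl_op_binomial_sym weyl_op_euler_sym intro!: weyl_left_ideal_gen)
qed

text \<open>The two exponents of a binomial differ by a kernel vector, and each term of an Euler
  operator has shift zero.\<close>

lemma homogeneous_hypergeometric_syms:
  assumes "q \<in> hypergeometric_syms A \<beta>"
  shows "\<exists>\<delta>. \<forall>k\<in>keys q. A *v exp_shift k = \<delta>"
proof -
  consider u where "u \<in> kernel_lattice A" "q = binomial_sym u" | i where "q = euler_sym A \<beta> i"
    using assms by (auto simp: hypergeometric_syms_def)
  then show ?thesis
  proof cases
    case 1
    have "exp_shift (0, pos_part u) - exp_shift (0, neg_part u) = u"
      by (simp add: exp_shift_def pos_part_def neg_part_def vec_eq_iff)
    then have "A *v exp_shift (0, pos_part u) - A *v exp_shift (0, neg_part u) = 0"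
      using 1(1) by (simp add: kernel_lattice_def flip: matrix_vector_mult_diff_distrib)
    then have eq: "A *v exp_shift (0, pos_part u) = A *v exp_shift (0, neg_part u)" by simp
    have "A *v exp_shift k = A *v exp_shift (0, neg_part u)" if "k \<in> keys q" for k
    proof -
      have "k = (0, pos_part u) \<or> k = (0, neg_part u)"
        using that unfolding 1(2) binomial_sym_def
        by (auto simp: in_keys_iff lookup_minus lookup_single when_def split: if_splits)
      then show ?thesis using eq by blast
    qed
    then show ?thesis by blast
  next
    case 2
    have "exp_shift k = 0" if "k \<in> keys q" for k
    proof -
      have "k = 0 \<or> (\<exists>j. k = (axis j 1, axis j 1))"
      proof (rule ccontr)
        assume "\<not> ?thesis"
        then have "lookup q k = 0"
          unfolding 2 euler_sym_def lookup_minus lookup_sum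
          by (auto simp: lookup_single when_def intro!: sum.neutral)
        then show False using that by (simp add: in_keys_iff)
      qed
      then show ?thesis by (auto simp: exp_shift_def vec_eq_iff)
    qed
    then show ?thesis by (intro exI[of _ 0]) simp
  qed
qed

lemma graded_hypergeometric_ideal:
  fixes A :: "int^'n::finite^'d"
  shows "graded_ideal A {P. weyl_op P \<in> hypergeometric_ideal A \<beta>}"
proof -
  let ?H = "weyl_left_ideal (weyl_op ` hypergeometric_syms A \<beta>)"
  let ?I = "{P. weyl_op P \<in> ?H}"
  let ?res = "\<lambda>\<alpha>. restrict_sym (\<lambda>k. A *v exp_shift k = \<alpha>)"
  have I: "sym_ideal ?I" by (rule sym_ideal_weyl_left_ideal)
  have res_sum: "(\<Sum>k\<in>X. f k) \<in> ?I" if "\<And>k. k \<in> X \<Longrightarrow> f k \<in> ?I" for X :: "'n wexp set" and f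
    using that
  proof (induction X rule: infinite_finite_induct)
    case (insert x X)
    then show ?case using sym_idealD(2)[OF I, of "f x" "sum f X"] by simp
  qed (use sym_idealD(1)[OF I] in simp_all)
  \<comment> \<open>The induction runs over operators, so it yields some symbol of \<open>T\<close>
    with all components in the ideal; injectivity of \<open>weyl_op\<close> identifies it at the end
    with the given symbol.\<close>
  have "\<exists>P. weyl_op P = T \<and> (\<forall>\<alpha>. ?res \<alpha> P \<in> ?I)" if "T \<in> ?H" for T
    using that
  proof (induction rule: weyl_left_ideal_induct)
    case zero
    have "?res \<alpha> 0 = 0" for \<alpha> by (simp add: restrict_sym_def)
    then show ?case using sym_idealD(1)[OF I] by (intro exI[of _ 0]) auto
  next
    case (add T R Q)
    obtain P where P: "weyl_op P = T" "\<forall>\<alpha>. ?res \<alpha> P \<in> ?I" using add.IH by (elim exE conjE)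
    obtain r where r: "R = weyl_op r" using add.hyps by (auto simp: weyl_algebra_def)
    obtain q where q: "Q = weyl_op q" "q \<in> hypergeometric_syms A \<beta>" using add.hyps by blast
    obtain \<delta> where \<delta>: "\<forall>k\<in>keys q. A *v exp_shift k = \<delta>"
      using homogeneous_hypergeometric_syms[OF q(2)] ..
    have qI: "q \<in> ?I" unfolding mem_Collect_eq by (rule weyl_left_ideal_gen[OF imageI[OF q(2)]])
    define Z where "Z = (\<Sum>k\<in>keys r. single 0 (lookup r k) * weyl_lmult k q)"
    have "?res \<alpha> (weyl_lmult k q) \<in> ?I" for \<alpha> k
    proof -
      have "?res \<alpha> (weyl_lmult k q) = weyl_lmult k (restrict_sym (\<lambda>l. A *v exp_shift (k + l) = \<alpha>) q)"
      proof (rule restrict_sym_lmult)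
        fix l l' assume "l' \<in> keys (weyl_lmult k (single l 1))"
        then have "exp_shift l' = exp_shift (k + l)" by (rule keys_weyl_lmult_single(1))
        then show "A *v exp_shift l' = \<alpha> \<longleftrightarrow> A *v exp_shift (k + l) = \<alpha>" by simp
      qed
      \<comment> \<open>A homogeneous generator is either kept whole or killed by a
        projection.\<close>
      moreover have "restrict_sym (\<lambda>l. A *v exp_shift (k + l) = \<alpha>) q = (if A *v exp_shift k + \<delta> = \<alpha> then q else 0)"
      proof (rule poly_mapping_eqI)
        fix l
        show "lookup (restrict_sym (\<lambda>l. A *v exp_shift (k + l) = \<alpha>) q) l =
          lookup (if A *v exp_shift k + \<delta> = \<alpha> then q else 0) l"
        proof (cases "l \<in> keys q")
          case True
          then show ?thesis using bspec[OF \<delta> True]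
            by (simp add: lookup_restrict_sym exp_shift_add matrix_vector_right_distrib)
        qed (simp add: lookup_restrict_sym in_keys_iff)
      qed
      ultimately have "?res \<alpha> (weyl_lmult k q) = weyl_lmult k (if A *v exp_shift k + \<delta> = \<alpha> then q else 0)"
        by (simp only:)
      moreover have "(if A *v exp_shift k + \<delta> = \<alpha> then q else 0) \<in> ?I"
      proof (cases "A *v exp_shift k + \<delta> = \<alpha>")
        case True show ?thesis unfolding if_P[OF True] by (rule qI)
      next
        case False show ?thesis unfolding if_not_P[OF False] by (rule sym_idealD(1)[OF I])
      qed
      ultimately show ?thesis by (simp only: sym_idealD(4)[OF I])
    qed
    then have "?res \<alpha> Z \<in> ?I" for \<alpha>
      unfolding Z_def restrict_sym_sum restrict_sym_scale by (intro res_sum sym_idealD(3)[OF I])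
    then have "?res \<alpha> (P + Z) \<in> ?I" for \<alpha>
      unfolding restrict_sym_add by (intro sym_idealD(2)[OF I] spec[OF P(2)])
    moreover have "weyl_op (P + Z) = (\<lambda>f. T f + R (Q f))"
    proof
      fix f
      have "weyl_op Z f = (weyl_op r \<circ> weyl_op q) f" by (simp add: weyl_op_comp Z_def)
      then show "weyl_op (P + Z) f = T f + R (Q f)" by (simp add: weyl_op_plus P(1) r q(1))
    qed
    ultimately show ?case by blast
  qed
  then have key: "\<exists>Q. weyl_op Q = weyl_op P \<and> (\<forall>\<alpha>. ?res \<alpha> Q \<in> ?I)" if "weyl_op P \<in> ?H" for P
    using that by blast
  show ?thesis
    unfolding graded_ideal_def hypergeometric_ideal_eq
  proof (intro ballI allI)
    fix P \<alpha> assume "P \<in> ?I"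
    then have "weyl_op P \<in> ?H" by (rule CollectD)
    from key[OF this] obtain Q where Q: "weyl_op Q = weyl_op P" "\<forall>\<alpha>. ?res \<alpha> Q \<in> ?I" by (elim exE conjE)
    have "Q = P" using Q(1) by (simp only: weyl_op_inject)
    then show "?res \<alpha> P \<in> ?I" using Q(2) by (simp only:)
  qed
qed


lemma generic_cell:
  fixes A :: "int^'n::finite^'d"
  assumes "\<And>u. A *v u = 0 \<Longrightarrow> u \<noteq> 0 \<Longrightarrow> w \<bullet> (\<chi> j. real_of_int (u $ j)) \<noteq> 0"
  shows "\<exists>C\<in>small_groebner_cells (hypergeometric_ideal A \<beta>). w \<in> interior C"
proof
  let ?H = "hypergeometric_ideal A \<beta>"
  let ?r = "{(w, w'). weyl_initial_ideal w ?H = weyl_initial_ideal w' ?H}"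
  show "?r `` {w} \<in> small_groebner_cells ?H"
    unfolding small_groebner_cells_def by (rule quotientI) simp
  have "?r `` {w} = {w'. weyl_initial_ideal w' ?H = weyl_initial_ideal w ?H}" by auto
  moreover have "w \<in> interior {w'. weyl_initial_ideal w' ?H = weyl_initial_ideal w ?H}"
    by (rule weyl_initial_ideal_locally_constant[OF hypergeometric_ideal_def graded_hypergeometric_ideal assms])
  ultimately show "w \<in> interior (?r `` {w})" by (simp only:)
qed

section \<open>The initial ideal of the toric ideal\<close>

definition nat_real :: "nat^'n \<Rightarrow> real^'n" where "nat_real p = (\<chi> j. real (p $ j))"

definition nat_int :: "nat^'n \<Rightarrow> int^'n" where "nat_int p = (\<chi> j. int (p $ j))"

lemma nat_real_add: "nat_real (p + q) = nat_real p + nat_real q"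
  by (simp add: nat_real_def vec_eq_iff)

lemma nat_int_add: "nat_int (p + q) = nat_int p + nat_int q"
  by (simp add: nat_int_def vec_eq_iff)

text \<open>The coefficient at t^\<alpha> of the image of \<open>f\<close> under the monomial map
  sending \<partial>^p to t^(Ap).\<close>

definition fiber_sum :: "int^'n^'d \<Rightarrow> int^'d \<Rightarrow> 'n::finite mpoly \<Rightarrow> complex" where
  "fiber_sum A \<alpha> f = (\<Sum>p\<in>keys f. if A *v nat_int p = \<alpha> then lookup f p else 0)"

lemma fiber_sum_alt:
  assumes "finite S" "keys f \<subseteq> S"
  shows "fiber_sum A \<alpha> f = (\<Sum>p\<in>S. if A *v nat_int p = \<alpha> then lookup f p else 0)"
  unfolding fiber_sum_def
  by (rule sum.mono_neutral_left) (use assms in \<open>auto simp: in_keys_iff\<close>)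

lemma fiber_sum_add: "fiber_sum A \<alpha> (f + g) = fiber_sum A \<alpha> f + fiber_sum A \<alpha> g"
proof -
  let ?S = "keys f \<union> keys g"
  have "keys (f + g) \<subseteq> ?S" by (rule keys_add)
  then show ?thesis
    by (auto simp: fiber_sum_alt[of ?S] lookup_add simp flip: sum.distrib intro!: sum.cong)
qed

lemma fiber_sum_sum: "fiber_sum A \<alpha> (\<Sum>i\<in>X. f i) = (\<Sum>i\<in>X. fiber_sum A \<alpha> (f i))"
  by (induction X rule: infinite_finite_induct) (simp_all add: fiber_sum_add, simp_all add: fiber_sum_def)

lemma fiber_sum_single: "fiber_sum A \<alpha> (single p c) = (if A *v nat_int p = \<alpha> then c else 0)"
  by (subst fiber_sum_alt[of "{p}"]) simp_all

lemma nat_int_pos_neg_part: "A *v nat_int (pos_part u) = A *v nat_int (neg_part u)" if "u \<in> kernel_lattice A"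
proof -
  have "nat_int (pos_part u) - nat_int (neg_part u) = u"
    by (simp add: nat_int_def pos_part_def neg_part_def vec_eq_iff)
  then have "A *v nat_int (pos_part u) - A *v nat_int (neg_part u) = 0"
    using that by (simp add: kernel_lattice_def flip: matrix_vector_mult_diff_distrib)
  then show ?thesis by simp
qed

text \<open>In a monomial multiple of a binomial generator both terms lie in one fiber, with
  opposite coefficients.\<close>

lemma fiber_sum_toric_ideal:
  assumes "f \<in> toric_ideal A" shows "fiber_sum A \<alpha> f = 0"
proof -
  \<comment> \<open>Quantifying over the multiplier \<open>g\<close> makes \<open>T\<close> an
    ideal; \<open>g = 1\<close> gives the claim.\<close>
  define T where "T = {f :: 'a mpoly. \<forall>g. fiber_sum A \<alpha> (g * f) = 0}"
  have "toric_ideal A \<subseteq> T"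
    unfolding toric_ideal_def
  proof (rule ideal_gen_minimal)
    show "{mpoly_monom (pos_part u) - mpoly_monom (neg_part u) |u. u \<in> kernel_lattice A} \<subseteq> T"
    proof
      fix b assume "b \<in> {mpoly_monom (pos_part u) - mpoly_monom (neg_part u) |u. u \<in> kernel_lattice A}"
      then obtain u where u: "u \<in> kernel_lattice A" and b: "b = mpoly_monom (pos_part u) - mpoly_monom (neg_part u)"
        by blast
      have "fiber_sum A \<alpha> (g * b) = 0" for g
      proof -
        have "g * b = (\<Sum>p\<in>keys g. single (p + pos_part u) (lookup g p)
            + single (p + neg_part u) (- lookup g p))"
          unfolding b mpoly_monom_def
          by (subst (1) poly_mapping_decompose[of g])
             (simp add: sum_distrib_right right_diff_distrib mult_single single_uminus sum_subtractf)
        then show ?thesis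
          by (auto simp: fiber_sum_sum fiber_sum_add fiber_sum_single nat_int_add matrix_vector_right_distrib
              nat_int_pos_neg_part[OF u] intro!: sum.neutral)
      qed
      then show "b \<in> T" by (simp add: T_def)
    qed
    show "0 \<in> T" by (simp add: T_def fiber_sum_def)
    show "x + y \<in> T" if "x \<in> T" "y \<in> T" for x y
      using that by (simp add: T_def distrib_left fiber_sum_add)
    show "r * x \<in> T" if "x \<in> T" for r x
      using that by (simp add: T_def flip: mult.assoc)
  qed
  then have "fiber_sum A \<alpha> (1 * f) = 0" using assms unfolding T_def by blast
  then show ?thesis by simp
qed

text \<open>Dividing both monomials by their greatest common divisor \<open>r\<close> leaves the
  positive and the negative part of a kernel vector.\<close>

lemma toric_ideal_fiber_binomial:
  assumes "A *v nat_int p = A *v nat_int q"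
  shows "mpoly_monom p - mpoly_monom q \<in> toric_ideal A"
proof -
  define u where "u = nat_int p - nat_int q"
  define r where "r = (\<chi> j. min (p $ j) (q $ j))"
  have "u \<in> kernel_lattice A"
    using assms by (simp add: u_def kernel_lattice_def matrix_vector_mult_diff_distrib)
  then have "mpoly_monom r * (mpoly_monom (pos_part u) - mpoly_monom (neg_part u)) \<in> toric_ideal A"
    unfolding toric_ideal_def by (intro ideal_gen_mult ideal_gen_base) blast
  moreover have "r + pos_part u = p" "r + neg_part u = q"
    by (auto simp: vec_eq_iff r_def u_def pos_part_def neg_part_def nat_int_def)
  ultimately show ?thesis by (simp add: mpoly_monom_def right_diff_distrib mult_single)
qed

lemma initial_form_mono_diff:
  assumes "\<omega> q < \<omega> p"
  shows "initial_form \<omega> (mpoly_monom p - mpoly_monom q) = mpoly_monom p"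
proof -
  have keys: "keys (mpoly_monom p - mpoly_monom q) = {p, q}"
    using assms by (auto simp: in_keys_iff mpoly_monom_def lookup_minus lookup_single when_def split: if_splits)
  have set: "{k \<in> {p, q}. \<forall>k'\<in>{p, q}. \<omega> k' \<le> \<omega> k} = {p}" using assms by auto
  show ?thesis
    unfolding initial_form_def keys set using assms
    by (auto simp: mpoly_monom_def lookup_minus lookup_single when_def)
qed

definition toric_leads :: "int^'n^'d \<Rightarrow> real^'n \<Rightarrow> (nat^'n::finite) set" where
  "toric_leads A w = {p. \<exists>q. A *v nat_int p = A *v nat_int q \<and> w \<bullet> nat_real q < w \<bullet> nat_real p}"

text \<open>The coefficients of a toric polynomial cancel in each fiber, so a term of largest weight
  shares its fiber with another one, which is strictly lighter by the assumption on
  \<open>w\<close>. Terms of largest weight in different fibers may tie; each of them lies in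
  \<open>toric_leads\<close> separately.\<close>

lemma poly_initial_ideal_toric:
  fixes A :: "int^'n::finite^'d"
  assumes w: "\<And>u. A *v u = 0 \<Longrightarrow> u \<noteq> 0 \<Longrightarrow> w \<bullet> (\<chi> j. real_of_int (u $ j)) \<noteq> 0"
  shows "poly_initial_ideal w (toric_ideal A) = ideal_gen (mpoly_monom ` toric_leads A w)"
proof
  let ?\<omega> = "\<lambda>p. w \<bullet> (\<chi> j. real (p $ j))"
  have "initial_form ?\<omega> f \<in> ideal_gen (mpoly_monom ` toric_leads A w)" if f: "f \<in> toric_ideal A" for f
    unfolding initial_form_def
  proof (rule ideal_gen_sum)
    fix p assume "p \<in> {k \<in> keys f. \<forall>k'\<in>keys f. ?\<omega> k' \<le> ?\<omega> k}"
    then have p: "p \<in> keys f" "\<And>q. q \<in> keys f \<Longrightarrow> ?\<omega> q \<le> ?\<omega> p" by auto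
    have "\<exists>q\<in>keys f. q \<noteq> p \<and> A *v nat_int q = A *v nat_int p"
    proof (rule ccontr)
      assume "\<not> ?thesis"
      then have "fiber_sum A (A *v nat_int p) f = (\<Sum>q\<in>keys f. if q = p then lookup f p else 0)"
        unfolding fiber_sum_def by (intro sum.cong) auto
      then show False using p(1) fiber_sum_toric_ideal[OF f] by (simp add: in_keys_iff)
    qed
    then obtain q where q: "q \<in> keys f" "q \<noteq> p" "A *v nat_int q = A *v nat_int p" by blast
    have "A *v (nat_int q - nat_int p) = 0" using q(3) by (simp add: matrix_vector_mult_diff_distrib)
    moreover have "nat_int q - nat_int p \<noteq> 0" using q(2) by (simp add: nat_int_def vec_eq_iff)
    moreover have "w \<bullet> (\<chi> j. real_of_int ((nat_int q - nat_int p) $ j)) = ?\<omega> q - ?\<omega> p"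
      by (simp add: inner_vec_def nat_int_def algebra_simps sum_subtractf)
    ultimately have "?\<omega> q < ?\<omega> p" using w p(2)[OF q(1)] by force
    then have "p \<in> toric_leads A w" using q(3)[symmetric] unfolding toric_leads_def nat_real_def by blast
    then have "single 0 (lookup f p) * mpoly_monom p \<in> ideal_gen (mpoly_monom ` toric_leads A w)"
      by (intro ideal_gen_mult ideal_gen_base imageI)
    then show "single p (lookup f p) \<in> ideal_gen (mpoly_monom ` toric_leads A w)"
      by (simp add: mpoly_monom_def mult_single)
  qed
  then show "poly_initial_ideal w (toric_ideal A) \<subseteq> ideal_gen (mpoly_monom ` toric_leads A w)"
    unfolding poly_initial_ideal_def by (intro ideal_gen_subsetI) blast
  have "mpoly_monom p \<in> initial_form ?\<omega> ` toric_ideal A" if "p \<in> toric_leads A w" for p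
  proof -
    obtain q where q: "A *v nat_int p = A *v nat_int q" "?\<omega> q < ?\<omega> p"
      using \<open>p \<in> toric_leads A w\<close> by (auto simp: toric_leads_def nat_real_def)
    show ?thesis
      using initial_form_mono_diff[of ?\<omega> q p, OF q(2)] toric_ideal_fiber_binomial[OF q(1)]
      by (intro image_eqI[of _ _ "mpoly_monom p - mpoly_monom q"]) simp_all
  qed
  then show "ideal_gen (mpoly_monom ` toric_leads A w) \<subseteq> poly_initial_ideal w (toric_ideal A)"
    unfolding poly_initial_ideal_def by (intro ideal_gen_subsetI) (auto intro: ideal_gen_base)
qed

lemma toric_leads_add: "p \<in> toric_leads A w \<Longrightarrow> r + p \<in> toric_leads A w"
proof -
  assume "p \<in> toric_leads A w"
  then obtain q where "A *v nat_int p = A *v nat_int q" "w \<bullet> nat_real q < w \<bullet> nat_real p"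
    by (auto simp: toric_leads_def)
  then have "A *v nat_int (r + p) = A *v nat_int (r + q)" "w \<bullet> nat_real (r + q) < w \<bullet> nat_real (r + p)"
    by (simp_all add: nat_int_add nat_real_add matrix_vector_right_distrib inner_add_right)
  then show ?thesis unfolding toric_leads_def by blast
qed

text \<open>For an upward closed \<open>M\<close> the polynomials supported in \<open>M\<close>
  already form an ideal.\<close>

lemma monom_mem_monomial_ideal:
  assumes up: "\<And>p r. p \<in> M \<Longrightarrow> r + p \<in> M" and p: "mpoly_monom p \<in> ideal_gen (mpoly_monom ` M)"
  shows "p \<in> M"
proof -
  have "ideal_gen (mpoly_monom ` M) \<subseteq> {f. keys f \<subseteq> M}"
  proof (rule ideal_gen_minimal)
    show "mpoly_monom ` M \<subseteq> {f. keys f \<subseteq> M}" by (auto simp: mpoly_monom_def)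
    show "x + y \<in> {f. keys f \<subseteq> M}" if "x \<in> {f. keys f \<subseteq> M}" "y \<in> {f. keys f \<subseteq> M}"
      for x y :: "'a mpoly" using that keys_add[of x y] by blast
    show "r * x \<in> {f. keys f \<subseteq> M}" if "x \<in> {f. keys f \<subseteq> M}"
      for r x :: "'a mpoly" using that keys_mult[of r x] up by fastforce
  qed simp
  then show ?thesis using p by (auto simp: mpoly_monom_def)
qed

section \<open>The example\<close>

lemma exhaust_5:
  fixes x :: 5
  shows "x = 1 \<or> x = 2 \<or> x = 3 \<or> x = 4 \<or> x = 5"
proof (induct x)
  case (of_int z)
  \<comment> \<open>In this type \<open>5 = 0\<close>, so the residue 0 is the index written
    5.\<close>
  then have "z = 0 \<or> z = 1 \<or> z = 2 \<or> z = 3 \<or> z = 4" by fastforce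
  then show ?case by auto
qed

lemma forall_5: "(\<forall>i::5. P i) \<longleftrightarrow> P 1 \<and> P 2 \<and> P 3 \<and> P 4 \<and> P 5"
  by (metis exhaust_5)

lemma UNIV_5: "UNIV = {1, 2, 3, 4, 5::5}"
  using exhaust_5 by auto

lemma sum_5: "sum f (UNIV::5 set) = f 1 + f 2 + f 3 + f 4 + f 5"
  unfolding UNIV_5 by (simp add: ac_simps)

lemma vector_5 [simp]:
  "(vector [a, b, c, d, e] :: 'a::zero^5) $ 1 = a"
  "(vector [a, b, c, d, e] :: 'a::zero^5) $ 2 = b"
  "(vector [a, b, c, d, e] :: 'a::zero^5) $ 3 = c"
  "(vector [a, b, c, d, e] :: 'a::zero^5) $ 4 = d"
  "(vector [a, b, c, d, e] :: 'a::zero^5) $ 5 = e"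
  by (simp_all add: vector_def One_nat_def)

section \<open>The matrices, the direction and the exponent\<close>

definition mat_A :: "int^5^3" where
  "mat_A = vector [vector [20, -5, 3, 0, 0], vector [-3, 2, -1, 1, 0], vector [-16, 4, -1, 0, 1]]"

definition mat_B :: "int^2^5" where
  "mat_B = vector [vector [0, -1], vector [3, -4], vector [5, 0], vector [-1, 5], vector [-7, 0]]"

definition theta :: real where "theta = 15 + sqrt 2 / 100"

definition dir_w :: "real^5" where "dir_w = vector [theta - 4, 1, 0, 0, 0]"

definition exp_v :: "complex^5" where "exp_v = vector [0, 1, 0, -2, -3]"

lemma mat_A_nth [simp]:
  "mat_A $ 1 $ 1 = 20" "mat_A $ 1 $ 2 = -5" "mat_A $ 1 $ 3 = 3" "mat_A $ 1 $ 4 = 0" "mat_A $ 1 $ 5 = 0"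
  "mat_A $ 2 $ 1 = -3" "mat_A $ 2 $ 2 = 2" "mat_A $ 2 $ 3 = -1" "mat_A $ 2 $ 4 = 1" "mat_A $ 2 $ 5 = 0"
  "mat_A $ 3 $ 1 = -16" "mat_A $ 3 $ 2 = 4" "mat_A $ 3 $ 3 = -1" "mat_A $ 3 $ 4 = 0" "mat_A $ 3 $ 5 = 1"
  by (simp_all add: mat_A_def)

lemma mat_B_nth [simp]:
  "mat_B $ 1 $ 1 = 0" "mat_B $ 1 $ 2 = -1" "mat_B $ 2 $ 1 = 3" "mat_B $ 2 $ 2 = -4"
  "mat_B $ 3 $ 1 = 5" "mat_B $ 3 $ 2 = 0" "mat_B $ 4 $ 1 = -1" "mat_B $ 4 $ 2 = 5"
  "mat_B $ 5 $ 1 = -7" "mat_B $ 5 $ 2 = 0"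
  by (simp_all add: mat_B_def)

lemma dir_w_nth [simp]:
  "dir_w $ 1 = theta - 4" "dir_w $ 2 = 1" "dir_w $ 3 = 0" "dir_w $ 4 = 0" "dir_w $ 5 = 0"
  by (simp_all add: dir_w_def)

lemma exp_v_nth [simp]:
  "exp_v $ 1 = 0" "exp_v $ 2 = 1" "exp_v $ 3 = 0" "exp_v $ 4 = -2" "exp_v $ 5 = -3"
  by (simp_all add: exp_v_def)

lemma theta_bounds: "15 < theta" "theta < 16"
proof -
  have "sqrt 2 < sqrt 4" by (rule real_sqrt_less_mono) simp
  then show "15 < theta" "theta < 16" by (simp_all add: theta_def)
qed

lemma full_row_rank_mat_A: "full_row_rank mat_A"
proof -
  have "surj ((*v) (map_matrix real_of_int mat_A))"
  proof (rule surjI)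
    fix y :: "real^3"
    \<comment> \<open>Columns 3, 4, 5 of A are (3,-1,-1) and two unit vectors, a triangular system:
      the first equation determines entry 3, and the other two entries are corrected by it.\<close>
    show "map_matrix real_of_int mat_A *v
        vector [0, 0, y $ 1 / 3, y $ 2 + y $ 1 / 3, y $ 3 + y $ 1 / 3] = y"
      by (simp add: vec_eq_iff forall_3 matrix_vector_mult_def map_matrix_def sum_5)
  qed
  then show ?thesis unfolding full_row_rank_def by (subst full_rank_surjective)
qed

lemma homogeneous_mat_A: "homogeneous_matrix mat_A"
  unfolding homogeneous_matrix_def
\<comment> \<open>All column sums of A are 1.\<close>
proof (intro exI[of _ "vector [1, 1, 1]"] exI[of _ 1] conjI allI)
  show "(vector [1, 1, 1] :: real^3) \<noteq> 0" by (simp add: vec_eq_iff forall_3)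
  fix j :: 5
  show "column j (map_matrix real_of_int mat_A) \<in> {x. vector [1, 1, 1] \<bullet> x = 1}"
    using exhaust_5[of j] by (auto simp: column_def map_matrix_def inner_vec_def sum_3)
qed simp

lemma mat_B_mult: "mat_B *v c = vector [- (c $ 2), 3 * c $ 1 - 4 * c $ 2, 5 * c $ 1, 5 * c $ 2 - c $ 1, - 7 * c $ 1]"
  by (simp add: vec_eq_iff forall_5 matrix_vector_mult_def sum_2)

lemma mat_A_mult_eq_0:
  "mat_A *v u = 0 \<longleftrightarrow> 20 * u $ 1 - 5 * u $ 2 + 3 * u $ 3 = 0 \<and>
     u $ 4 = 3 * u $ 1 - 2 * u $ 2 + u $ 3 \<and> u $ 5 = 16 * u $ 1 - 4 * u $ 2 + u $ 3"
  by (auto simp: vec_eq_iff forall_3 matrix_vector_mult_def sum_5)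

lemma kernel_lattice_mat_A: "kernel_lattice mat_A = range ((*v) mat_B)"
proof (intro equalityI subsetI)
  fix u assume "u \<in> kernel_lattice mat_A"
  then have u: "20 * u $ 1 - 5 * u $ 2 + 3 * u $ 3 = 0" "u $ 4 = 3 * u $ 1 - 2 * u $ 2 + u $ 3"
    "u $ 5 = 16 * u $ 1 - 4 * u $ 2 + u $ 3"
    by (simp_all add: kernel_lattice_def mat_A_mult_eq_0)
  \<comment> \<open>The first equation makes 3 u_3, hence u_3, divisible by 5. Rows 3 and 1 of B,
    which are (5,0) and (0,-1), then give the integer coordinates u_3/5 and -u_1.\<close>
  define k where "k = u $ 3 div 5"
  have k: "u $ 3 = 5 * k" using u(1) unfolding k_def by presburger
  have "u = mat_B *v vector [k, - (u $ 1)]"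
    using u k by (simp add: mat_B_mult vec_eq_iff forall_5)
  then show "u \<in> range ((*v) mat_B)" by blast
qed (auto simp: kernel_lattice_def mat_A_mult_eq_0 mat_B_mult)

lemma gale_dual_mat_B: "gale_dual mat_A mat_B"
  unfolding gale_dual_def bij_betw_def kernel_lattice_mat_A
  by (auto simp: inj_on_def mat_B_mult vec_eq_iff forall_5 forall_2)

lemma dir_w_mat_B: "dir_w v* map_matrix real_of_int mat_B = vector [3, - theta]"
  by (simp add: vec_eq_iff forall_2 vector_matrix_mult_def map_matrix_def sum_5)

lemma mat_A_exp_v: "map_matrix of_int mat_A *v exp_v = vector [-5, 0, 1]"
  by (simp add: vec_eq_iff forall_3 matrix_vector_mult_def map_matrix_def sum_5)

lemma sqrt_2_irrational: "sqrt 2 \<notin> \<rat>"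
proof
  assume "sqrt 2 \<in> \<rat>"
  then obtain m n :: nat where n: "n \<noteq> 0" and eq: "\<bar>sqrt 2\<bar> = real m / real n" and co: "coprime m n"
    by (rule Rats_abs_nat_div_natE)
  have "real m = sqrt 2 * real n" using eq n by (simp add: field_simps)
  then have "real m ^ 2 = 2 * real n ^ 2" by (simp add: power_mult_distrib)
  then have mn: "m ^ 2 = 2 * n ^ 2" by (metis of_nat_eq_iff of_nat_mult of_nat_numeral of_nat_power)
  then have "even m" by (metis dvd_triv_left even_power)
  then obtain k where "m = 2 * k" by blast
  then have "n ^ 2 = 2 * k ^ 2" using mn by (simp add: power2_eq_square)
  then have "even n" by (metis dvd_triv_left even_power)
  then show False using \<open>even m\<close> co by (metis coprime_common_divisor odd_one)
qed

lemma dir_w_inner: "dir_w \<bullet> (\<chi> j. real_of_int ((mat_B *v c) $ j)) = 3 * c $ 1 - theta * c $ 2"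
  by (simp add: inner_vec_def sum_5 mat_B_mult algebra_simps)

lemma dir_w_inner_nonzero:
  assumes "mat_A *v u = 0" "u \<noteq> 0"
  shows "dir_w \<bullet> (\<chi> j. real_of_int (u $ j)) \<noteq> 0"
proof
  assume 0: "dir_w \<bullet> (\<chi> j. real_of_int (u $ j)) = 0"
  have "u \<in> range ((*v) mat_B)" using assms(1) unfolding kernel_lattice_mat_A[symmetric] kernel_lattice_def by simp
  then obtain c where c: "u = mat_B *v c" by blast
  have eq: "3 * real_of_int (c $ 1) = theta * real_of_int (c $ 2)" using 0 unfolding c dir_w_inner by simp
  show False
  proof (cases "c $ 2 = 0")
    case True
    then have "c $ 1 = 0" using eq by simp
    then show False using True assms(2) c by (simp add: mat_B_mult vec_eq_iff forall_5)
  next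
    case False
    then have "sqrt 2 = (300 * real_of_int (c $ 1) - 1500 * real_of_int (c $ 2)) / real_of_int (c $ 2)"
      using eq by (simp add: theta_def field_simps)
    moreover have "\<dots> \<in> \<rat>" by simp
    ultimately show False using sqrt_2_irrational by simp
  qed
qed

lemma poly_initial_ideal_mat_A:
  "poly_initial_ideal dir_w (toric_ideal mat_A) = ideal_gen (mpoly_monom ` toric_leads mat_A dir_w)"
  by (rule poly_initial_ideal_toric[OF dir_w_inner_nonzero])

lemma generic_direction_dir_w: "generic_direction mat_A \<beta> dir_w"
  unfolding generic_direction_def monomial_ideal_def
proof
  show "\<exists>M. poly_initial_ideal dir_w (toric_ideal mat_A) = ideal_gen (mpoly_monom ` M)"
    using poly_initial_ideal_mat_A by blast
  show "\<exists>C\<in>small_groebner_cells (hypergeometric_ideal mat_A \<beta>). dir_w \<in> interior C"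
    by (rule generic_cell[OF dir_w_inner_nonzero])
qed

text \<open>Entries 1 and 3 of v are zero, so it is enough that every leading monomial contains one
  of these two variables. If p omitted both, rows 1 and 3 of B would give c_2 \<ge> 0 and c_1 \<le>
  0 for p - q = B c, contradicting 3 c_1 > theta c_2.\<close>

lemma fake_exponent_exp_v: "fake_exponent mat_A (map_matrix of_int mat_A *v exp_v) dir_w exp_v"
  unfolding fake_exponent_def
proof (intro conjI allI impI refl)
  fix p assume "mpoly_monom p \<in> poly_initial_ideal dir_w (toric_ideal mat_A)"
  then have "mpoly_monom p \<in> ideal_gen (mpoly_monom ` toric_leads mat_A dir_w)"
    unfolding poly_initial_ideal_mat_A .
  then have "p \<in> toric_leads mat_A dir_w" using monom_mem_monomial_ideal[of "toric_leads mat_A dir_w" p] toric_leads_add by blast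
  then obtain q where q: "mat_A *v nat_int p = mat_A *v nat_int q" "dir_w \<bullet> nat_real q < dir_w \<bullet> nat_real p"
    by (auto simp: toric_leads_def)
  have "nat_int p - nat_int q \<in> range ((*v) mat_B)"
    unfolding kernel_lattice_mat_A[symmetric] kernel_lattice_def
    using q(1) by (simp add: matrix_vector_mult_diff_distrib)
  then obtain c where c: "nat_int p - nat_int q = mat_B *v c" by blast
  have "dir_w \<bullet> nat_real p - dir_w \<bullet> nat_real q = dir_w \<bullet> (\<chi> j. real_of_int ((nat_int p - nat_int q) $ j))"
    by (simp add: inner_vec_def nat_real_def nat_int_def sum_5 algebra_simps)
  then have pos: "3 * real_of_int (c $ 1) - theta * real_of_int (c $ 2) > 0"
    using q(2) unfolding c dir_w_inner by simp
  have comp: "int (p $ j) - int (q $ j) = (mat_B *v c) $ j" for j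
    unfolding c[symmetric] by (simp add: nat_int_def)
  have "p $ 1 > 0 \<or> p $ 3 > 0"
  proof (rule ccontr)
    assume "\<not> ?thesis"
    then have "c $ 2 \<ge> 0" "c $ 1 \<le> 0" using comp[of 1] comp[of 3] by (simp_all add: mat_B_mult)
    then have "theta * real_of_int (c $ 2) \<ge> 0" "real_of_int (c $ 1) \<le> 0" using theta_bounds by simp_all
    then show False using pos by linarith
  qed
  then obtain j where j: "p $ j > 0" "exp_v $ j = 0" by auto
  then have "(\<Prod>k<p $ j. exp_v $ j - of_nat k) = 0" by (intro prod_zero) auto
  then show "falling exp_v p = 0" unfolding falling_def by (intro prod_zero) auto
qed

section \<open>Negative supports and the distinguished collection\<close>

lemma mem_shifted_nsupp:
  "1 \<in> shifted_nsupp exp_v u \<longleftrightarrow> u $ 1 < 0"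
  "2 \<in> shifted_nsupp exp_v u \<longleftrightarrow> u $ 2 < -1"
  "3 \<in> shifted_nsupp exp_v u \<longleftrightarrow> u $ 3 < 0"
  "4 \<in> shifted_nsupp exp_v u \<longleftrightarrow> u $ 4 < 2"
  "5 \<in> shifted_nsupp exp_v u \<longleftrightarrow> u $ 5 < 3"
proof -
  have "(\<exists>k<0. of_int m = (of_int k :: complex)) \<longleftrightarrow> m < 0" for m :: int by auto
  moreover have "exp_v $ 2 + of_int (u $ 2) = of_int (1 + u $ 2)"
    "exp_v $ 4 + of_int (u $ 4) = of_int (u $ 4 - 2)" "exp_v $ 5 + of_int (u $ 5) = of_int (u $ 5 - 3)"
    by simp_all
  ultimately show 
    "1 \<in> shifted_nsupp exp_v u \<longleftrightarrow> u $ 1 < 0"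
    "2 \<in> shifted_nsupp exp_v u \<longleftrightarrow> u $ 2 < -1"
    "3 \<in> shifted_nsupp exp_v u \<longleftrightarrow> u $ 3 < 0"
    "4 \<in> shifted_nsupp exp_v u \<longleftrightarrow> u $ 4 < 2"
    "5 \<in> shifted_nsupp exp_v u \<longleftrightarrow> u $ 5 < 3"
    unfolding shifted_nsupp_def nsupp_def by (auto simp del: of_int_add of_int_diff)
qed

definition lattice_nsupp :: "int \<Rightarrow> int \<Rightarrow> 5 set" where
  "lattice_nsupp a b = shifted_nsupp exp_v (mat_B *v vector [a, b])"

lemma set_5_eq_iff:
  "X = Y \<longleftrightarrow> (1 \<in> X \<longleftrightarrow> 1 \<in> Y) \<and> (2 \<in> X \<longleftrightarrow> 2 \<in> Y) \<and> (3 \<in> X \<longleftrightarrow> 3 \<in> Y) \<and>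
     (4 \<in> X \<longleftrightarrow> 4 \<in> Y) \<and> (5 \<in> X \<longleftrightarrow> 5 \<in> Y)" for X Y :: "5 set"
  unfolding set_eq_iff forall_5 ..

lemma subset_5_iff:
  "X \<subseteq> Y \<longleftrightarrow> (1 \<in> X \<longrightarrow> 1 \<in> Y) \<and> (2 \<in> X \<longrightarrow> 2 \<in> Y) \<and> (3 \<in> X \<longrightarrow> 3 \<in> Y) \<and>
     (4 \<in> X \<longrightarrow> 4 \<in> Y) \<and> (5 \<in> X \<longrightarrow> 5 \<in> Y)" for X Y :: "5 set"
  unfolding subset_iff forall_5 ..

lemma mem_lattice_nsupp:
  "1 \<in> lattice_nsupp a b \<longleftrightarrow> b > 0"
  "2 \<in> lattice_nsupp a b \<longleftrightarrow> 3 * a - 4 * b < -1"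
  "3 \<in> lattice_nsupp a b \<longleftrightarrow> a < 0"
  "4 \<in> lattice_nsupp a b \<longleftrightarrow> 5 * b - a < 2"
  "5 \<in> lattice_nsupp a b \<longleftrightarrow> a \<ge> 0"
  unfolding lattice_nsupp_def mem_shifted_nsupp by (auto simp: mat_B_mult)

lemma ball_kernel_lattice:
  "(\<forall>u\<in>kernel_lattice mat_A. P u) \<longleftrightarrow> (\<forall>a b. P (mat_B *v vector [a, b]))"
proof -
  have "c = vector [c $ 1, c $ 2]" for c :: "int^2" by (simp add: vec_eq_iff forall_2)
  then have "(\<forall>c. P (mat_B *v c)) \<longleftrightarrow> (\<forall>a b. P (mat_B *v vector [a, b]))" by metis
  then show ?thesis unfolding kernel_lattice_mat_A by simp
qed

lemma lattice_nsupp_eq_iff: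
  "lattice_nsupp a b = X \<longleftrightarrow> (b > 0 \<longleftrightarrow> 1 \<in> X) \<and> (3 * a - 4 * b < -1 \<longleftrightarrow> 2 \<in> X) \<and>
     (a < 0 \<longleftrightarrow> 3 \<in> X) \<and> (5 * b - a < 2 \<longleftrightarrow> 4 \<in> X) \<and> (a \<ge> 0 \<longleftrightarrow> 5 \<in> X)"
  unfolding set_5_eq_iff[of "lattice_nsupp a b"] mem_lattice_nsupp ..

text \<open>The elements 3 and 5 exclude each other and one of them always occurs, so four
  inequalities give sixteen sign patterns; linear arithmetic over the integers refutes eight of
  them.\<close>

lemma lattice_nsupp_cases:
  "lattice_nsupp a b = {1, 5} \<or> lattice_nsupp a b = {1, 2, 5} \<or> lattice_nsupp a b = {1, 4, 5} \<or>
   lattice_nsupp a b = {4, 5} \<or> lattice_nsupp a b = {1, 2, 3} \<or> lattice_nsupp a b = {3, 4} \<or>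
   lattice_nsupp a b = {2, 3, 4} \<or> lattice_nsupp a b = {2, 3}"
proof -
  have neg: "a < 0 \<longleftrightarrow> \<not> a \<ge> 0" by linarith
  show ?thesis
    unfolding lattice_nsupp_eq_iff neg
    by (cases "b > 0"; cases "a \<ge> 0"; cases "3 * a - 4 * b < -1"; cases "5 * b - a < 2";
        (linarith | simp del: not_less not_le))
qed

text \<open>For each of the six sets other than {4,5} and {3,4} the point also has negative weight
  3a - theta b, which rules the set out as distinguished. The tightest case is (4,1), of weight 12 -
  theta.\<close>

lemma lattice_nsupp_witnesses:
  "lattice_nsupp 1 1 = {1, 5}" "lattice_nsupp 0 1 = {1, 2, 5}" "lattice_nsupp 4 1 = {1, 4, 5}"
  "lattice_nsupp 0 0 = {4, 5}" "lattice_nsupp (-1) 1 = {1, 2, 3}" "lattice_nsupp (-1) (-1) = {3, 4}"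
  "lattice_nsupp (-1) 0 = {2, 3, 4}" "lattice_nsupp (-2) 0 = {2, 3}"
  unfolding lattice_nsupp_eq_iff by simp_all

lemma nsupps_eq:
  "nsupps mat_A exp_v = {{1, 5}, {1, 2, 5}, {1, 4, 5}, {4, 5}, {1, 2, 3}, {3, 4}, {2, 3, 4}, {2, 3}}"
    (is "_ = ?S")
proof
  have "lattice_nsupp a b \<in> ?S" for a b
    using lattice_nsupp_cases[of a b] by (elim disjE) simp_all
  then have "\<forall>u\<in>kernel_lattice mat_A. shifted_nsupp exp_v u \<in> ?S"
    unfolding ball_kernel_lattice lattice_nsupp_def[symmetric] by (intro allI)
  then show "nsupps mat_A exp_v \<subseteq> ?S" unfolding nsupps_def image_subset_iff .
  have mem: "lattice_nsupp a b \<in> nsupps mat_A exp_v" for a b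
    unfolding nsupps_def lattice_nsupp_def kernel_lattice_mat_A by (intro imageI rangeI)
  note mem[of 1 1] mem[of 0 1] mem[of 4 1] mem[of 0 0] mem[of "-1" 1] mem[of "-1" "-1"] mem[of "-1" 0] mem[of "-2" 0]
  from this[unfolded lattice_nsupp_witnesses]
  show "?S \<subseteq> nsupps mat_A exp_v" by (intro insert_subsetI empty_subsetI)
qed

lemma nsupp_exp_v: "nsupp exp_v = {4, 5}"
proof -
  have "shifted_nsupp exp_v 0 = {4, 5}" unfolding set_5_eq_iff mem_shifted_nsupp by simp
  moreover have "shifted_nsupp exp_v 0 = nsupp exp_v" by (simp add: shifted_nsupp_def zero_vec_def[symmetric])
  ultimately show ?thesis by simp
qed

lemma distinguished_iff:
  "I \<in> distinguished mat_A dir_w exp_v \<longleftrightarrow> I \<in> nsupps mat_A exp_v \<and>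
     (\<forall>a b. lattice_nsupp a b = I \<longrightarrow> 3 * real_of_int a - theta * real_of_int b \<ge> 0)"
  unfolding distinguished_def mem_Collect_eq ball_kernel_lattice lattice_nsupp_def dir_w_inner
  by simp

lemma distinguished_eq: "distinguished mat_A dir_w exp_v = {{3, 4}, {4, 5}}"
proof -
  have neg: "lattice_nsupp a b \<notin> distinguished mat_A dir_w exp_v"
    if "3 * real_of_int a - theta * real_of_int b < 0" for a b
    using that unfolding distinguished_iff by (auto simp: not_le)
  note neg[of 1 1] neg[of 0 1] neg[of 4 1] neg[of "-1" 1] neg[of "-1" 0] neg[of "-2" 0]
  from this[unfolded lattice_nsupp_witnesses] have out: "{1, 5} \<notin> distinguished mat_A dir_w exp_v"
    "{1, 2, 5} \<notin> distinguished mat_A dir_w exp_v" "{1, 4, 5} \<notin> distinguished mat_A dir_w exp_v"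
    "{1, 2, 3} \<notin> distinguished mat_A dir_w exp_v" "{2, 3, 4} \<notin> distinguished mat_A dir_w exp_v"
    "{2, 3} \<notin> distinguished mat_A dir_w exp_v"
    using theta_bounds by simp_all
  have "3 * real_of_int a - theta * real_of_int b \<ge> 0" if "lattice_nsupp a b = {4, 5}" for a b
  proof -
    have "a \<ge> 0" "b \<le> 0" using that unfolding lattice_nsupp_eq_iff by auto
    then have "theta * real_of_int b \<le> 0" using theta_bounds by (intro mult_nonneg_nonpos) auto
    then show ?thesis using \<open>a \<ge> 0\<close> by simp
  qed
  moreover have "3 * real_of_int a - theta * real_of_int b \<ge> 0" if "lattice_nsupp a b = {3, 4}" for a b
  proof -
    have "3 * a - 4 * b \<ge> -1" "a < 0" "b \<le> 0" using that unfolding lattice_nsupp_eq_iff by auto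
    \<comment> \<open>Here b = 0 would give 3a \<ge> -1 with a < 0. From 3a \<ge> 4b - 1 and b \<le>
      -1 follows 3a \<ge> 15b, which suffices because theta exceeds 15.\<close>
    then have "b < 0" "3 * a - 15 * b \<ge> 0" by linarith+
    then have "3 * real_of_int a - 15 * real_of_int b \<ge> 0" "real_of_int b < 0"
      by (simp_all flip: of_int_mult of_int_diff)
    moreover have "theta * real_of_int b \<le> 15 * real_of_int b"
      using theta_bounds \<open>real_of_int b < 0\<close> by (intro mult_right_mono_neg) auto
    ultimately show ?thesis by linarith
  qed
  ultimately have "{4, 5} \<in> distinguished mat_A dir_w exp_v" "{3, 4} \<in> distinguished mat_A dir_w exp_v"
    unfolding distinguished_iff nsupps_eq by simp_all
  moreover have "distinguished mat_A dir_w exp_v \<subseteq> nsupps mat_A exp_v"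
    by (auto simp: distinguished_def)
  ultimately show ?thesis using out unfolding nsupps_eq
    by (intro equalityI subsetI) (auto simp only: insert_iff empty_iff subset_iff)
qed

lemma ordered_family_distinguished: "ordered_family mat_A dir_w exp_v {{3, 4}, {4, 5}}"
  unfolding ordered_family_def distinguished_eq nsupps_eq nsupp_exp_v
  by (simp add: subset_5_iff)

section \<open>Index sets of the generators\<close>

lemma Inter_family: "\<Inter>{{3, 4}, {4, 5}} = {4 :: 5}"
  by auto

lemma member_sets_family: "member_sets {{3, 4}, {4, 5}} = {{3}, {5 :: 5}}"
proof -
  have "member_sets {{3, 4}, {4, 5}} = (\<lambda>I. I - {4 :: 5}) ` {{3, 4}, {4, 5}}"
    unfolding member_sets_def Inter_family Setcompr_eq_image by simp
  moreover have "{3, 4} - {4 :: 5} = {3}" "{4, 5} - {4 :: 5} = {5}" by auto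
  ultimately show ?thesis by (simp only: image_insert image_empty)
qed

lemma nonmember_sets_family:
  "nonmember_sets mat_A exp_v {{3, 4}, {4, 5}} = {{2, 3}, {1, 5}, {1, 2, 3}, {1, 2, 5}, {1, 3, 5}, {1, 2, 3, 5}, {2, 3, 5}}"
proof -
  have ne: "{1, 5} \<noteq> {3, 4 :: 5}" "{1, 5} \<noteq> {4, 5 :: 5}" "{1, 2, 5} \<noteq> {3, 4 :: 5}" "{1, 2, 5} \<noteq> {4, 5 :: 5}"
    "{1, 4, 5} \<noteq> {3, 4 :: 5}" "{1, 4, 5} \<noteq> {4, 5 :: 5}" "{1, 2, 3} \<noteq> {3, 4 :: 5}" "{1, 2, 3} \<noteq> {4, 5 :: 5}"
    "{2, 3, 4} \<noteq> {3, 4 :: 5}" "{2, 3, 4} \<noteq> {4, 5 :: 5}" "{2, 3} \<noteq> {3, 4 :: 5}" "{2, 3} \<noteq> {4, 5 :: 5}"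
    unfolding set_5_eq_iff by simp_all
  have diff: "nsupps mat_A exp_v - {{3, 4}, {4, 5}} = {{1, 5}, {1, 2, 5}, {1, 4, 5}, {1, 2, 3}, {2, 3, 4}, {2, 3}}"
    unfolding nsupps_eq by (simp only: insert_Diff_if insert_iff empty_iff empty_Diff ne if_False if_True simp_thms)
  have split: "{f I J |I J. I \<in> {a, b} \<and> J \<in> S} = f a ` S \<union> f b ` S"
    for f :: "5 set \<Rightarrow> 5 set \<Rightarrow> 5 set" and a b S by blast
  have "nonmember_sets mat_A exp_v {{3, 4}, {4, 5}} =
      (\<lambda>J. ({3, 4} \<union> J) - {4}) ` {{1, 5}, {1, 2, 5}, {1, 4, 5}, {1, 2, 3}, {2, 3, 4}, {2, 3}} \<union>
      (\<lambda>J. ({4, 5} \<union> J) - {4}) ` {{1, 5}, {1, 2, 5}, {1, 4, 5}, {1, 2, 3}, {2, 3, 4}, {2, 3}}"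
    unfolding nonmember_sets_def Inter_family diff by (rule split)
  also have "\<dots> = {{1, 3, 5}, {1, 2, 3, 5}, {1, 3, 5}, {1, 2, 3}, {2, 3}, {2, 3}} \<union>
      {{1, 5}, {1, 2, 5}, {1, 5}, {1, 2, 3, 5}, {2, 3, 5}, {2, 3, 5}}"
  proof -
    have "({3, 4} \<union> {1, 5}) - {4 :: 5} = {1, 3, 5}" "({3, 4} \<union> {1, 2, 5}) - {4 :: 5} = {1, 2, 3, 5}"
      "({3, 4} \<union> {1, 4, 5}) - {4 :: 5} = {1, 3, 5}" "({3, 4} \<union> {1, 2, 3}) - {4 :: 5} = {1, 2, 3}"
      "({3, 4} \<union> {2, 3, 4}) - {4 :: 5} = {2, 3}" "({3, 4} \<union> {2, 3}) - {4 :: 5} = {2, 3}"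
      "({4, 5} \<union> {1, 5}) - {4 :: 5} = {1, 5}" "({4, 5} \<union> {1, 2, 5}) - {4 :: 5} = {1, 2, 5}"
      "({4, 5} \<union> {1, 4, 5}) - {4 :: 5} = {1, 5}" "({4, 5} \<union> {1, 2, 3}) - {4 :: 5} = {1, 2, 3, 5}"
      "({4, 5} \<union> {2, 3, 4}) - {4 :: 5} = {2, 3, 5}" "({4, 5} \<union> {2, 3}) - {4 :: 5} = {2, 3, 5}"
      unfolding set_5_eq_iff by simp_all
    then show ?thesis by (simp only: image_insert image_empty)
  qed
  finally show ?thesis by (simp only: Un_insert_left Un_empty_left insert_commute insert_absorb2)
qed

lemma G_sets_family: "G_sets {{3, 4}, {4, 5}} = {{3}, {5 :: 5}}"
proof -
  have "\<not> {3} \<subseteq> {5 :: 5}" "\<not> {5} \<subseteq> {3 :: 5}" unfolding subset_5_iff by simp_all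
  then show ?thesis
    unfolding G_sets_def minimal_members_def member_sets_family by (auto simp only: insert_iff empty_iff)
qed

lemma H_sets_family: "H_sets mat_A exp_v {{3, 4}, {4, 5}} = {{2, 3}, {1, 5}}"
proof -
  have "{2, 3} \<subseteq> {1, 2, 3 :: 5} \<and> {2, 3} \<noteq> {1, 2, 3 :: 5}" "{1, 5} \<subseteq> {1, 2, 5 :: 5} \<and> {1, 5} \<noteq> {1, 2, 5 :: 5}"
    "{1, 5} \<subseteq> {1, 3, 5 :: 5} \<and> {1, 5} \<noteq> {1, 3, 5 :: 5}" "{1, 5} \<subseteq> {1, 2, 3, 5 :: 5} \<and> {1, 5} \<noteq> {1, 2, 3, 5 :: 5}"
    "{2, 3} \<subseteq> {2, 3, 5 :: 5} \<and> {2, 3} \<noteq> {2, 3, 5 :: 5}"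
    unfolding subset_5_iff set_5_eq_iff by simp_all
  moreover have "\<not> {1, 5} \<subseteq> {2, 3 :: 5}" "\<not> {1, 2, 3} \<subseteq> {2, 3 :: 5}" "\<not> {1, 2, 5} \<subseteq> {2, 3 :: 5}"
    "\<not> {1, 3, 5} \<subseteq> {2, 3 :: 5}" "\<not> {1, 2, 3, 5} \<subseteq> {2, 3 :: 5}" "\<not> {2, 3, 5} \<subseteq> {2, 3 :: 5}"
    "\<not> {2, 3} \<subseteq> {1, 5 :: 5}" "\<not> {1, 2, 3} \<subseteq> {1, 5 :: 5}" "\<not> {1, 2, 5} \<subseteq> {1, 5 :: 5}"
    "\<not> {1, 3, 5} \<subseteq> {1, 5 :: 5}" "\<not> {1, 2, 3, 5} \<subseteq> {1, 5 :: 5}" "\<not> {2, 3, 5} \<subseteq> {1, 5 :: 5}"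
    unfolding subset_5_iff by simp_all
  moreover have "{1, 2, 3} \<noteq> {2, 3 :: 5}" "{1, 2, 3} \<noteq> {1, 5 :: 5}"
    "{1, 2, 5} \<noteq> {2, 3 :: 5}" "{1, 2, 5} \<noteq> {1, 5 :: 5}" "{1, 3, 5} \<noteq> {2, 3 :: 5}" "{1, 3, 5} \<noteq> {1, 5 :: 5}"
    "{1, 2, 3, 5} \<noteq> {2, 3 :: 5}" "{1, 2, 3, 5} \<noteq> {1, 5 :: 5}" "{2, 3, 5} \<noteq> {2, 3 :: 5}" "{2, 3, 5} \<noteq> {1, 5 :: 5}"
    unfolding set_5_eq_iff by simp_all
  ultimately have min: "(\<forall>Y\<in>{{2, 3}, {1, 5}, {1, 2, 3}, {1, 2, 5}, {1, 3, 5}, {1, 2, 3, 5}, {2, 3, 5}}. Y \<subseteq> X \<longrightarrow> Y = X) \<longleftrightarrow>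
      X \<in> {{2, 3}, {1, 5}}"
    if "X \<in> {{2, 3}, {1, 5}, {1, 2, 3}, {1, 2, 5}, {1, 3, 5}, {1, 2, 3, 5}, {2, 3, 5 :: 5}}" for X
    using that by (elim insertE emptyE) (simp_all only: ball_simps insert_iff empty_iff simp_thms)
  have sub: "X \<in> {{2, 3}, {1, 5}, {1, 2, 3}, {1, 2, 5}, {1, 3, 5}, {1, 2, 3, 5}, {2, 3, 5 :: 5}}"
    if "X \<in> {{2, 3}, {1, 5}}" for X
    using that by (elim insertE emptyE) (simp_all only: insert_iff simp_thms)
  have filter: "{X \<in> S. Q X} = T" if "\<And>X. X \<in> S \<Longrightarrow> Q X \<longleftrightarrow> X \<in> T" "\<And>X. X \<in> T \<Longrightarrow> X \<in> S"
    for S T :: "5 set set" and Q using that by blast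
  show ?thesis
    unfolding H_sets_def minimal_members_def nonmember_sets_family by (rule filter[OF min sub])
qed

text \<open>Each minimal H contains exactly one minimal G, so the choice is forced on the sets that
  matter.\<close>

lemma choice_H_family:
  "choice_H mat_A exp_v {{3, 4}, {4, 5}} \<iota> \<longleftrightarrow> \<iota> {2, 3} = {3} \<and> \<iota> {1, 5} = {5}"
proof -
  have sub: "{3} \<subseteq> {2, 3 :: 5}" "\<not> {5} \<subseteq> {2, 3 :: 5}" "\<not> {3} \<subseteq> {1, 5 :: 5}" "{5} \<subseteq> {1, 5 :: 5}"
    unfolding subset_5_iff by simp_all
  have "X \<in> {{3}, {5}} \<and> X \<subseteq> {2, 3} \<longleftrightarrow> X = {3}" "X \<in> {{3}, {5}} \<and> X \<subseteq> {1, 5} \<longleftrightarrow> X = {5}" for X :: "5 set"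
    by (safe; simp only: sub insert_iff simp_thms)+
  then show ?thesis
    unfolding choice_H_def H_sets_family G_sets_family by (simp only: ball_simps simp_thms)
qed

lemma choice_E_family: "choice_E exp_v {{3, 4}, {4, 5}} G \<longleftrightarrow> G = {5}"
proof -
  have "{4, 5} - {4 :: 5} = {5}" by auto
  moreover have "\<not> {3} \<subseteq> {5 :: 5}" unfolding subset_5_iff by simp
  ultimately show ?thesis
    unfolding choice_E_def G_sets_family nsupp_exp_v Inter_family
    by (cases "G = {5}") (simp_all only: insert_iff empty_iff simp_thms subset_refl, auto)
qed

section \<open>The ambient and intrinsic ideals\<close>

lemma ideal_gen_pair: "x \<in> ideal_gen {a, b} \<longleftrightarrow> (\<exists>r s. x = r * a + s * b)"
proof
  have "ideal_gen {a, b} \<subseteq> {x. \<exists>r s. x = r * a + s * b}"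
  proof (rule ideal_gen_minimal)
    have "a = 1 * a + 0 * b" "b = 0 * a + 1 * b" by simp_all
    then show "{a, b} \<subseteq> {x. \<exists>r s. x = r * a + s * b}" by blast
    have "0 = 0 * a + 0 * b" by simp
    then show "0 \<in> {x. \<exists>r s. x = r * a + s * b}" by blast
    fix x y assume "x \<in> {x. \<exists>r s. x = r * a + s * b}" "y \<in> {x. \<exists>r s. x = r * a + s * b}"
    then obtain r s r' s' where "x = r * a + s * b" "y = r' * a + s' * b" by blast
    then have "x + y = (r + r') * a + (s + s') * b" by (simp add: algebra_simps)
    then show "x + y \<in> {x. \<exists>r s. x = r * a + s * b}" by blast
  next
    fix c x assume "x \<in> {x. \<exists>r s. x = r * a + s * b}"
    then obtain r s where "x = r * a + s * b" by blast
    then have "c * x = (c * r) * a + (c * s) * b" by (simp add: algebra_simps)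
    then show "c * x \<in> {x. \<exists>r s. x = r * a + s * b}" by blast
  qed
  then show "x \<in> ideal_gen {a, b} \<Longrightarrow> \<exists>r s. x = r * a + s * b" by blast
  show "\<exists>r s. x = r * a + s * b \<Longrightarrow> x \<in> ideal_gen {a, b}"
    by (auto intro!: ideal_gen_add ideal_gen_mult intro: ideal_gen_base)
qed

lemma mpoly_numeral_inverse: "single 0 (inverse (numeral k)) * (numeral k * f) = f"
  for f :: "'n::finite mpoly"
proof -
  have "single 0 (inverse (numeral k)) * numeral k = (1 :: 'n mpoly)"
    by (simp add: mult_single flip: single_numeral)
  then show ?thesis by (simp flip: mult.assoc)
qed

text \<open>Numerals are units over the complex numbers. This allows the ideal computations to be
  done with integer coefficients and the common factor to be dropped at the end.\<close>

lemma ideal_gen_numeral_cancel: "numeral k * f \<in> ideal_gen S \<Longrightarrow> f \<in> ideal_gen S"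
  for f :: "'n::finite mpoly"
  using ideal_gen_mult[of "numeral k * f" S "single 0 (inverse (numeral k))"]
  unfolding mpoly_numeral_inverse .

lemma lookup_mpoly_var_mult: "lookup (mpoly_var j * f) (axis j 1 + m) = lookup f m"
  unfolding mpoly_var_def mpoly_monom_def lookup_single_mult_add by simp

lemma mpoly_var_mult_cancel: "mpoly_var j * f = mpoly_var j * g \<Longrightarrow> f = g"
  by (metis lookup_mpoly_var_mult poly_mapping_eqI)

text \<open>Distinct variables are coprime: multiplication by the variable \<open>j\<close> leaves
  the exponent of variable \<open>i\<close> unchanged, so that exponent is positive throughout
  \<open>b\<close> and can be lowered by one.\<close>

lemma mpoly_var_dvd:
  assumes eq: "mpoly_var j * b = mpoly_var i * h" and "i \<noteq> j"
  shows "\<exists>c. b = mpoly_var i * c"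
proof
  let ?c = "\<Sum>k\<in>keys b. single (k - axis i 1) (lookup b k)"
  have le: "axis i 1 + (k - axis i 1) = k" if k: "k \<in> keys b" for k
  proof -
    have "lookup (mpoly_var i * h) (axis j 1 + k) \<noteq> 0"
      using k unfolding eq[symmetric] lookup_mpoly_var_mult by (simp add: in_keys_iff)
    then have "axis i 1 \<le> axis j 1 + k"
      unfolding mpoly_var_def mpoly_monom_def lookup_single_mult_vec by (auto split: if_splits)
    then have "axis i (1::nat) $ i \<le> (axis j 1 + k) $ i" unfolding less_eq_vec_def by blast
    then have "k $ i \<ge> 1" using \<open>i \<noteq> j\<close> by (simp add: axis_def)
    then show ?thesis by (auto simp: vec_eq_iff axis_def)
  qed
  have "mpoly_var i * ?c = (\<Sum>k\<in>keys b. single k (lookup b k))"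
    by (simp add: mpoly_var_def mpoly_monom_def sum_distrib_left mult_single le)
  then show "b = mpoly_var i * ?c" using poly_mapping_decompose[of b] by simp
qed

abbreviation s1 :: "2 mpoly" where "s1 \<equiv> mpoly_var 1"
abbreviation s2 :: "2 mpoly" where "s2 \<equiv> mpoly_var 2"

lemma linear_form_mat_B:
  "linear_form mat_B 1 = - s2" "linear_form mat_B 2 = 3 * s1 - 4 * s2" "linear_form mat_B 3 = 5 * s1"
  "linear_form mat_B 5 = - 7 * s1"
  by (simp_all add: linear_form_def sum_2)

lemma form_prod_mat_B:
  "form_prod mat_B {} = 1" "form_prod mat_B {1} = - s2" "form_prod mat_B {2} = 3 * s1 - 4 * s2"
  "form_prod mat_B {3} = 5 * s1" "form_prod mat_B {5} = - 7 * s1"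
  "form_prod mat_B {2, 3} = (3 * s1 - 4 * s2) * (5 * s1)" "form_prod mat_B {1, 5} = - s2 * (- 7 * s1)"
  by (simp_all add: form_prod_def linear_form_mat_B del: mult_minus_left)

text \<open>Both generators and the divisor contain the factor s1. Cancelling it leaves, up to
  units, the ideal of 3 s1 - 4 s2 and s2.\<close>

lemma J_intr_family: "J_intr mat_A mat_B exp_v {{3, 4}, {4, 5}} = ideal_gen {s1, s2}"
proof -
  have E: "nsupp exp_v - \<Inter>{{3, 4}, {4, 5}} = {5}" unfolding nsupp_exp_v Inter_family by auto
  have J: "J_intr mat_A mat_B exp_v {{3, 4}, {4, 5}} =
      {f. f * (- 7 * s1) \<in> ideal_gen {(3 * s1 - 4 * s2) * (5 * s1), - s2 * (- 7 * s1)}}"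
    unfolding J_intr_def E H_sets_family ideal_colon_def image_insert image_empty form_prod_mat_B ..
  have "f \<in> ideal_gen {s1, s2}"
    if f: "f * (- 7 * s1) \<in> ideal_gen {(3 * s1 - 4 * s2) * (5 * s1), - s2 * (- 7 * s1)}" for f
  proof -
    obtain r s where "f * (- 7 * s1) = r * ((3 * s1 - 4 * s2) * (5 * s1)) + s * (- s2 * (- 7 * s1))"
      using f unfolding ideal_gen_pair by blast
    then have "s1 * (7 * f) = s1 * ((- 15 * r) * s1 + (20 * r - 7 * s) * s2)" by (simp add: algebra_simps)
    then have "7 * f = (- 15 * r) * s1 + (20 * r - 7 * s) * s2" by (rule mpoly_var_mult_cancel)
    then have "7 * f \<in> ideal_gen {s1, s2}" unfolding ideal_gen_pair by blast
    then show ?thesis by (rule ideal_gen_numeral_cancel)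
  qed
  moreover have "f * (- 7 * s1) \<in> ideal_gen {(3 * s1 - 4 * s2) * (5 * s1), - s2 * (- 7 * s1)}" (is "_ \<in> ?I")
    if fI: "f \<in> ideal_gen {s1, s2}" for f
  proof -
    obtain p q where f: "f = p * s1 + q * s2" using fI unfolding ideal_gen_pair by blast
    \<comment> \<open>The factor 15 is the coefficient of s1^2 in the first generator; the multiple
      of the second one compensates its term -20 s1 s2.\<close>
    have "15 * (f * (- 7 * s1)) = (- 7 * p) * ((3 * s1 - 4 * s2) * (5 * s1))
        + (- 20 * p - 15 * q) * (- s2 * (- 7 * s1))"
      by (simp add: f algebra_simps)
    then have "15 * (f * (- 7 * s1)) \<in> ?I" unfolding ideal_gen_pair by blast
    then show ?thesis by (rule ideal_gen_numeral_cancel)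
  qed
  ultimately show ?thesis unfolding J by blast
qed

section \<open>The free module and the ambient annihilator\<close>

lemma lookup_fm_scale [simp]: "lookup (fm_scale c p) k = c * lookup p k"
  unfolding fm_scale_def by transfer (simp add: when_def)

lemma module_fm_scale: "module (fm_scale :: 'r::finite mpoly \<Rightarrow> ('n, 'r) free_module \<Rightarrow> ('n, 'r) free_module)"
  by unfold_locales (auto intro!: poly_mapping_eqI simp: lookup_add algebra_simps)

definition pair_elem :: "2 mpoly \<Rightarrow> 2 mpoly \<Rightarrow> (5, 2) free_module" where
  "pair_elem a b = single {3} a + single {5} b"

lemma lookup_pair_elem: "lookup (pair_elem a b) {3} = a" "lookup (pair_elem a b) {5} = b"
proof -
  have "{3} \<noteq> {5 :: 5}" by simp
  then show "lookup (pair_elem a b) {3} = a" "lookup (pair_elem a b) {5} = b"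
    unfolding pair_elem_def lookup_add lookup_single when_def by auto
qed

lemma pair_elem_add: "pair_elem a b + pair_elem c d = pair_elem (a + c) (b + d)"
  by (simp add: pair_elem_def single_add)

lemma fm_scale_single: "fm_scale c (single k a) = single k (c * a)"
  by (rule poly_mapping_eqI) (simp add: lookup_single when_def)

lemma fm_scale_pair_elem: "fm_scale c (pair_elem a b) = pair_elem (c * a) (c * b)"
  by (rule poly_mapping_eqI) (simp add: pair_elem_def lookup_add lookup_single when_def algebra_simps)

lemma fm_scale_basis: "fm_scale c (fm_basis {3}) = pair_elem c 0" "fm_scale c (fm_basis {5}) = pair_elem 0 c"
  by (simp_all add: fm_basis_def fm_scale_single pair_elem_def)

text \<open>The first two generators are the relation between the two basis vectors, once for each
  order of the pair.\<close>

lemma Z_module_family: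
  assumes "\<iota> {2, 3} = {3}" "\<iota> {1, 5} = {5}"
  shows "Z_module mat_A mat_B exp_v {{3, 4}, {4, 5}} \<iota> = module.span fm_scale
    {pair_elem (- 7 * s1) (- 5 * s1), pair_elem (7 * s1) (5 * s1), pair_elem (3 * s1 - 4 * s2) 0, pair_elem 0 (- s2)}"
proof -
  have ne: "{3} \<noteq> {5 :: 5}" "{5} \<noteq> {3 :: 5}" by simp_all
  have diff: "{5} - {3} = {5 :: 5}" "{3} - {5} = {3 :: 5}" "{2, 3} - {3} = {2 :: 5}" "{1, 5} - {5} = {1 :: 5}" by auto
  have pairs: "{f G G' |G G'. G \<in> {a, b} \<and> G' \<in> {a, b} \<and> G \<noteq> G'} = {f a b, f b a}"
    if "a \<noteq> b" for f :: "5 set \<Rightarrow> 5 set \<Rightarrow> (5, 2) free_module" and a b using that by blast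
  have two: "{f H |H. H \<in> {a, b}} = {f a, f b}" for f :: "5 set \<Rightarrow> (5, 2) free_module" and a b by blast
  have minus: "pair_elem a 0 - pair_elem 0 b = pair_elem a (- b)" "pair_elem 0 b - pair_elem a 0 = pair_elem (- a) b"
    for a b by (simp_all add: pair_elem_def single_uminus)
  show ?thesis
    unfolding Z_module_def G_sets_family H_sets_family pairs[OF ne(1)] two assms diff form_prod_mat_B fm_scale_basis minus
    by (rule arg_cong[where f = "module.span fm_scale"]) (simp add: insert_commute)
qed

text \<open>Since E = {5}, the question is which (0, f) lie in the span. There the relation s1 (7,
  5) cannot be divided by s1. Eliminating the first coordinate costs a further factor 3 s1 - 4 s2,
  which leaves s1 (3 s1 - 4 s2) beside s2, that is, s1^2 modulo s2.\<close>

lemma J_amb_family: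
  assumes \<iota>: "choice_H mat_A exp_v {{3, 4}, {4, 5}} \<iota>" and G: "choice_E exp_v {{3, 4}, {4, 5}} G"
  shows "J_amb mat_A mat_B exp_v {{3, 4}, {4, 5}} \<iota> G = ideal_gen {s2, s1\<^sup>2}"
proof -
  let ?gens = "{pair_elem (- 7 * s1) (- 5 * s1), pair_elem (7 * s1) (5 * s1), pair_elem (3 * s1 - 4 * s2) 0, pair_elem 0 (- s2)}"
  let ?Z = "module.span fm_scale ?gens"
  have \<iota>': "\<iota> {2, 3} = {3}" "\<iota> {1, 5} = {5}" using \<iota> unfolding choice_H_family by blast+
  have G5: "G = {5}" using G unfolding choice_E_family .
  have E: "(nsupp exp_v - \<Inter>{{3, 4}, {4, 5}}) - {5} = {}" unfolding nsupp_exp_v Inter_family by auto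
  have J: "J_amb mat_A mat_B exp_v {{3, 4}, {4, 5}} \<iota> G = {f. pair_elem 0 f \<in> ?Z}"
    unfolding J_amb_def G5 E Z_module_family[OF \<iota>'] form_prod_mat_B fm_scale_basis fm_scale_pair_elem by simp
  note Z_base = module.span_base[OF module_fm_scale, of _ ?gens]
    and Z_add = module.span_add[OF module_fm_scale, of _ ?gens]
    and Z_scale = module.span_scale[OF module_fm_scale, of _ ?gens]
  have "f \<in> ideal_gen {s2, s1\<^sup>2}" if f: "pair_elem 0 f \<in> ?Z" for f
  proof -
    define T where "T = {p :: (5, 2) free_module. \<exists>a b c.
      lookup p {3} = - 7 * s1 * a + (3 * s1 - 4 * s2) * b \<and>
      lookup p {5} = - 5 * s1 * a - s2 * c}"
    have T: "p \<in> T" if "lookup p {3} = - 7 * s1 * a + (3 * s1 - 4 * s2) * b"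
      "lookup p {5} = - 5 * s1 * a - s2 * c" for p a b c
      unfolding T_def using that by blast
    have "?Z \<subseteq> T"
    proof (rule module.span_minimal[OF module_fm_scale])
      have "pair_elem (- 7 * s1) (- 5 * s1) \<in> T" by (rule T[of _ 1 0 0]) (simp_all add: lookup_pair_elem)
      moreover have "pair_elem (7 * s1) (5 * s1) \<in> T" by (rule T[of _ "-1" 0 0]) (simp_all add: lookup_pair_elem)
      moreover have "pair_elem (3 * s1 - 4 * s2) 0 \<in> T" by (rule T[of _ 0 1 0]) (simp_all add: lookup_pair_elem)
      moreover have "pair_elem 0 (- s2) \<in> T" by (rule T[of _ 0 0 1]) (simp_all add: lookup_pair_elem)
      ultimately show "?gens \<subseteq> T" by blast
      show "module.subspace fm_scale T"
        unfolding module.subspace_def[OF module_fm_scale]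
      proof (intro conjI ballI allI)
        show "0 \<in> T" by (rule T[of _ 0 0 0]) simp_all
      next
        fix p q assume "p \<in> T" "q \<in> T"
        then obtain a b c a' b' c' where h:
          "lookup p {3} = - 7 * s1 * a + (3 * s1 - 4 * s2) * b"
          "lookup p {5} = - 5 * s1 * a - s2 * c"
          "lookup q {3} = - 7 * s1 * a' + (3 * s1 - 4 * s2) * b'"
          "lookup q {5} = - 5 * s1 * a' - s2 * c'" unfolding T_def by blast
        show "p + q \<in> T"
          by (rule T[of _ "a + a'" "b + b'" "c + c'"]; unfold lookup_add h; simp add: algebra_simps)
      next
        fix r p assume "p \<in> T"
        then obtain a b c where h:
          "lookup p {3} = - 7 * s1 * a + (3 * s1 - 4 * s2) * b"
          "lookup p {5} = - 5 * s1 * a - s2 * c" unfolding T_def by blast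
        show "fm_scale r p \<in> T"
          by (rule T[of _ "r * a" "r * b" "r * c"]; unfold lookup_fm_scale h; simp add: algebra_simps)
      qed
    qed
    then have "pair_elem 0 f \<in> T" using f by blast
    then obtain a b c where 3: "0 = - 7 * s1 * a + (3 * s1 - 4 * s2) * b" and 5: "f = - 5 * s1 * a - s2 * c"
      unfolding T_def mem_Collect_eq lookup_pair_elem by blast
    \<comment> \<open>Vanishing of the coordinate at {3}, sorted by variables: s1 divides s2 b and
      hence b.\<close>
    have "s2 * (4 * b) = s1 * (3 * b - 7 * a)" using 3 by (simp add: algebra_simps)
    then obtain d where d: "4 * b = s1 * d" using mpoly_var_dvd[of 2 "4 * b" 1] by auto
    have "s1 * (28 * a) = s1 * ((3 * s1 - 4 * s2) * d)"
    proof -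
      have 7: "7 * s1 * a = (3 * s1 - 4 * s2) * b" using 3 by (simp add: algebra_simps)
      have "s1 * (28 * a) = 4 * (7 * s1 * a)" by (simp add: algebra_simps)
      also have "\<dots> = 4 * ((3 * s1 - 4 * s2) * b)" unfolding 7 ..
      also have "\<dots> = (3 * s1 - 4 * s2) * (4 * b)" by (simp add: algebra_simps)
      also have "\<dots> = s1 * ((3 * s1 - 4 * s2) * d)" unfolding d by (simp add: algebra_simps)
      finally show ?thesis .
    qed
    then have a: "28 * a = (3 * s1 - 4 * s2) * d" by (rule mpoly_var_mult_cancel)
    have "28 * f = - 5 * s1 * (28 * a) - 28 * (s2 * c)" unfolding 5 by (simp add: algebra_simps)
    also have "\<dots> = (20 * s1 * d - 28 * c) * s2 + (- 15 * d) * s1\<^sup>2"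
      unfolding a by (simp add: algebra_simps power2_eq_square)
    finally have "28 * f \<in> ideal_gen {s2, s1\<^sup>2}" unfolding ideal_gen_pair by blast
    then show ?thesis by (rule ideal_gen_numeral_cancel)
  qed
  moreover have "ideal_gen {s2, s1\<^sup>2} \<subseteq> {f. pair_elem 0 f \<in> ?Z}"
  proof (rule ideal_gen_minimal)
    have g: "pair_elem (7 * s1) (5 * s1) \<in> ?Z" "pair_elem (3 * s1 - 4 * s2) 0 \<in> ?Z" "pair_elem 0 (- s2) \<in> ?Z"
      by (rule Z_base, simp)+
    \<comment> \<open>The second summand cancels the coordinate at {3}, the third one the term -20
      s1 s2 in the coordinate at {5}.\<close>
    have "fm_scale (3 * s1 - 4 * s2) (pair_elem (7 * s1) (5 * s1)) + (fm_scale (- 7 * s1) (pair_elem (3 * s1 - 4 * s2) 0)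
        + fm_scale (- 20 * s1) (pair_elem 0 (- s2))) \<in> ?Z"
      by (intro Z_add Z_scale g)
    also have "fm_scale (3 * s1 - 4 * s2) (pair_elem (7 * s1) (5 * s1)) + (fm_scale (- 7 * s1) (pair_elem (3 * s1 - 4 * s2) 0)
        + fm_scale (- 20 * s1) (pair_elem 0 (- s2))) = pair_elem 0 (15 * s1\<^sup>2)"
      unfolding fm_scale_pair_elem pair_elem_add
      by (rule arg_cong2[where f = pair_elem]) (simp_all add: algebra_simps power2_eq_square)
    finally have "fm_scale (single 0 (inverse 15)) (pair_elem 0 (15 * s1\<^sup>2)) \<in> ?Z" by (rule Z_scale)
    then have "pair_elem 0 (s1\<^sup>2) \<in> ?Z" unfolding fm_scale_pair_elem mpoly_numeral_inverse by simp
    moreover have "pair_elem 0 s2 \<in> ?Z" using Z_scale[OF g(3), of "-1"] by (simp add: fm_scale_pair_elem)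
    ultimately show "{s2, s1\<^sup>2} \<subseteq> {f. pair_elem 0 f \<in> ?Z}" by simp
    have "pair_elem 0 0 = 0" by (simp add: pair_elem_def)
    then show "0 \<in> {f. pair_elem 0 f \<in> ?Z}" using module.span_zero[OF module_fm_scale, of ?gens] by simp
    show "x + y \<in> {f. pair_elem 0 f \<in> ?Z}"
      if "x \<in> {f. pair_elem 0 f \<in> ?Z}" "y \<in> {f. pair_elem 0 f \<in> ?Z}" for x y
      using Z_add[of "pair_elem 0 x" "pair_elem 0 y"] that by (simp add: pair_elem_add)
    show "r * x \<in> {f. pair_elem 0 f \<in> ?Z}" if "x \<in> {f. pair_elem 0 f \<in> ?Z}" for r x
      using Z_scale[of "pair_elem 0 x" r] that by (simp add: fm_scale_pair_elem)
  qed
  ultimately show ?thesis unfolding J by blast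
qed

text \<open>The monomial s1 is divisible neither by s2 nor by s1^2, so it has coefficient zero in
  every element of the smaller ideal.\<close>

lemma J_amb_subset_J_intr: "ideal_gen {s2, s1\<^sup>2} \<subset> ideal_gen {s1, s2}"
proof
  show "ideal_gen {s2, s1\<^sup>2} \<subseteq> ideal_gen {s1, s2}"
    by (intro ideal_gen_subsetI) (auto simp: power2_eq_square intro: ideal_gen_base ideal_gen_mult)
  have "s1 \<notin> ideal_gen {s2, s1\<^sup>2}"
  proof
    assume "s1 \<in> ideal_gen {s2, s1\<^sup>2}"
    then obtain r s where "s1 = r * s2 + s * s1\<^sup>2" unfolding ideal_gen_pair by blast
    then have "s1 = single (axis 2 1) 1 * r + single (axis 1 1 + axis 1 1) 1 * s"
      by (simp add: mpoly_var_def mpoly_monom_def power2_eq_square mult_single mult.commute)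
    then have "lookup s1 (axis 1 1) = lookup
      (single (axis 2 1) 1 * r + single (axis 1 1 + axis 1 1) 1 * s) (axis 1 1)"
      by simp
    moreover have "\<not> axis 2 (1::nat) \<le> (axis 1 1 :: nat^2)" "\<not> axis 1 (1::nat) + axis 1 1 \<le> (axis 1 1 :: nat^2)"
      by (auto simp: less_eq_vec_def forall_2 axis_def)
    ultimately show False
      unfolding lookup_add lookup_single_mult_vec by (simp add: mpoly_var_def mpoly_monom_def)
  qed
  moreover have "s1 \<in> ideal_gen {s1, s2}" by (intro ideal_gen_base) simp
  ultimately show "ideal_gen {s2, s1\<^sup>2} \<noteq> ideal_gen {s1, s2}" by blast
qed

section \<open>The obstruction module\<close>

lemma mfps_nth_arith [simp]:
  "mfps_nth 0 m = 0" "mfps_nth (f + g) m = mfps_nth f m + mfps_nth g m"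
  "mfps_nth (f - g) m = mfps_nth f m - mfps_nth g m" "mfps_nth (- f) m = - mfps_nth f m"
  by (simp_all add: zero_mfps_def plus_mfps_def minus_mfps_def uminus_mfps_def)

lemma mfps_nth_sum: "mfps_nth (\<Sum>i\<in>S. f i) m = (\<Sum>i\<in>S. mfps_nth (f i) m)"
  by (induction S rule: infinite_finite_induct) simp_all

lemma mfps_nth_mult: "mfps_nth (f * g) m = (\<Sum>k | k \<le> m. mfps_nth f k * mfps_nth g (m - k))"
  by (simp add: times_mfps_def)

lemma mfps_nth_const_mult [simp]: "mfps_nth (mfps_const c * f) m = c * mfps_nth f m"
proof -
  have "mfps_nth (mfps_const c * f) m = (\<Sum>k\<in>{0}. c * mfps_nth f (m - k))"
    unfolding mfps_nth_mult
    by (rule sum.mono_neutral_cong_right[OF finite_exponents_le]) (auto simp: mfps_const_def less_eq_vec_def)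
  moreover have "m - 0 = m" by (simp add: vec_eq_iff)
  ultimately show ?thesis by simp
qed

lemma of_nat_mfps: "of_nat n = mfps_const (of_nat n)"
proof (induction n)
  case 0 then show ?case by (simp add: mfps_eq_iff mfps_const_def)
next
  case (Suc n)
  then show ?case by (auto simp: mfps_eq_iff mfps_const_def one_mfps_def)
qed

lemma numeral_mfps: "(numeral k :: 'n::finite mfps) = mfps_const (numeral k)"
  using of_nat_mfps[of "numeral k"] by simp

lemma mfps_nth_numeral_mult [simp]: "mfps_nth (numeral k * f) m = numeral k * mfps_nth f m"
  by (simp add: numeral_mfps)

lemma mfps_nth_mult_0: "mfps_nth (f * g) 0 = mfps_nth f 0 * mfps_nth g 0"
proof -
  have "{k :: nat^'a. k \<le> 0} = {0}" by (auto simp: less_eq_vec_def vec_eq_iff)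
  then show ?thesis by (simp add: mfps_nth_mult)
qed

lemma le_axis_iff: "k \<le> axis j 1 \<longleftrightarrow> k = 0 \<or> k = axis j 1" for k :: "nat^'n::finite"
proof
  assume k: "k \<le> axis j 1"
  have z: "k $ i = 0" if "i \<noteq> j" for i
    using k[unfolded less_eq_vec_def, rule_format, of i] that by (simp add: axis_def)
  have "k $ j = 0 \<or> k $ j = 1"
    using k[unfolded less_eq_vec_def, rule_format, of j] by (auto simp: axis_def One_nat_def)
  then show "k = 0 \<or> k = axis j 1"
  proof
    assume "k $ j = 0"
    then have "k $ i = 0" for i using z by (cases "i = j") auto
    then show ?thesis by (simp add: vec_eq_iff)
  next
    assume "k $ j = 1"
    then have "k $ i = axis j 1 $ i" for i using z by (cases "i = j") (auto simp: axis_def)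
    then show ?thesis by (simp add: vec_eq_iff)
  qed
qed (auto simp: less_eq_vec_def)

lemma axis_nat_neq_0 [simp]: "axis j (1::nat) \<noteq> 0"
  by (simp add: axis_eq_0_iff)

lemma mfps_nth_mult_axis:
  "mfps_nth (f * g) (axis j 1) = mfps_nth f 0 * mfps_nth g (axis j 1) + mfps_nth f (axis j 1) * mfps_nth g 0"
proof -
  have "{k :: nat^'a. k \<le> axis j 1} = {0, axis j 1}" by (auto simp: le_axis_iff)
  moreover have "axis j (1::nat) - 0 = axis j 1" by (simp add: vec_eq_iff)
  ultimately show ?thesis by (simp add: mfps_nth_mult axis_nat_neq_0[symmetric] del: axis_nat_neq_0)
qed

lemma mfps_nth_var_mult:
  "mfps_nth (mfps_var j * f) m = (if axis j 1 \<le> m then mfps_nth f (m - axis j 1) else 0)"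
proof -
  have "mfps_nth (mfps_var j * f) m = (\<Sum>k | k \<le> m. if k = axis j 1 then mfps_nth f (m - axis j 1) else 0)"
    unfolding mfps_nth_mult by (rule sum.cong) (auto simp: mfps_var_def)
  then show ?thesis by (simp add: finite_exponents_le)
qed

lemma mfps_nth_var: "mfps_nth (mfps_var j) m = (if m = axis j 1 then 1 else 0)"
  by (simp add: mfps_var_def)

text \<open>Every nonzero exponent \<open>m\<close> is assigned one variable \<open>J m\<close> that
  occurs in it, and its coefficient goes to the cofactor of that variable alone.\<close>

lemma mfps_split_vars:
  fixes f :: "'n::finite mfps"
  assumes "mfps_nth f 0 = 0"
  obtains g where "f = (\<Sum>j\<in>UNIV. mfps_var j * g j)"
proof -
  have "\<exists>j. m $ j > 0" if "m \<noteq> 0" for m :: "nat^'n"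
    using that by (auto simp: vec_eq_iff)
  then obtain J where J: "\<And>m :: nat^'n. m \<noteq> 0 \<Longrightarrow> m $ J m > 0" by metis
  define g where "g j = Abs_mfps (\<lambda>m. if J (m + axis j 1) = j then mfps_nth f (m + axis j 1) else 0)" for j
  have "mfps_nth f m = mfps_nth (\<Sum>j\<in>UNIV. mfps_var j * g j) m" for m
  proof (cases "m = 0")
    case True
    have "\<not> axis j 1 \<le> (0 :: nat^'n)" for j by (auto simp: less_eq_vec_def axis_def)
    then show ?thesis using True assms by (simp add: mfps_nth_sum mfps_nth_var_mult)
  next
    case False
    have "mfps_nth (mfps_var j * g j) m = (if j = J m then mfps_nth f m else 0)" for j
    proof (cases "axis j 1 \<le> m")
      case True
      have "m - axis j 1 + axis j 1 = m" by (rule vec_diff_add[OF True])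
      then show ?thesis using True by (auto simp: mfps_nth_var_mult g_def vec_diff_add)
    next
      case nle: False
      have "axis (J m) 1 \<le> m" using J[OF False] by (auto simp: less_eq_vec_def axis_def)
      then show ?thesis using nle by (auto simp: mfps_nth_var_mult)
    qed
    then show ?thesis by (simp add: mfps_nth_sum)
  qed
  then show ?thesis using that[of g] by (simp add: mfps_eq_iff)
qed

lemma mfps_sqfree_superset: "X \<subseteq> Y \<Longrightarrow> mfps_sqfree Y = mfps_sqfree (Y - X) * mfps_sqfree X"
  unfolding mfps_sqfree_def by (rule prod.subset_diff) simp_all

lemma ideal_sum_gen: "ideal_sum (ideal_gen S) (ideal_gen T) = ideal_gen (S \<union> T)"
  unfolding ideal_sum_def ideal_gen_def module.span_Un[OF module_mult] by auto


section \<open>Linear parts and constraints on numerator and denominator\<close>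

abbreviation tv :: "5 \<Rightarrow> 5 mfps" where "tv \<equiv> mfps_var"

definition row_form :: "3 \<Rightarrow> 5 mfps" where
  "row_form i = (\<Sum>j\<in>UNIV. of_int (mat_A $ i $ j) * mfps_var j)"

lemma row_form_eq:
  "row_form 1 = 20 * tv 1 - 5 * tv 2 + 3 * tv 3"
  "row_form 2 = 2 * tv 2 - 3 * tv 1 - tv 3 + tv 4"
  "row_form 3 = 4 * tv 2 - 16 * tv 1 - tv 3 + tv 5"
  by (simp_all add: row_form_def sum_5)

lemma U_ideal_eq: "U_ideal mat_A = ideal_gen (range row_form)"
  unfolding U_ideal_def row_form_def by simp

text \<open>The linear part of a series, evaluated at the two columns of the Gale dual.\<close>

definition lin1 :: "5 mfps \<Rightarrow> complex" where
  "lin1 f = 3 * mfps_nth f (axis 2 1) + 5 * mfps_nth f (axis 3 1) - mfps_nth f (axis 4 1) - 7 * mfps_nth f (axis 5 1)"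

definition lin2 :: "5 mfps \<Rightarrow> complex" where
  "lin2 f = 5 * mfps_nth f (axis 4 1) - mfps_nth f (axis 1 1) - 4 * mfps_nth f (axis 2 1)"

lemma lin_add: "lin1 (f + g) = lin1 f + lin1 g" "lin2 (f + g) = lin2 f + lin2 g"
  by (simp_all add: lin1_def lin2_def algebra_simps)

lemma lin_mult:
  assumes "mfps_nth g 0 = 0"
  shows "lin1 (f * g) = mfps_nth f 0 * lin1 g" "lin2 (f * g) = mfps_nth f 0 * lin2 g"
  using assms by (simp_all add: lin1_def lin2_def mfps_nth_mult_axis algebra_simps)

lemma axis_nat_eq_iff [simp]: "axis i (1::nat) = axis j 1 \<longleftrightarrow> i = j"
  by (simp add: axis_eq_axis)

text \<open>The rows of A are orthogonal to the columns of B, and multiplying a series without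
  constant term by another one only scales its linear part.\<close>

lemma U_ideal_linear_part:
  assumes "z \<in> U_ideal mat_A"
  shows "mfps_nth z 0 = 0" "lin1 z = 0" "lin2 z = 0"
proof -
  have "ideal_gen (range row_form) \<subseteq> {z. mfps_nth z 0 = 0 \<and> lin1 z = 0 \<and> lin2 z = 0}"
  proof (rule ideal_gen_minimal)
    have "mfps_nth (row_form i) 0 = 0 \<and> lin1 (row_form i) = 0 \<and> lin2 (row_form i) = 0" for i
      using exhaust_3[of i]
      by (elim disjE) (simp_all add: row_form_eq lin1_def lin2_def mfps_nth_var axis_nat_neq_0[symmetric] del: axis_nat_neq_0)
    then show "range row_form \<subseteq> {z. mfps_nth z 0 = 0 \<and> lin1 z = 0 \<and> lin2 z = 0}" by blast
  qed (auto simp: lin_add lin_mult mfps_nth_mult_0, simp_all add: lin1_def lin2_def)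
  then show "mfps_nth z 0 = 0" "lin1 z = 0" "lin2 z = 0" using assms unfolding U_ideal_eq by auto
qed

lemma mfps_sqfree_family:
  "mfps_sqfree {3} = tv 3" "mfps_sqfree {5} = tv 5" "mfps_sqfree {2, 3} = tv 2 * tv 3" "mfps_sqfree {1, 5} = tv 1 * tv 5"
  by (simp_all add: mfps_sqfree_def)

lemma M_ideal_family: "M_ideal {{3, 4}, {4, 5}} = ideal_gen {tv 3, tv 5}"
  unfolding M_ideal_def member_sets_family image_insert image_empty mfps_sqfree_family ..

text \<open>Every index set of the family contains {2,3} or {1,5}.\<close>

lemma P_ideal_family: "P_ideal mat_A exp_v {{3, 4}, {4, 5}} = ideal_gen {tv 2 * tv 3, tv 1 * tv 5}"
proof
  let ?I = "ideal_gen {tv 2 * tv 3, tv 1 * tv 5}"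
  have 23: "mfps_sqfree Y \<in> ?I" if "{2, 3} \<subseteq> Y" for Y
    unfolding mfps_sqfree_superset[OF that] mfps_sqfree_family by (intro ideal_gen_mult ideal_gen_base) simp
  have 15: "mfps_sqfree Y \<in> ?I" if "{1, 5} \<subseteq> Y" for Y
    unfolding mfps_sqfree_superset[OF that] mfps_sqfree_family by (intro ideal_gen_mult ideal_gen_base) simp
  have "mfps_sqfree {2, 3} \<in> ?I" "mfps_sqfree {1, 2, 3} \<in> ?I" "mfps_sqfree {1, 2, 3, 5} \<in> ?I" "mfps_sqfree {2, 3, 5} \<in> ?I"
    by (rule 23, simp)+
  moreover have "mfps_sqfree {1, 5} \<in> ?I" "mfps_sqfree {1, 2, 5} \<in> ?I" "mfps_sqfree {1, 3, 5} \<in> ?I"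
    by (rule 15, simp)+
  ultimately show "P_ideal mat_A exp_v {{3, 4}, {4, 5}} \<subseteq> ?I"
    unfolding P_ideal_def nonmember_sets_family image_insert image_empty
    by (intro ideal_gen_subsetI insert_subsetI empty_subsetI)
  have "tv 2 * tv 3 \<in> P_ideal mat_A exp_v {{3, 4}, {4, 5}}" "tv 1 * tv 5 \<in> P_ideal mat_A exp_v {{3, 4}, {4, 5}}"
    unfolding P_ideal_def nonmember_sets_family mfps_sqfree_family(3,4)[symmetric]
    by (intro ideal_gen_base imageI; simp only: insert_iff simp_thms)+
  then show "?I \<subseteq> P_ideal mat_A exp_v {{3, 4}, {4, 5}}"
    unfolding P_ideal_def by (intro ideal_gen_subsetI) simp
qed

definition num_ideal :: "5 mfps set" where
  "num_ideal = obstruction_num mat_A exp_v {{3, 4}, {4, 5}} (tv 5)"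

definition den_ideal :: "5 mfps set" where
  "den_ideal = obstruction_den mat_A exp_v {{3, 4}, {4, 5}} (tv 5)"

lemma num_ideal_alt:
  "num_ideal = {f. f * tv 5 \<in> ideal_gen (range row_form \<union> {tv 2 * tv 3, tv 1 * tv 5})}"
  unfolding num_ideal_def obstruction_num_def U_ideal_eq P_ideal_family ideal_sum_gen ideal_colon_def ..

lemma den_ideal_alt:
  "den_ideal = {f. f * tv 5 \<in> ideal_gen ({a * b |a b. a \<in> ideal_gen (range row_form) \<and> b \<in> ideal_gen {tv 3, tv 5}} \<union>
     {tv 2 * tv 3, tv 1 * tv 5})}"
  unfolding den_ideal_def obstruction_den_def U_ideal_eq P_ideal_family M_ideal_family ideal_prod_def
    ideal_sum_gen ideal_colon_def ..

text \<open>The functional \<open>lin1\<close> vanishes on U and on P, whose elements have no linear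
  part. On \<open>f * tv 5\<close> it is -7 times the constant term of \<open>f\<close>.\<close>

lemma num_ideal_subset:
  assumes "f \<in> num_ideal" shows "mfps_nth f 0 = 0"
proof -
  obtain y p where y: "y \<in> U_ideal mat_A" and p: "p \<in> ideal_gen {tv 2 * tv 3, tv 1 * tv 5}" and eq: "f * tv 5 = y + p"
    using assms unfolding num_ideal_def obstruction_num_def P_ideal_family ideal_sum_def ideal_colon_def by blast
  have "ideal_gen {tv 2 * tv 3, tv 1 * tv 5} \<subseteq> {z. mfps_nth z 0 = 0 \<and> (\<forall>j. mfps_nth z (axis j 1) = 0)}"
    by (rule ideal_gen_minimal)
       (auto simp: mfps_nth_mult_0 mfps_nth_mult_axis mfps_nth_var axis_nat_neq_0[symmetric] simp del: axis_nat_neq_0)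
  then have "mfps_nth p (axis j 1) = 0" for j using p by auto
  then have "lin1 p = 0" by (simp add: lin1_def)
  then have "lin1 (f * tv 5) = 0" unfolding eq lin_add U_ideal_linear_part(2)[OF y] by simp
  moreover have "lin1 (f * tv 5) = mfps_nth f 0 * lin1 (tv 5)"
    by (rule lin_mult) (simp add: mfps_nth_var axis_nat_neq_0[symmetric] del: axis_nat_neq_0)
  moreover have "lin1 (tv 5) = -7" by (simp add: lin1_def mfps_nth_var)
  ultimately show ?thesis by simp
qed


lemma mfps_nth_two_axes:
  "mfps_nth (mfps_var j * f) (axis i 1 + axis j 1) = mfps_nth f (axis i 1)"
  "i \<noteq> j \<Longrightarrow> k \<noteq> j \<Longrightarrow> mfps_nth (mfps_var j * f) (axis i 1 + axis k 1) = 0"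
proof -
  have "axis j (1::nat) \<le> axis i 1 + axis j 1" by (simp add: less_eq_vec_def)
  then show "mfps_nth (mfps_var j * f) (axis i 1 + axis j 1) = mfps_nth f (axis i 1)"
    by (simp add: mfps_nth_var_mult)
  assume "i \<noteq> j" "k \<noteq> j"
  then have "\<not> axis j (1::nat) $ j \<le> (axis i 1 + axis k 1) $ j" by (simp add: axis_def)
  then have "\<not> axis j (1::nat) \<le> axis i 1 + axis k 1" unfolding less_eq_vec_def by blast
  then show "mfps_nth (mfps_var j * f) (axis i 1 + axis k 1) = 0" by (simp add: mfps_nth_var_mult)
qed

lemma mfps_nth_var_mult_axis: "mfps_nth (mfps_var j * f) (axis i 1) = (if i = j then mfps_nth f 0 else 0)"
proof -
  have "mfps_nth (mfps_var j) 0 = 0" by (simp add: mfps_nth_var axis_nat_neq_0[symmetric] del: axis_nat_neq_0)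
  then show ?thesis by (auto simp: mfps_nth_mult_axis mfps_nth_var)
qed

text \<open>
  Modulo terms of higher order the relation reads \<open>g t\<^sub>5 = h t\<^sub>3\<close>, which forces the linear parts of
  \<open>g\<close> and \<open>h\<close> to be \<open>c t\<^sub>3\<close> and \<open>c t\<^sub>5\<close>; evaluating on the two columns of the Gale dual gives \<open>c = 0\<close>.
\<close>

lemma den_ideal_subset:
  assumes "f \<in> den_ideal" shows "mfps_nth f 0 = 0" "lin1 f = 0"
proof -
  let ?U = "U_ideal mat_A"
  obtain m p where m: "m \<in> ideal_prod ?U (ideal_gen {tv 3, tv 5})" and p: "p \<in> ideal_gen {tv 2 * tv 3, tv 1 * tv 5}"
    and eq: "f * tv 5 = m + p"
    using assms unfolding den_ideal_def obstruction_den_def P_ideal_family M_ideal_family ideal_sum_def ideal_colon_def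
    by blast
  have "ideal_prod ?U (ideal_gen {tv 3, tv 5}) \<subseteq> {z. \<exists>x\<in>?U. \<exists>y\<in>?U. z = x * tv 3 + y * tv 5}" (is "_ \<subseteq> ?T")
    unfolding ideal_prod_def
  proof (rule ideal_gen_minimal)
    show "{a * b |a b. a \<in> ?U \<and> b \<in> ideal_gen {tv 3, tv 5}} \<subseteq> ?T"
    proof
      fix z assume "z \<in> {a * b |a b. a \<in> ?U \<and> b \<in> ideal_gen {tv 3, tv 5}}"
      then obtain a r s where a: "a \<in> ?U" and z: "z = a * (r * tv 3 + s * tv 5)"
        unfolding ideal_gen_pair by blast
      have "r * a \<in> ?U" "s * a \<in> ?U" using a unfolding U_ideal_eq by (simp_all add: ideal_gen_mult)
      moreover have "z = (r * a) * tv 3 + (s * a) * tv 5" unfolding z by (simp add: algebra_simps)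
      ultimately show "z \<in> ?T" by blast
    qed
    have U0: "0 \<in> ?U" unfolding U_ideal_eq by (rule ideal_gen_0)
    have "0 = 0 * tv 3 + 0 * tv 5" by simp
    then show "0 \<in> ?T" using U0 by blast
    show "z + z' \<in> ?T" if z: "z \<in> ?T" "z' \<in> ?T" for z z'
    proof -
      obtain x y x' y' where xy: "x \<in> ?U" "y \<in> ?U" "x' \<in> ?U" "y' \<in> ?U"
        "z = x * tv 3 + y * tv 5" "z' = x' * tv 3 + y' * tv 5" using z by blast
      have "x + x' \<in> ?U" "y + y' \<in> ?U" using xy unfolding U_ideal_eq by (simp_all add: ideal_gen_add)
      moreover have "z + z' = (x + x') * tv 3 + (y + y') * tv 5" unfolding xy by (simp add: algebra_simps)
      ultimately show ?thesis by blast
    qed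
    show "r * z \<in> ?T" if z: "z \<in> ?T" for r z
    proof -
      obtain x y where xy: "x \<in> ?U" "y \<in> ?U" "z = x * tv 3 + y * tv 5" using z by blast
      have "r * x \<in> ?U" "r * y \<in> ?U" using xy unfolding U_ideal_eq by (simp_all add: ideal_gen_mult)
      moreover have "r * z = (r * x) * tv 3 + (r * y) * tv 5" unfolding xy by (simp add: algebra_simps)
      ultimately show ?thesis by blast
    qed
  qed
  then obtain x y where x: "x \<in> ?U" and y: "y \<in> ?U" and m': "m = x * tv 3 + y * tv 5" using m by blast
  obtain r s where p': "p = r * (tv 2 * tv 3) + s * (tv 1 * tv 5)" using p unfolding ideal_gen_pair by blast
  \<comment> \<open>The equation f t5 = x t3 + y t5 + r t2 t3 + s t1 t5 is sorted by its factors t5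
    and t3.\<close>
  define g where "g = f - y - s * tv 1"
  define h where "h = x + r * tv 2"
  have gh: "tv 5 * g = tv 3 * h"
    using eq unfolding m' p' g_def h_def by (simp add: algebra_simps)
  have t0: "mfps_nth (mfps_var j) 0 = 0" for j :: 5
    by (simp add: mfps_nth_var axis_nat_neq_0[symmetric] del: axis_nat_neq_0)
  have g0: "mfps_nth g 0 = 0"
    using arg_cong[OF gh, of "\<lambda>z. mfps_nth z (axis 5 1)"] by (simp add: mfps_nth_var_mult_axis)
  have g: "mfps_nth g (axis j 1) = (if j = 3 then mfps_nth h (axis 5 1) else 0)" for j
  proof -
    have "mfps_nth g (axis j 1) = mfps_nth (tv 3 * h) (axis j 1 + axis 5 1)"
      unfolding gh[symmetric] by (rule mfps_nth_two_axes(1)[symmetric])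
    then show ?thesis
      using mfps_nth_two_axes(1)[of 3 h 5] mfps_nth_two_axes(2)[of j 3 5 h] by (auto simp: add.commute)
  qed
  have h: "mfps_nth h (axis j 1) = 0" if "j \<noteq> 5" for j
  proof -
    have "mfps_nth h (axis j 1) = mfps_nth (tv 5 * g) (axis j 1 + axis 3 1)"
      unfolding gh by (rule mfps_nth_two_axes(1)[symmetric])
    then show ?thesis using mfps_nth_two_axes(2)[of j 5 3 g] that by simp
  qed
  have "lin2 (r * tv 2) = mfps_nth r 0 * lin2 (tv 2)" "lin1 (r * tv 2) = mfps_nth r 0 * lin1 (tv 2)"
    "lin1 (s * tv 1) = mfps_nth s 0 * lin1 (tv 1)" by (rule lin_mult[OF t0])+
  then have tvs: "lin2 (r * tv 2) = - 4 * mfps_nth r 0" "lin1 (r * tv 2) = 3 * mfps_nth r 0" "lin1 (s * tv 1) = 0"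
    by (simp_all add: lin1_def lin2_def mfps_nth_var)
  \<comment> \<open>The linear part of \<open>h\<close> sits at t5, where the second column of B is
    zero. As \<open>lin2\<close> kills \<open>x\<close> and takes the value -4 on t2, the constant
    term of \<open>r\<close> vanishes; only then does the first column bear on the coefficient at
    t5.\<close>
  have "lin2 h = 0" using h by (simp add: lin2_def)
  then have "mfps_nth r 0 = 0" unfolding h_def lin_add tvs U_ideal_linear_part(3)[OF x] by simp
  then have "lin1 h = 0" unfolding h_def lin_add tvs U_ideal_linear_part(2)[OF x] by simp
  then have "mfps_nth h (axis 5 1) = 0" using h by (simp add: lin1_def)
  then have "lin1 g = 0" using g by (simp add: lin1_def)
  have f: "f = g + y + s * tv 1" by (simp add: g_def)
  show "mfps_nth f 0 = 0" unfolding f using g0 U_ideal_linear_part(1)[OF y] by (simp add: mfps_nth_mult_0 t0)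
  show "lin1 f = 0" unfolding f lin_add tvs U_ideal_linear_part(2)[OF y] \<open>lin1 g = 0\<close> by simp
qed

section \<open>Generators of the denominator and the quotient\<close>

lemma den_ideal_closed: "0 \<in> den_ideal" "f \<in> den_ideal \<Longrightarrow> g \<in> den_ideal \<Longrightarrow> f + g \<in> den_ideal"
  "f \<in> den_ideal \<Longrightarrow> r * f \<in> den_ideal"
  unfolding den_ideal_alt
  by (simp_all add: ideal_gen_0 distrib_right ideal_gen_add mult.assoc ideal_gen_mult)

lemma den_ideal_sum: "(\<And>i. i \<in> X \<Longrightarrow> f i \<in> den_ideal) \<Longrightarrow> (\<Sum>i\<in>X. f i) \<in> den_ideal"
  by (induction X rule: infinite_finite_induct) (simp_all add: den_ideal_closed)

lemma den_subset_num: "den_ideal \<subseteq> num_ideal"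
proof -
  have "ideal_gen ({a * b |a b. a \<in> ideal_gen (range row_form) \<and> b \<in> ideal_gen {tv 3, tv 5}} \<union> {tv 2 * tv 3, tv 1 * tv 5})
      \<subseteq> ideal_gen (range row_form \<union> {tv 2 * tv 3, tv 1 * tv 5})"
  proof (rule ideal_gen_subsetI)
    have "ideal_gen (range row_form) \<subseteq> ideal_gen (range row_form \<union> {tv 2 * tv 3, tv 1 * tv 5})"
      by (rule ideal_gen_subsetI) (auto intro: ideal_gen_base)
    then have "b * a \<in> ideal_gen (range row_form \<union> {tv 2 * tv 3, tv 1 * tv 5})" if "a \<in> ideal_gen (range row_form)" for a b
      using that by (intro ideal_gen_mult) blast
    then show "{a * b |a b. a \<in> ideal_gen (range row_form) \<and> b \<in> ideal_gen {tv 3, tv 5}} \<union> {tv 2 * tv 3, tv 1 * tv 5}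
        \<subseteq> ideal_gen (range row_form \<union> {tv 2 * tv 3, tv 1 * tv 5})"
      by (auto simp: mult.commute intro: ideal_gen_base)
  qed
  then show ?thesis unfolding num_ideal_alt den_ideal_alt by blast
qed

lemma mfps_const_mult_numeral: "mfps_const (inverse (numeral k)) * (numeral k * f) = f"
  by (simp add: mfps_eq_iff)

text \<open>Linear forms in U express relations among the rows of B; these two are 7 (3,-4) + 3
  (-7,0) - 28 (0,-1) = 0 and 7 (5,0) + 5 (-7,0) = 0.\<close>

lemma row_form_combination: "7 * tv 2 + 3 * tv 5 - 28 * tv 1 = row_form 1 + 3 * row_form 3"
  "7 * tv 3 + 5 * tv 5 = 4 * row_form 1 + 5 * row_form 3"
  unfolding row_form_eq by (simp_all add: algebra_simps)

text \<open>
  The class of \<open>t\<^sub>3\<close> generates the numerator modulo the denominator, and its square lies in the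
  denominator: both follow by multiplying \<open>7 t\<^sub>2 + 3 t\<^sub>5 - 28 t\<^sub>1\<close>, a combination of the rows, by
  \<open>t\<^sub>3\<close> and eliminating \<open>t\<^sub>1 t\<^sub>3\<close> with \<open>7 t\<^sub>3 + 5 t\<^sub>5\<close>, another one.
\<close>

lemma t3_t5_identity:
  "21 * (tv 3 * tv 5) = (7 * tv 3) * row_form 1 + (21 * tv 3) * row_form 3 - 49 * (tv 2 * tv 3)
     + 28 * (tv 1 * (4 * row_form 1 + 5 * row_form 3)) - 140 * (tv 1 * tv 5)"
  unfolding row_form_combination(2)[symmetric]
  unfolding row_form_eq by (simp add: algebra_simps)

lemma tv3_num: "tv 3 \<in> num_ideal"
proof -
  let ?I = "ideal_gen (range row_form \<union> {tv 2 * tv 3, tv 1 * tv 5})"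
  have b: "row_form i \<in> ?I" "tv 2 * tv 3 \<in> ?I" "tv 1 * tv 5 \<in> ?I" for i by (rule ideal_gen_base; simp)+
  have "21 * (tv 3 * tv 5) \<in> ?I"
    unfolding t3_t5_identity by (intro ideal_gen_add ideal_gen_diff ideal_gen_mult b)
  then have "mfps_const (inverse 21) * (21 * (tv 3 * tv 5)) \<in> ?I" by (rule ideal_gen_mult)
  then show ?thesis unfolding num_ideal_alt mfps_const_mult_numeral by simp
qed

lemma den_ideal_elements: "row_form i \<in> den_ideal" "tv 1 \<in> den_ideal" "tv 3 * tv 3 \<in> den_ideal"
proof -
  let ?P = "{a * b |a b. a \<in> ideal_gen (range row_form) \<and> b \<in> ideal_gen {tv 3, tv 5}}"
  let ?I = "ideal_gen (?P \<union> {tv 2 * tv 3, tv 1 * tv 5})"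
  have b: "row_form i * tv 3 \<in> ?I" "row_form i * tv 5 \<in> ?I" "tv 2 * tv 3 \<in> ?I" "tv 1 * tv 5 \<in> ?I" for i
  proof -
    have "row_form i \<in> ideal_gen (range row_form)" "tv 3 \<in> ideal_gen {tv 3, tv 5}" "tv 5 \<in> ideal_gen {tv 3, tv 5}"
      by (rule ideal_gen_base; simp)+
    then have "row_form i * tv 3 \<in> ?P" "row_form i * tv 5 \<in> ?P" by blast+
    then show "row_form i * tv 3 \<in> ?I" "row_form i * tv 5 \<in> ?I" by (auto intro: ideal_gen_base)
    show "tv 2 * tv 3 \<in> ?I" "tv 1 * tv 5 \<in> ?I" by (rule ideal_gen_base; simp)+
  qed
  show "row_form i \<in> den_ideal" "tv 1 \<in> den_ideal" unfolding den_ideal_alt using b by simp_all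
  \<comment> \<open>The identity for t3 t5 contains row forms multiplied by t1, which is not in M.
    After a further multiplication by t3 every row form has a cofactor in M.\<close>
  have "21 * (tv 3 * tv 3 * tv 5) = tv 3 * (21 * (tv 3 * tv 5))" by (simp add: algebra_simps)
  also have "\<dots> = (7 * tv 3) * (row_form 1 * tv 3) + (21 * tv 3) * (row_form 3 * tv 3) - (49 * tv 3) * (tv 2 * tv 3)
     + (112 * tv 1) * (row_form 1 * tv 3) + (140 * tv 1) * (row_form 3 * tv 3) - (140 * tv 3) * (tv 1 * tv 5)"
    unfolding t3_t5_identity by (simp add: algebra_simps)
  also have "\<dots> \<in> ?I" by (intro ideal_gen_add ideal_gen_diff ideal_gen_mult b)
  finally have "mfps_const (inverse 21) * (21 * (tv 3 * tv 3 * tv 5)) \<in> ?I" by (rule ideal_gen_mult)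
  then show "tv 3 * tv 3 \<in> den_ideal" unfolding den_ideal_alt mfps_const_mult_numeral by simp
qed

text \<open>The first column of B divided by its third entry, so that t3 itself has slope 1.\<close>

definition slope :: "5 \<Rightarrow> complex" where
  "slope j = (if j = 2 then 3 / 5 else if j = 3 then 1 else if j = 4 then - 1 / 5 else if j = 5 then - 7 / 5 else 0)"

text \<open>With t1 and the rows of A t in the denominator, row 1 is solved for t2, and then rows 2
  and 3 for t4 and t5.\<close>

lemma tv_mod_den: "tv j - mfps_const (slope j) * tv 3 \<in> den_ideal"
proof -
  have 1: "tv 1 - mfps_const (slope 1) * tv 3 = tv 1" by (simp add: slope_def mfps_eq_iff)
  have 2: "tv 2 - mfps_const (slope 2) * tv 3 = (4 * tv 1) + mfps_const (- 1 / 5) * row_form 1"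
    unfolding mfps_eq_iff row_form_eq mfps_nth_arith mfps_nth_const_mult mfps_nth_numeral_mult
    by (simp add: slope_def field_simps)
  have 3: "tv 3 - mfps_const (slope 3) * tv 3 = 0" by (simp add: slope_def mfps_eq_iff)
  have 4: "tv 4 - mfps_const (slope 4) * tv 3 = row_form 2 + 3 * tv 1 + mfps_const (- 2) * (tv 2 - mfps_const (slope 2) * tv 3)"
    unfolding mfps_eq_iff row_form_eq mfps_nth_arith mfps_nth_const_mult mfps_nth_numeral_mult
    by (simp add: slope_def field_simps)
  have 5: "tv 5 - mfps_const (slope 5) * tv 3 = row_form 3 + 16 * tv 1 + mfps_const (- 4) * (tv 2 - mfps_const (slope 2) * tv 3)"
    unfolding mfps_eq_iff row_form_eq mfps_nth_arith mfps_nth_const_mult mfps_nth_numeral_mult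
    by (simp add: slope_def field_simps)
  have D2: "tv 2 - mfps_const (slope 2) * tv 3 \<in> den_ideal"
    unfolding 2 by (intro den_ideal_closed(2,3) den_ideal_elements)
  have "tv 1 - mfps_const (slope 1) * tv 3 \<in> den_ideal" unfolding 1 by (rule den_ideal_elements)
  moreover have "tv 3 - mfps_const (slope 3) * tv 3 \<in> den_ideal" unfolding 3 by (rule den_ideal_closed)
  moreover have "tv 4 - mfps_const (slope 4) * tv 3 \<in> den_ideal"
    unfolding 4 by (intro den_ideal_closed(2,3) den_ideal_elements D2)
  moreover have "tv 5 - mfps_const (slope 5) * tv 3 \<in> den_ideal"
    unfolding 5 by (intro den_ideal_closed(2,3) den_ideal_elements D2)
  ultimately show ?thesis using D2 exhaust_5[of j] by auto
qed

text \<open>Each variable is congruent to a multiple of t3, and the square of t3 lies in the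
  denominator.\<close>

lemma tv3_mult_den:
  assumes "mfps_nth g 0 = 0" shows "tv 3 * g \<in> den_ideal"
proof -
  obtain h where g: "g = (\<Sum>j\<in>UNIV. tv j * h j)" using mfps_split_vars[OF assms] .
  have "tv 3 * (tv j * h j) \<in> den_ideal" for j
  proof -
    have "tv 3 * (tv j * h j) = (tv 3 * h j) * (tv j - mfps_const (slope j) * tv 3)
        + (h j * mfps_const (slope j)) * (tv 3 * tv 3)" by (simp add: algebra_simps)
    then show ?thesis by (simp add: den_ideal_closed tv_mod_den den_ideal_elements)
  qed
  then show ?thesis unfolding g sum_distrib_left by (intro den_ideal_sum)
qed

text \<open>Only the linear part of \<open>f\<close> survives, each variable being replaced by its
  multiple of t3. The divisor 5 is the value of \<open>lin1\<close> at t3.\<close>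

lemma mod_den:
  assumes "mfps_nth f 0 = 0" shows "f - mfps_const (lin1 f / 5) * tv 3 \<in> den_ideal"
proof -
  obtain g where f: "f = (\<Sum>j\<in>UNIV. tv j * g j)" using mfps_split_vars[OF assms] .
  define c where "c j = slope j * mfps_nth (g j) 0" for j
  have summand: "tv j * g j - mfps_const (c j) * tv 3 \<in> den_ideal" for j
  proof -
    have cc: "mfps_const (c j) = mfps_const (slope j) * mfps_const (mfps_nth (g j) 0)"
      unfolding mfps_eq_iff mfps_nth_const_mult by (simp add: mfps_const_def c_def)
    have "tv j * g j - mfps_const (c j) * tv 3 = g j * (tv j - mfps_const (slope j) * tv 3)
        + mfps_const (slope j) * (tv 3 * (g j - mfps_const (mfps_nth (g j) 0)))"
      unfolding cc by (simp add: algebra_simps)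
    moreover have "mfps_nth (g j - mfps_const (mfps_nth (g j) 0)) 0 = 0" by (simp add: mfps_const_def)
    ultimately show ?thesis by (simp add: den_ideal_closed tv_mod_den tv3_mult_den)
  qed
  have nth: "mfps_nth f (axis j 1) = mfps_nth (g j) 0" for j
    unfolding f by (simp add: mfps_nth_sum mfps_nth_var_mult_axis)
  have "lin1 f / 5 = (\<Sum>j\<in>UNIV. c j)"
    by (simp add: sum_5 c_def slope_def lin1_def nth field_simps)
  then have "(mfps_const (lin1 f / 5) :: 5 mfps) = (\<Sum>j\<in>UNIV. mfps_const (c j))"
    by (simp add: mfps_eq_iff mfps_nth_sum mfps_const_def)
  then have "f - mfps_const (lin1 f / 5) * tv 3 = (\<Sum>j\<in>UNIV. tv j * g j - mfps_const (c j) * tv 3)"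
    unfolding sum_subtractf f[symmetric] sum_distrib_right[symmetric] by simp
  also have "\<dots> \<in> den_ideal" by (rule den_ideal_sum) (rule summand)
  finally show ?thesis .
qed

lemma obstruction_dim:
  "quotient_has_dim (obstruction_num mat_A exp_v {{3, 4}, {4, 5}} (mfps_sqfree (nsupp exp_v - \<Inter>{{3, 4}, {4, 5}})))
     (obstruction_den mat_A exp_v {{3, 4}, {4, 5}} (mfps_sqfree (nsupp exp_v - \<Inter>{{3, 4}, {4, 5}}))) 1"
proof -
  have E: "nsupp exp_v - \<Inter>{{3, 4}, {4, 5}} = {5}" unfolding nsupp_exp_v Inter_family by auto
  have "quotient_has_dim num_ideal den_ideal 1"
    unfolding quotient_has_dim_def
  proof (intro conjI exI[of _ "{tv 3}"] ballI allI impI)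
    show "den_ideal \<subseteq> num_ideal" by (rule den_subset_num)
    show "{tv 3} \<subseteq> num_ideal" using tv3_num by simp
    fix f assume "f \<in> num_ideal"
    then have "f - mfps_const (lin1 f / 5) * tv 3 \<in> den_ideal" by (intro mod_den num_ideal_subset)
    then show "\<exists>c. f - (\<Sum>b\<in>{tv 3}. mfps_const (c b) * b) \<in> den_ideal"
      by (intro exI[of _ "\<lambda>_. lin1 f / 5"]) simp
  next
    fix c b assume "(\<Sum>b\<in>{tv 3}. mfps_const (c b) * b) \<in> den_ideal" and b: "b \<in> {tv 3}"
    \<comment> \<open>Independence: \<open>lin1\<close> vanishes on the denominator, while its value
      at t3 is 5.\<close>
    then have "lin1 (mfps_const (c (tv 3)) * tv 3) = 0" using den_ideal_subset(2) by simp
    then show "c b = 0" using b by (simp add: lin1_def mfps_nth_var)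
  qed simp_all
  then show ?thesis unfolding E mfps_sqfree_family num_ideal_def den_ideal_def .
qed

theorem theorem4p17:
  fixes A :: "int^5^3" and B :: "int^2^5"
    and \<theta> :: real and w :: "real^5" and v :: "complex^5" and \<beta> :: "complex^3"
    and N :: "5 set set"
  assumes "A = vector [vector [20, -5, 3, 0, 0],
                       vector [-3, 2, -1, 1, 0],
                       vector [-16, 4, -1, 0, 1]]"
    and "B = vector [vector [0, -1], vector [3, -4], vector [5, 0], vector [-1, 5], vector [-7, 0]]"
    and "\<theta> = 15 + sqrt 2 / 100"
    and "w = vector [\<theta> - 4, 1, 0, 0, 0]"
    and "v = vector [0, 1, 0, -2, -3]"
    and "\<beta> = map_matrix of_int A *v v"
    and "N = distinguished A w v"
  shows "full_row_rank A \<and> homogeneous_matrix A \<and> gale_dual A B \<and>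
    w v* map_matrix real_of_int B = vector [3, - \<theta>] \<and>
    \<beta> = vector [-5, 0, 1] \<and>
    generic_direction A \<beta> w \<and>
    fake_exponent A \<beta> w v \<and>
    N = {{3, 4}, {4, 5}} \<and>
    ordered_family A w v N \<and>
    (\<exists>\<iota> G. choice_H A v N \<iota> \<and> choice_E v N G) \<and>
    (\<forall>\<iota> G. choice_H A v N \<iota> \<and> choice_E v N G \<longrightarrow>
       J_amb A B v N \<iota> G = ideal_gen {mpoly_var 2, (mpoly_var 1)\<^sup>2} \<and>
       J_amb A B v N \<iota> G \<subset> J_intr A B v N) \<and>
    J_intr A B v N = ideal_gen {mpoly_var 1, mpoly_var 2} \<and>
    quotient_has_dim (obstruction_num A v N (mfps_sqfree (nsupp v - \<Inter>N)))
                     (obstruction_den A v N (mfps_sqfree (nsupp v - \<Inter>N))) 1"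
proof -
  have A: "A = mat_A" using assms(1) by (simp add: mat_A_def)
  have B: "B = mat_B" using assms(2) by (simp add: mat_B_def)
  have \<theta>: "\<theta> = theta" using assms(3) by (simp add: theta_def)
  have w: "w = dir_w" using assms(4) by (simp add: dir_w_def \<theta>)
  have v: "v = exp_v" using assms(5) by (simp add: exp_v_def)
  have \<beta>: "\<beta> = map_matrix of_int mat_A *v exp_v" using assms(6) by (simp only: A v)
  have N: "N = {{3, 4}, {4, 5}}" using assms(7) by (simp only: A v w distinguished_eq)
  \<comment> \<open>Exhibiting admissible choices keeps the clause quantified over all of them from
    being vacuous.\<close>
  have choice: "\<exists>\<iota> G. choice_H mat_A exp_v {{3, 4}, {4, 5}} \<iota> \<and> choice_E exp_v {{3, 4}, {4, 5}} G"
  proof -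
    have "{2, 3} \<noteq> {1, 5 :: 5}" unfolding set_5_eq_iff by simp
    then show ?thesis
      unfolding choice_H_family choice_E_family
      by (intro exI[of _ "\<lambda>H. if H = {2, 3} then {3} else {5}"] exI[of _ "{5}"]) auto
  qed
  show ?thesis
    unfolding A B \<theta> w v N
  proof (intro conjI)
    show "full_row_rank mat_A" by (rule full_row_rank_mat_A)
    show "homogeneous_matrix mat_A" by (rule homogeneous_mat_A)
    show "gale_dual mat_A mat_B" by (rule gale_dual_mat_B)
    show "dir_w v* map_matrix real_of_int mat_B = vector [3, - theta]" by (rule dir_w_mat_B)
    show "\<beta> = vector [-5, 0, 1]" unfolding \<beta> by (rule mat_A_exp_v)
    show "generic_direction mat_A \<beta> dir_w" by (rule generic_direction_dir_w)
    show "fake_exponent mat_A \<beta> dir_w exp_v" unfolding \<beta> by (rule fake_exponent_exp_v)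
    show "{{3, 4}, {4, 5}} = {{3, 4}, {4, 5 :: 5}}" ..
    show "ordered_family mat_A dir_w exp_v {{3, 4}, {4, 5}}" by (rule ordered_family_distinguished)
    show "J_intr mat_A mat_B exp_v {{3, 4}, {4, 5}} = ideal_gen {mpoly_var 1, mpoly_var 2}"
      by (rule J_intr_family)
    show "\<forall>\<iota> G. choice_H mat_A exp_v {{3, 4}, {4, 5}} \<iota> \<and> choice_E exp_v {{3, 4}, {4, 5}} G \<longrightarrow>
        J_amb mat_A mat_B exp_v {{3, 4}, {4, 5}} \<iota> G = ideal_gen {mpoly_var 2, (mpoly_var 1)\<^sup>2} \<and>
        J_amb mat_A mat_B exp_v {{3, 4}, {4, 5}} \<iota> G \<subset> J_intr mat_A mat_B exp_v {{3, 4}, {4, 5}}"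
    proof (intro allI impI)
      fix \<iota> :: "5 set \<Rightarrow> 5 set" and G :: "5 set"
      assume "choice_H mat_A exp_v {{3, 4}, {4, 5}} \<iota> \<and> choice_E exp_v {{3, 4}, {4, 5}} G"
      then have "J_amb mat_A mat_B exp_v {{3, 4}, {4, 5}} \<iota> G = ideal_gen {mpoly_var 2, (mpoly_var 1)\<^sup>2}"
        by (elim conjE) (rule J_amb_family)
      then show "J_amb mat_A mat_B exp_v {{3, 4}, {4, 5}} \<iota> G = ideal_gen {mpoly_var 2, (mpoly_var 1)\<^sup>2} \<and>
        J_amb mat_A mat_B exp_v {{3, 4}, {4, 5}} \<iota> G \<subset> J_intr mat_A mat_B exp_v {{3, 4}, {4, 5}}"
        using J_amb_subset_J_intr unfolding J_intr_family by simp
    qed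
  qed (rule choice obstruction_dim)+
qed

end
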